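(* Let $\Gamma$ be a finite, simplicial, triangle free graph. If $\Gamma$ contains an induced loop (induced cycle) $\sigma$ of length greater than $4$ such that the vertex set of $\sigma$ does not contain a pair of non-adjacent vertices of an induced 4-cycle in $\Gamma$, then the Morse boundary of the right-angled Coxeter group $G_\Gamma$ is not totally disconnected.
   Context: The right-angled Coxeter group $G_\Gamma$ has generating set the vertices of $\Gamma$ and relations $s^2=1$ for all vertices $s$ and $st=ts$ whenever $s,t$ are adjacent. A $(K,L)$-quasi-geodesic is a map $c$ from an interval of $\mathbb{R}$ to a metric space with $\frac1K|s-t|-L\le d(c(s),c(t))\le K|s-t|+L$. A geodesic ray is $N$-Morse (with Morse gauge $N$) if for every $K\ge1$, $C\ge0$ every $(K,C)$-quasi-geodesic with endpoints on it lies in its $N(K,C)$-neighborhood. Morse boundary: let $X$ be a proper geodesic space with basepoint $p$. $\partial_M X_p$ is the set of equivalence classes $[\alpha]$ of Morse geodesic rays $\alpha:[0,\infty)\to X$ with $\alpha(0)=p$, where $\alpha\sim\alpha'$ if $\sup_t d(\alpha(t),\alpha'(t))<\infty$. For a Morse gauge $N$, $\partial_M^N X_p$ is the set of classes containing at least one $N$-Morse geodesic ray starting at $p$. Declare $x_n\to x$ in $\partial_M^NX_p$ if there are $N$-Morse geodesic rays $\alpha_n$ from $p$ with $[\alpha_n]=x_n$ such that every subsequence of $(\alpha_n)$ has a further subsequence converging uniformly on compact sets to a geodesic ray $\alpha$ with $[\alpha]=x$; closed sets of $\partial_M^N X_p$ are those closed under such limits. Order Morse gauges pointwise; $\partial_M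 X_p=\varinjlim_N\partial_M^N X_p$ carries the direct limit topology. It is independent of basepoint and a quasi-isometry invariant; the Morse boundary of a finitely generated group is that of its Cayley graph with respect to a finite generating set. *)

theory Defs
  imports
    "HOL-Analysis.Analysis"
    "HOL-Algebra.Generated_Groups"
    "Graph_Theory.Pair_Digraph"
begin

section \<open>Finite simplicial graphs\<close>

text \<open>
  A finite simplicial graph is a \<open>pair_graph\<close>: finitely many vertices, and a
  symmetric irreflexive set of arcs.  \<open>u\<close> and \<open>v\<close> are adjacent iff \<open>(u, v)\<close> is an arc.
\<close>

definition triangle_free :: "'a pair_pre_digraph \<Rightarrow> bool" where
  "triangle_free \<Gamma> \<longleftrightarrow>
     \<not> (\<exists>u v w. (u, v) \<in> parcs \<Gamma> \<and> (v, w) \<in> parcs \<Gamma> \<and> (w, u) \<in> parcs \<Gamma>)"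

text \<open>
  The list is the cyclic enumeration of the vertices of the cycle, without repeating the
  first vertex at the end; its length is the length of the cycle.
\<close>

definition induced_cycle :: "'a pair_pre_digraph \<Rightarrow> 'a list \<Rightarrow> bool" where
  "induced_cycle \<Gamma> c \<longleftrightarrow>
     3 \<le> length c \<and> distinct c \<and> set c \<subseteq> pverts \<Gamma> \<and>
     (\<forall>i < length c. \<forall>j < length c.
        (c ! i, c ! j) \<in> parcs \<Gamma> \<longleftrightarrow> j = Suc i mod length c \<or> i = Suc j mod length c)"


section \<open>Group presentations and right-angled Coxeter groups\<close>

text \<open>The letter \<open>(True, s)\<close> stands for the generator \<open>s\<close>, and \<open>(False, s)\<close> for its inverse.\<close>

type_synonym 'a gword = "(bool \<times> 'a) list"

definition gwords :: "'a set \<Rightarrow> 'a gword set" where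
  "gwords S = lists (UNIV \<times> S)"

text \<open>A relation \<open>u = v\<close> of a presentation is encoded as the pair of words \<open>(u, v)\<close>.\<close>

inductive_set pres_rel :: "'a set \<Rightarrow> 'a gword rel \<Rightarrow> 'a gword rel"
  for S :: "'a set" and R :: "'a gword rel" where
  refl: "w \<in> gwords S \<Longrightarrow> (w, w) \<in> pres_rel S R"
| sym: "(u, v) \<in> pres_rel S R \<Longrightarrow> (v, u) \<in> pres_rel S R"
| trans: "(u, v) \<in> pres_rel S R \<Longrightarrow> (v, w) \<in> pres_rel S R \<Longrightarrow> (u, w) \<in> pres_rel S R"
| cancel: "a \<in> gwords S \<Longrightarrow> b \<in> gwords S \<Longrightarrow> s \<in> S \<Longrightarrow>
    (a @ [(e, s), (\<not> e, s)] @ b, a @ b) \<in> pres_rel S R"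
| relator: "a \<in> gwords S \<Longrightarrow> b \<in> gwords S \<Longrightarrow> (u, v) \<in> R \<Longrightarrow> u \<in> gwords S \<Longrightarrow> v \<in> gwords S \<Longrightarrow>
    (a @ u @ b, a @ v @ b) \<in> pres_rel S R"

definition presented_group :: "'a set \<Rightarrow> 'a gword rel \<Rightarrow> 'a gword set monoid" where
  "presented_group S R =
     \<lparr> carrier = gwords S // pres_rel S R,
       mult = (\<lambda>A B. \<Union>u\<in>A. \<Union>v\<in>B. pres_rel S R `` {u @ v}),
       one = pres_rel S R `` {[]} \<rparr>"

definition presented_gens :: "'a set \<Rightarrow> 'a gword rel \<Rightarrow> 'a gword set set" where
  "presented_gens S R = (\<lambda>s. pres_rel S R `` {[(True, s)]}) ` S"

definition racg_relations :: "'a pair_pre_digraph \<Rightarrow> 'a gword rel" where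
  "racg_relations \<Gamma> =
     {([(True, s), (True, s)], []) | s. s \<in> pverts \<Gamma>} \<union>
     {([(True, s), (True, t)], [(True, t), (True, s)]) | s t. (s, t) \<in> parcs \<Gamma>}"

definition racg :: "'a pair_pre_digraph \<Rightarrow> 'a gword set monoid" where
  "racg \<Gamma> = presented_group (pverts \<Gamma>) (racg_relations \<Gamma>)"

definition racg_gens :: "'a pair_pre_digraph \<Rightarrow> 'a gword set set" where
  "racg_gens \<Gamma> = presented_gens (pverts \<Gamma>) (racg_relations \<Gamma>)"

lemma gwords_simps [simp]:
  "[] \<in> gwords S" "u @ v \<in> gwords S \<longleftrightarrow> u \<in> gwords S \<and> v \<in> gwords S"
  "x # u \<in> gwords S \<longleftrightarrow> snd x \<in> S \<and> u \<in> gwords S"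
  by (cases x; auto simp: gwords_def)+

lemma pres_rel_gwords:
  assumes "(u, v) \<in> pres_rel S R"
  shows "u \<in> gwords S \<and> v \<in> gwords S"
  using assms by induction auto

lemma equiv_pres_rel: "equiv (gwords S) (pres_rel S R)"
proof (rule equivI)
  show "pres_rel S R \<subseteq> gwords S \<times> gwords S"
    using pres_rel_gwords by auto
  show "refl_on (gwords S) (pres_rel S R)"
    using pres_rel_gwords by (fastforce intro!: refl_onI pres_rel.refl)
  show "sym (pres_rel S R)"
    by (auto intro: symI pres_rel.sym)
  show "trans (pres_rel S R)"
    by (auto intro: transI pres_rel.trans)
qed

lemma pres_rel_context:
  assumes "(u, v) \<in> pres_rel S R" "a \<in> gwords S" "b \<in> gwords S"
  shows "(a @ u @ b, a @ v @ b) \<in> pres_rel S R"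
  using assms
proof induction
  case (cancel c d s e)
  then show ?case using pres_rel.cancel[of "a @ c" S "d @ b" s e R] by simp
next
  case (relator c d u v)
  then show ?case using pres_rel.relator[of "a @ c" S "d @ b" u v R] by simp
next
  case (trans u v w)
  then show ?case by (blast intro: pres_rel.trans)
qed (simp add: pres_rel.refl, blast intro: pres_rel.sym)

lemma pres_rel_append:
  assumes "(u, u') \<in> pres_rel S R" "(v, v') \<in> pres_rel S R"
  shows "(u @ v, u' @ v') \<in> pres_rel S R"
proof (rule pres_rel.trans)
  show "(u @ v, u' @ v) \<in> pres_rel S R"
    using pres_rel_context[OF assms(1), of "[]" v] assms(2) pres_rel_gwords by fastforce
  show "(u' @ v, u' @ v') \<in> pres_rel S R"
    using pres_rel_context[OF assms(2), of u' "[]"] assms(1) pres_rel_gwords by fastforce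
qed

lemma presented_mult:
  assumes "u \<in> gwords S" "v \<in> gwords S"
  shows "pres_rel S R `` {u} \<otimes>\<^bsub>presented_group S R\<^esub> pres_rel S R `` {v} = pres_rel S R `` {u @ v}"
proof -
  have *: "pres_rel S R `` {u' @ v'} = pres_rel S R `` {u @ v}"
    if "(u, u') \<in> pres_rel S R" "(v, v') \<in> pres_rel S R" for u' v'
    using equiv_class_eq[OF equiv_pres_rel pres_rel_append[OF that]] by simp
  have "u \<in> pres_rel S R `` {u}" "v \<in> pres_rel S R `` {v}"
    using assms by (auto intro: pres_rel.refl)
  then have "(\<Union>u'\<in>pres_rel S R `` {u}. \<Union>v'\<in>pres_rel S R `` {v}. pres_rel S R `` {u' @ v'})
    = pres_rel S R `` {u @ v}"
    using * by blast
  then show ?thesis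
    by (simp add: presented_group_def)
qed

definition gword_inv :: "'a gword \<Rightarrow> 'a gword" where
  "gword_inv w = rev (map (\<lambda>(e, s). (\<not> e, s)) w)"

lemma gword_inv_gwords [simp]: "gword_inv w \<in> gwords S \<longleftrightarrow> w \<in> gwords S"
  by (induction w) (auto simp: gword_inv_def)

lemma gword_inv_left: "w \<in> gwords S \<Longrightarrow> (gword_inv w @ w, []) \<in> pres_rel S R"
proof (induction w)
  case Nil
  then show ?case by (auto simp: gword_inv_def intro: pres_rel.refl)
next
  case (Cons x w)
  obtain e s where x: "x = (e, s)" by (cases x)
  have "(gword_inv w @ [(\<not> e, s), (\<not> (\<not> e), s)] @ w, gword_inv w @ w) \<in> pres_rel S R"
    using Cons.prems x by (intro pres_rel.cancel) auto
  with Cons x show ?case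
    by (auto simp: gword_inv_def intro: pres_rel.trans)
qed

lemma presented_carrier:
  "carrier (presented_group S R) = (\<lambda>w. pres_rel S R `` {w}) ` gwords S"
  by (auto simp: presented_group_def quotient_def)

lemma presented_one: "\<one>\<^bsub>presented_group S R\<^esub> = pres_rel S R `` {[]}"
  by (simp add: presented_group_def)

theorem group_presented_group: "group (presented_group S R)"
proof (rule groupI)
  fix x assume "x \<in> carrier (presented_group S R)"
  then obtain w where w: "w \<in> gwords S" "x = pres_rel S R `` {w}"
    by (auto simp: presented_carrier)
  show "\<exists>y\<in>carrier (presented_group S R). y \<otimes>\<^bsub>presented_group S R\<^esub> x = \<one>\<^bsub>presented_group S R\<^esub>"
  proof (intro bexI)
    show "pres_rel S R `` {gword_inv w} \<in> carrier (presented_group S R)"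
      using w by (auto simp: presented_carrier)
    show "pres_rel S R `` {gword_inv w} \<otimes>\<^bsub>presented_group S R\<^esub> x = \<one>\<^bsub>presented_group S R\<^esub>"
      using w equiv_class_eq[OF equiv_pres_rel gword_inv_left[OF w(1)]]
      by (simp add: presented_mult presented_one)
  qed
qed (auto simp: presented_carrier presented_mult presented_one)

lemma presented_gens_subset: "presented_gens S R \<subseteq> carrier (presented_group S R)"
  by (auto simp: presented_gens_def presented_carrier)

theorem generate_presented_gens:
  "generate (presented_group S R) (presented_gens S R) = carrier (presented_group S R)"
proof -
  interpret group "presented_group S R" by (rule group_presented_group)
  have "pres_rel S R `` {w} \<in> generate (presented_group S R) (presented_gens S R)"
    if "w \<in> gwords S" for w
    using that
  proof (induction w)
    case Nil
    then show ?case by (metis generate.one presented_one)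
  next
    case (Cons x w)
    obtain e s where x: "x = (e, s)" by (cases x)
    have s: "s \<in> S" and w: "w \<in> gwords S" using Cons.prems x by auto
    have gen: "pres_rel S R `` {[(True, s)]} \<in> presented_gens S R"
      using s by (auto simp: presented_gens_def)
    have "([(False, s), (True, s)], []) \<in> pres_rel S R"
      using pres_rel.cancel[of "[]" S "[]" s False R] s by simp
    then have "pres_rel S R `` {[(False, s)]} \<otimes>\<^bsub>presented_group S R\<^esub> pres_rel S R `` {[(True, s)]}
      = \<one>\<^bsub>presented_group S R\<^esub>"
      using s by (simp add: presented_mult presented_one equiv_class_eq[OF equiv_pres_rel])
    then have "inv\<^bsub>presented_group S R\<^esub> (pres_rel S R `` {[(True, s)]}) = pres_rel S R `` {[(False, s)]}"
      using s by (intro inv_equality) (auto simp: presented_carrier)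
    then have "pres_rel S R `` {[x]} \<in> generate (presented_group S R) (presented_gens S R)"
      using generate.incl[OF gen, of "presented_group S R"] generate.inv[OF gen, of "presented_group S R"] x
      by (cases e) auto
    then have "pres_rel S R `` {[x]} \<otimes>\<^bsub>presented_group S R\<^esub> pres_rel S R `` {w}
      \<in> generate (presented_group S R) (presented_gens S R)"
      using Cons.IH[OF w] by (rule generate.eng)
    then show ?case
      using w s x by (simp add: presented_mult)
  qed
  then show ?thesis
    using generate_incl[OF presented_gens_subset] by (auto simp: presented_carrier)
qed


section \<open>Graphs as geodesic metric spaces; Cayley graphs\<close>

text \<open>
  The geometric realization is described by barycentric coordinates: a point is a function
  on the vertices that is supported on a single vertex or on the two endpoints of an edge.
  Each edge carries the metric of the unit interval, and the distance of two points is the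
  infimum of the lengths of the chains joining them, where consecutive members of a chain lie
  in a common closed edge.
\<close>

definition graph_cells :: "'v pair_pre_digraph \<Rightarrow> 'v set set" where
  "graph_cells \<Gamma> = {{v} | v. v \<in> pverts \<Gamma>} \<union> {{u, v} | u v. (u, v) \<in> parcs \<Gamma>}"

definition cell_points :: "'v set \<Rightarrow> ('v \<Rightarrow> real) set" where
  "cell_points c = {x. (\<forall>v. 0 \<le> x v) \<and> (\<forall>v. v \<notin> c \<longrightarrow> x v = 0) \<and> sum x c = 1}"

definition graph_points :: "'v pair_pre_digraph \<Rightarrow> ('v \<Rightarrow> real) set" where
  "graph_points \<Gamma> = (\<Union>c\<in>graph_cells \<Gamma>. cell_points c)"

text \<open>
  On the closed edge with endpoints \<open>u\<close> and \<open>v\<close>, the points \<open>(1 - s) u + s v\<close> and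
  \<open>(1 - t) u + t v\<close> have \<open>cell_dist\<close> equal to \<open>\<bar>s - t\<bar>\<close>.
\<close>

definition cell_dist :: "('v \<Rightarrow> real) \<Rightarrow> ('v \<Rightarrow> real) \<Rightarrow> real" where
  "cell_dist x y = (\<Sum>v | x v \<noteq> 0 \<or> y v \<noteq> 0. \<bar>x v - y v\<bar>) / 2"

definition chain_step :: "'v pair_pre_digraph \<Rightarrow> ('v \<Rightarrow> real) rel" where
  "chain_step \<Gamma> = {(x, y). \<exists>c\<in>graph_cells \<Gamma>. x \<in> cell_points c \<and> y \<in> cell_points c}"

definition chain_lengths :: "'v pair_pre_digraph \<Rightarrow> ('v \<Rightarrow> real) \<Rightarrow> ('v \<Rightarrow> real) \<Rightarrow> real set" where
  "chain_lengths \<Gamma> x y =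
     {(\<Sum>i<n. cell_dist (c i) (c (Suc i))) | n c.
        c 0 = x \<and> c n = y \<and> (\<forall>i<n. (c i, c (Suc i)) \<in> chain_step \<Gamma>)}"

definition graph_dist :: "'v pair_pre_digraph \<Rightarrow> ('v \<Rightarrow> real) \<Rightarrow> ('v \<Rightarrow> real) \<Rightarrow> real" where
  "graph_dist \<Gamma> x y =
     (if x \<in> graph_points \<Gamma> \<and> y \<in> graph_points \<Gamma> then Inf (chain_lengths \<Gamma> x y) else 0)"

text \<open>Meaningful for connected graphs only, see \<open>Metric_space_graph\<close> below.\<close>

definition graph_metric :: "'v pair_pre_digraph \<Rightarrow> ('v \<Rightarrow> real) metric" where
  "graph_metric \<Gamma> = metric (graph_points \<Gamma>, graph_dist \<Gamma>)"

definition vertex_point :: "'v \<Rightarrow> 'v \<Rightarrow> real" where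
  "vertex_point v = (\<lambda>u. of_bool (u = v))"

definition cayley_graph :: "('g, 'b) monoid_scheme \<Rightarrow> 'g set \<Rightarrow> 'g pair_pre_digraph" where
  "cayley_graph G S =
     \<lparr> pverts = carrier G,
       parcs = {(g, g \<otimes>\<^bsub>G\<^esub> s) | g s. g \<in> carrier G \<and> s \<in> S} \<union>
               {(g \<otimes>\<^bsub>G\<^esub> s, g) | g s. g \<in> carrier G \<and> s \<in> S} \<rparr>"

lemma finite_graph_cell: "c \<in> graph_cells \<Gamma> \<Longrightarrow> finite c"
  by (auto simp: graph_cells_def)

lemma finite_support_graph_point:
  assumes "x \<in> graph_points \<Gamma>"
  shows "finite {v. x v \<noteq> 0}"
proof -
  obtain c where "c \<in> graph_cells \<Gamma>" "x \<in> cell_points c"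
    using assms by (auto simp: graph_points_def)
  then show ?thesis
    using finite_subset[OF _ finite_graph_cell, of "{v. x v \<noteq> 0}" c] by (auto simp: cell_points_def)
qed

lemma cell_dist_eq_sum:
  assumes "finite F" "{v. x v \<noteq> 0} \<subseteq> F" "{v. y v \<noteq> 0} \<subseteq> F"
  shows "cell_dist x y = (\<Sum>v\<in>F. \<bar>x v - y v\<bar>) / 2"
  unfolding cell_dist_def using assms by (auto intro!: sum.mono_neutral_left)

lemma cell_dist_nonneg: "0 \<le> cell_dist x y"
  by (simp add: cell_dist_def sum_nonneg)

lemma cell_dist_commute: "cell_dist x y = cell_dist y x"
  by (simp add: cell_dist_def abs_minus_commute disj_commute)

lemma cell_dist_triangle:
  assumes "x \<in> graph_points \<Gamma>" "y \<in> graph_points \<Gamma>" "z \<in> graph_points \<Gamma>"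
  shows "cell_dist x z \<le> cell_dist x y + cell_dist y z"
proof -
  define F where "F = {v. x v \<noteq> 0} \<union> {v. y v \<noteq> 0} \<union> {v. z v \<noteq> 0}"
  have F: "finite F" "{v. x v \<noteq> 0} \<subseteq> F" "{v. y v \<noteq> 0} \<subseteq> F" "{v. z v \<noteq> 0} \<subseteq> F"
    using assms by (auto simp: F_def finite_support_graph_point)
  have "(\<Sum>v\<in>F. \<bar>x v - z v\<bar>) \<le> (\<Sum>v\<in>F. \<bar>x v - y v\<bar> + \<bar>y v - z v\<bar>)"
    by (intro sum_mono) linarith
  then show ?thesis
    using F by (simp add: cell_dist_eq_sum sum.distrib)
qed

lemma cell_dist_zero:
  assumes "x \<in> graph_points \<Gamma>" "y \<in> graph_points \<Gamma>" "cell_dist x y = 0"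
  shows "x = y"
proof -
  have "finite ({v. x v \<noteq> 0} \<union> {v. y v \<noteq> 0})"
    using assms finite_support_graph_point by blast
  then have "finite {v. x v \<noteq> 0 \<or> y v \<noteq> 0}"
    by (simp only: Collect_disj_eq)
  then have "\<forall>v\<in>{v. x v \<noteq> 0 \<or> y v \<noteq> 0}. \<bar>x v - y v\<bar> = 0"
    using assms(3) by (simp add: cell_dist_def sum_nonneg_eq_0_iff)
  then show ?thesis
    by fastforce
qed

lemma chain_step_points: "(x, y) \<in> chain_step \<Gamma> \<Longrightarrow> x \<in> graph_points \<Gamma> \<and> y \<in> graph_points \<Gamma>"
  by (auto simp: chain_step_def graph_points_def)

lemma chain_step_sym: "(x, y) \<in> chain_step \<Gamma> \<Longrightarrow> (y, x) \<in> chain_step \<Gamma>"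
  by (auto simp: chain_step_def)

lemma chain_lengths_lower:
  assumes "l \<in> chain_lengths \<Gamma> x y" "x \<in> graph_points \<Gamma>"
  shows "cell_dist x y \<le> l"
proof -
  obtain n c where c: "c 0 = x" "c n = y" "\<And>i. i < n \<Longrightarrow> (c i, c (Suc i)) \<in> chain_step \<Gamma>"
    and l: "l = (\<Sum>i<n. cell_dist (c i) (c (Suc i)))"
    using assms by (auto simp: chain_lengths_def)
  have "c k \<in> graph_points \<Gamma> \<and> cell_dist x (c k) \<le> (\<Sum>i<k. cell_dist (c i) (c (Suc i)))"
    if "k \<le> n" for k
    using that
  proof (induction k)
    case 0
    then show ?case using c assms(2) by (simp add: cell_dist_def)
  next
    case (Suc k)
    then have s: "(c k, c (Suc k)) \<in> chain_step \<Gamma>" using c(3) by auto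
    then show ?case
      using Suc chain_step_points[OF s] cell_dist_triangle[of x \<Gamma> "c k" "c (Suc k)"] assms(2)
      by auto
  qed
  from this[of n] show ?thesis using c l by simp
qed

lemma chain_lengths_append:
  assumes "l \<in> chain_lengths \<Gamma> x y" "m \<in> chain_lengths \<Gamma> y z"
  shows "l + m \<in> chain_lengths \<Gamma> x z"
proof -
  obtain n c where c: "c 0 = x" "c n = y" "\<And>i. i < n \<Longrightarrow> (c i, c (Suc i)) \<in> chain_step \<Gamma>"
    and l: "l = (\<Sum>i<n. cell_dist (c i) (c (Suc i)))"
    using assms(1) by (auto simp: chain_lengths_def)
  obtain k e where e: "e 0 = y" "e k = z" "\<And>i. i < k \<Longrightarrow> (e i, e (Suc i)) \<in> chain_step \<Gamma>"
    and m: "m = (\<Sum>i<k. cell_dist (e i) (e (Suc i)))"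
    using assms(2) by (auto simp: chain_lengths_def)
  define f where "f = (\<lambda>i. if i \<le> n then c i else e (i - n))"
  have f1: "f i = c i" if "i \<le> n" for i using that by (simp add: f_def)
  have f2: "f (n + i) = e i" for i using c e by (cases i) (auto simp: f_def)
  have "(\<Sum>i<n + k. cell_dist (f i) (f (Suc i)))
      = (\<Sum>i<n. cell_dist (f i) (f (Suc i))) + (\<Sum>i<k. cell_dist (f (n + i)) (f (Suc (n + i))))"
    by (induction k) (auto simp: algebra_simps)
  also have "\<dots> = l + m"
    using f1 f2[of "Suc _"] f2 by (simp add: l m)
  finally have sum: "l + m = (\<Sum>i<n + k. cell_dist (f i) (f (Suc i)))" by simp
  have step: "(f i, f (Suc i)) \<in> chain_step \<Gamma>" if i: "i < n + k" for i
  proof (cases "i < n")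
    case True
    then show ?thesis using c(3) f1 by simp
  next
    case False
    then obtain j where "i = n + j" "j < k"
      using i by (metis add_less_cancel_left le_Suc_ex not_less)
    then show ?thesis using e(3) f2[of j] f2[of "Suc j"] by simp
  qed
  have "f 0 = x" "f (n + k) = z" using f1[of 0] f2[of k] c e by auto
  with sum step show ?thesis
    unfolding chain_lengths_def by blast
qed

lemma chain_lengths_rev:
  assumes "l \<in> chain_lengths \<Gamma> x y"
  shows "l \<in> chain_lengths \<Gamma> y x"
proof -
  obtain n c where c: "c 0 = x" "c n = y" "\<And>i. i < n \<Longrightarrow> (c i, c (Suc i)) \<in> chain_step \<Gamma>"
    and l: "l = (\<Sum>i<n. cell_dist (c i) (c (Suc i)))"
    using assms(1) by (auto simp: chain_lengths_def)
  define f where "f = (\<lambda>i. c (n - i))"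
  have "(\<Sum>i<n. cell_dist (f i) (f (Suc i))) = (\<Sum>i<n. cell_dist (c (n - Suc i)) (c (Suc (n - Suc i))))"
    by (intro sum.cong) (auto simp: f_def cell_dist_commute Suc_diff_Suc)
  also have "\<dots> = l"
    unfolding l by (rule sum.nat_diff_reindex)
  finally have sum: "l = (\<Sum>i<n. cell_dist (f i) (f (Suc i)))" by simp
  have "(f i, f (Suc i)) \<in> chain_step \<Gamma>" if "i < n" for i
    using c(3)[of "n - Suc i"] that by (auto simp: f_def Suc_diff_Suc intro: chain_step_sym)
  moreover have "f 0 = y" "f n = x" using c by (auto simp: f_def)
  ultimately show ?thesis
    using sum unfolding chain_lengths_def by blast
qed

lemma vertex_point_cell: "finite c \<Longrightarrow> v \<in> c \<Longrightarrow> vertex_point v \<in> cell_points c"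
  by (auto simp: vertex_point_def cell_points_def of_bool_def)

lemma vertex_point_graph_points: "v \<in> pverts \<Gamma> \<Longrightarrow> vertex_point v \<in> graph_points \<Gamma>"
  unfolding graph_points_def graph_cells_def using vertex_point_cell[of "{v}" v] by auto

theorem Metric_space_graph:
  assumes wf: "parcs \<Gamma> \<subseteq> pverts \<Gamma> \<times> pverts \<Gamma>"
    and con: "\<And>u v. u \<in> pverts \<Gamma> \<Longrightarrow> v \<in> pverts \<Gamma> \<Longrightarrow> (u, v) \<in> (parcs \<Gamma>)\<^sup>*"
  shows "Metric_space (graph_points \<Gamma>) (graph_dist \<Gamma>)"
proof -
  let ?P = "graph_points \<Gamma>"
  have edges: "(vertex_point u, vertex_point v) \<in> (chain_step \<Gamma>)\<^sup>*" if "(u, v) \<in> (parcs \<Gamma>)\<^sup>*" for u v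
    using that
  proof induction
    case (step v w)
    then have "{v, w} \<in> graph_cells \<Gamma>" by (auto simp: graph_cells_def)
    then have "(vertex_point v, vertex_point w) \<in> chain_step \<Gamma>"
      unfolding chain_step_def using vertex_point_cell[of "{v, w}"] by auto
    with step show ?case by auto
  qed auto
  have to_vertex: "\<exists>v\<in>pverts \<Gamma>. (x, vertex_point v) \<in> chain_step \<Gamma>" if x: "x \<in> ?P" for x
  proof -
    obtain c where c: "c \<in> graph_cells \<Gamma>" "x \<in> cell_points c"
      using x by (auto simp: graph_points_def)
    then obtain v where v: "v \<in> c" "v \<in> pverts \<Gamma>"
      using wf by (auto simp: graph_cells_def)
    then have "vertex_point v \<in> cell_points c"
      using vertex_point_cell[OF finite_graph_cell[OF c(1)]] by simp
    with c have "(x, vertex_point v) \<in> chain_step \<Gamma>"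
      unfolding chain_step_def by blast
    with v(2) show ?thesis by (rule bexI[rotated])
  qed
  have ne: "chain_lengths \<Gamma> x y \<noteq> {}" if xy: "x \<in> ?P" "y \<in> ?P" for x y
  proof -
    obtain u where u: "u \<in> pverts \<Gamma>" "(x, vertex_point u) \<in> chain_step \<Gamma>"
      using to_vertex xy by blast
    obtain v where v: "v \<in> pverts \<Gamma>" "(y, vertex_point v) \<in> chain_step \<Gamma>"
      using to_vertex xy by blast
    have "(x, y) \<in> (chain_step \<Gamma>)\<^sup>*"
      using u edges[OF con[OF u(1) v(1)]] chain_step_sym[OF v(2)]
      by (meson converse_rtrancl_into_rtrancl rtrancl.rtrancl_into_rtrancl)
    then obtain n where "(x, y) \<in> chain_step \<Gamma> ^^ n"
      using rtrancl_imp_relpow by blast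
    then show ?thesis
      by (auto simp: relpow_fun_conv chain_lengths_def)
  qed
  have bdd: "bdd_below (chain_lengths \<Gamma> x y)" if "x \<in> ?P" for x y
    using chain_lengths_lower[OF _ that] by (auto intro!: bdd_belowI)
  have lower: "cell_dist x y \<le> graph_dist \<Gamma> x y" if "x \<in> ?P" "y \<in> ?P" for x y
    using that ne[OF that] chain_lengths_lower[of _ \<Gamma> x y]
    by (auto simp: graph_dist_def intro!: cInf_greatest)
  show ?thesis
  proof
    fix x y
    show "0 \<le> graph_dist \<Gamma> x y"
      using lower[of x y] cell_dist_nonneg[of x y] by (auto simp: graph_dist_def)
    have "chain_lengths \<Gamma> x y = chain_lengths \<Gamma> y x"
      by (auto intro: chain_lengths_rev)
    then show "graph_dist \<Gamma> x y = graph_dist \<Gamma> y x"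
      by (auto simp: graph_dist_def)
  next
    fix x y assume xy: "x \<in> ?P" "y \<in> ?P"
    show "graph_dist \<Gamma> x y = 0 \<longleftrightarrow> x = y"
    proof
      assume "graph_dist \<Gamma> x y = 0"
      then have "cell_dist x y = 0"
        using lower[OF xy] cell_dist_nonneg[of x y] by simp
      then show "x = y" using cell_dist_zero xy by blast
    next
      assume "x = y"
      have "0 \<in> chain_lengths \<Gamma> x x"
        unfolding chain_lengths_def by (rule CollectI, rule exI[of _ 0]) auto
      then have "graph_dist \<Gamma> x x \<le> 0"
        using xy bdd by (auto simp: graph_dist_def intro!: cInf_lower)
      then show "graph_dist \<Gamma> x y = 0"
        using lower[OF xy(1) xy(1)] cell_dist_nonneg[of x x] \<open>x = y\<close> by simp
    qed
  next
    fix x y z assume xyz: "x \<in> ?P" "y \<in> ?P" "z \<in> ?P"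
    have "Inf (chain_lengths \<Gamma> x z) - m \<le> l"
      if "l \<in> chain_lengths \<Gamma> x y" "m \<in> chain_lengths \<Gamma> y z" for l m
      using cInf_lower[OF chain_lengths_append[OF that] bdd[OF xyz(1)]] by simp
    then have "Inf (chain_lengths \<Gamma> x z) - m \<le> Inf (chain_lengths \<Gamma> x y)"
      if "m \<in> chain_lengths \<Gamma> y z" for m
      using that ne xyz by (intro cInf_greatest) auto
    then have "Inf (chain_lengths \<Gamma> x z) - Inf (chain_lengths \<Gamma> x y) \<le> m"
      if "m \<in> chain_lengths \<Gamma> y z" for m
      using that by force
    then have "Inf (chain_lengths \<Gamma> x z) - Inf (chain_lengths \<Gamma> x y) \<le> Inf (chain_lengths \<Gamma> y z)"
      using ne xyz by (intro cInf_greatest) auto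
    then show "graph_dist \<Gamma> x z \<le> graph_dist \<Gamma> x y + graph_dist \<Gamma> y z"
      using xyz by (simp add: graph_dist_def)
  qed
qed

lemma cayley_graph_wf:
  assumes "group G" "S \<subseteq> carrier G"
  shows "parcs (cayley_graph G S) \<subseteq> pverts (cayley_graph G S) \<times> pverts (cayley_graph G S)"
proof -
  interpret group G by fact
  show ?thesis using assms(2) by (auto simp: cayley_graph_def)
qed

lemma cayley_graph_connected:
  assumes "group G" "S \<subseteq> carrier G" "generate G S = carrier G" "g \<in> carrier G" "h \<in> carrier G"
  shows "(g, h) \<in> (parcs (cayley_graph G S))\<^sup>*"
proof -
  interpret group G by fact
  let ?E = "parcs (cayley_graph G S)"
  have *: "(g, g \<otimes>\<^bsub>G\<^esub> k) \<in> ?E\<^sup>*" if "k \<in> generate G S" "g \<in> carrier G" for g k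
    using that
  proof (induction arbitrary: g)
    case (incl s)
    then have "(g, g \<otimes>\<^bsub>G\<^esub> s) \<in> ?E" by (auto simp: cayley_graph_def)
    then show ?case by (rule r_into_rtrancl)
  next
    case (inv s)
    then have s: "s \<in> carrier G" using assms(2) by auto
    have "((g \<otimes>\<^bsub>G\<^esub> inv\<^bsub>G\<^esub> s) \<otimes>\<^bsub>G\<^esub> s, g \<otimes>\<^bsub>G\<^esub> inv\<^bsub>G\<^esub> s) \<in> ?E"
      using inv s unfolding cayley_graph_def by fastforce
    moreover have "(g \<otimes>\<^bsub>G\<^esub> inv\<^bsub>G\<^esub> s) \<otimes>\<^bsub>G\<^esub> s = g"
      using inv s by (simp add: m_assoc)
    ultimately show ?case by auto
  next
    case (eng a b)
    then have ab: "a \<in> carrier G" "b \<in> carrier G" using assms(3) by auto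
    have "(g, g \<otimes>\<^bsub>G\<^esub> a) \<in> ?E\<^sup>*" "(g \<otimes>\<^bsub>G\<^esub> a, (g \<otimes>\<^bsub>G\<^esub> a) \<otimes>\<^bsub>G\<^esub> b) \<in> ?E\<^sup>*"
      using eng ab by auto
    then show ?case using ab eng.prems by (simp add: m_assoc)
  qed auto
  have "(g, g \<otimes>\<^bsub>G\<^esub> (inv\<^bsub>G\<^esub> g \<otimes>\<^bsub>G\<^esub> h)) \<in> ?E\<^sup>*"
    using assms by (intro *) auto
  then show ?thesis
    using assms(4,5) by (simp add: m_assoc[symmetric])
qed

corollary Metric_space_cayley_graph:
  assumes "group G" "S \<subseteq> carrier G" "generate G S = carrier G"
  shows "Metric_space (graph_points (cayley_graph G S)) (graph_dist (cayley_graph G S))"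
  using assms by (intro Metric_space_graph cayley_graph_wf cayley_graph_connected)
    (auto simp: cayley_graph_def)


section \<open>The Morse boundary\<close>

text \<open>
  Rays are functions on the reals of which only the values at nonnegative parameters matter;
  likewise only the restriction of a quasi-geodesic to its interval matters.
\<close>

definition geodesic_ray :: "'x metric \<Rightarrow> 'x \<Rightarrow> (real \<Rightarrow> 'x) \<Rightarrow> bool" where
  "geodesic_ray X p \<alpha> \<longleftrightarrow>
     \<alpha> ` {0..} \<subseteq> mspace X \<and> \<alpha> 0 = p \<and> (\<forall>s\<ge>0. \<forall>t\<ge>0. mdist X (\<alpha> s) (\<alpha> t) = \<bar>s - t\<bar>)"

definition quasi_geodesic :: "'x metric \<Rightarrow> real \<Rightarrow> real \<Rightarrow> real set \<Rightarrow> (real \<Rightarrow> 'x) \<Rightarrow> bool" where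
  "quasi_geodesic X K L I c \<longleftrightarrow>
     is_interval I \<and> c ` I \<subseteq> mspace X \<and>
     (\<forall>s\<in>I. \<forall>t\<in>I. 1 / K * \<bar>s - t\<bar> - L \<le> mdist X (c s) (c t) \<and>
                     mdist X (c s) (c t) \<le> K * \<bar>s - t\<bar> + L)"

text \<open>Only the values at \<open>K \<ge> 1\<close> and \<open>C \<ge> 0\<close> of a Morse gauge matter.\<close>

type_synonym gauge_fun = "real \<Rightarrow> real \<Rightarrow> real"

definition morse_gauge :: "gauge_fun \<Rightarrow> bool" where
  "morse_gauge N \<longleftrightarrow> (\<forall>K\<ge>1. \<forall>C\<ge>0. 0 \<le> N K C)"

definition morse_ray :: "'x metric \<Rightarrow> 'x \<Rightarrow> gauge_fun \<Rightarrow> (real \<Rightarrow> 'x) \<Rightarrow> bool" where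
  "morse_ray X p N \<alpha> \<longleftrightarrow>
     geodesic_ray X p \<alpha> \<and>
     (\<forall>K\<ge>1. \<forall>C\<ge>0. \<forall>a b c. a \<le> b \<and> quasi_geodesic X K C {a..b} c \<and>
        c a \<in> \<alpha> ` {0..} \<and> c b \<in> \<alpha> ` {0..} \<longrightarrow>
        (\<forall>t\<in>{a..b}. \<exists>s\<ge>0. mdist X (c t) (\<alpha> s) \<le> N K C))"

definition morse_rays :: "'x metric \<Rightarrow> 'x \<Rightarrow> (real \<Rightarrow> 'x) set" where
  "morse_rays X p = {\<alpha>. \<exists>N. morse_gauge N \<and> morse_ray X p N \<alpha>}"

definition asymptotic :: "'x metric \<Rightarrow> 'x \<Rightarrow> (real \<Rightarrow> 'x) rel" where
  "asymptotic X p = {(\<alpha>, \<beta>). \<alpha> \<in> morse_rays X p \<and> \<beta> \<in> morse_rays X p \<and>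
     bdd_above ((\<lambda>t. mdist X (\<alpha> t) (\<beta> t)) ` {0..})}"

definition morse_boundary :: "'x metric \<Rightarrow> 'x \<Rightarrow> (real \<Rightarrow> 'x) set set" where
  "morse_boundary X p = morse_rays X p // asymptotic X p"

definition morse_stratum :: "'x metric \<Rightarrow> 'x \<Rightarrow> gauge_fun \<Rightarrow> (real \<Rightarrow> 'x) set set" where
  "morse_stratum X p N = {x \<in> morse_boundary X p. \<exists>\<alpha>\<in>x. morse_ray X p N \<alpha>}"

definition ray_limit :: "'x metric \<Rightarrow> (nat \<Rightarrow> real \<Rightarrow> 'x) \<Rightarrow> (real \<Rightarrow> 'x) \<Rightarrow> bool" where
  "ray_limit X f \<alpha> \<longleftrightarrow>
     (\<forall>A. compact A \<and> A \<subseteq> {0..} \<longrightarrow>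
        (\<forall>\<epsilon>>0. \<forall>\<^sub>F n in sequentially. \<forall>t\<in>A. mdist X (f n t) (\<alpha> t) < \<epsilon>))"

text \<open>
  For \<open>x\<close> in the boundary, \<open>\<alpha> \<in> x\<close> says that \<open>\<alpha>\<close> is a Morse geodesic ray from \<open>p\<close> with
  class \<open>[\<alpha>] = x\<close>.
\<close>

definition stratum_converges ::
    "'x metric \<Rightarrow> 'x \<Rightarrow> gauge_fun \<Rightarrow> (nat \<Rightarrow> (real \<Rightarrow> 'x) set) \<Rightarrow> (real \<Rightarrow> 'x) set \<Rightarrow> bool" where
  "stratum_converges X p N xs x \<longleftrightarrow>
     (\<exists>\<alpha>s. (\<forall>n. morse_ray X p N (\<alpha>s n) \<and> \<alpha>s n \<in> xs n) \<and>
        (\<forall>r. strict_mono r \<longrightarrow>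
           (\<exists>q \<alpha>. strict_mono q \<and> geodesic_ray X p \<alpha> \<and> \<alpha> \<in> x \<and>
                 ray_limit X (\<alpha>s \<circ> (r :: nat \<Rightarrow> nat) \<circ> (q :: nat \<Rightarrow> nat)) \<alpha>)))"

definition stratum_closed :: "'x metric \<Rightarrow> 'x \<Rightarrow> gauge_fun \<Rightarrow> (real \<Rightarrow> 'x) set set \<Rightarrow> bool" where
  "stratum_closed X p N C \<longleftrightarrow>
     C \<subseteq> morse_stratum X p N \<and>
     (\<forall>xs x. (\<forall>n. xs n \<in> C) \<and> x \<in> morse_stratum X p N \<and> stratum_converges X p N xs x \<longrightarrow> x \<in> C)"

definition stratum_topology :: "'x metric \<Rightarrow> 'x \<Rightarrow> gauge_fun \<Rightarrow> (real \<Rightarrow> 'x) set topology" where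
  "stratum_topology X p N =
     topology (\<lambda>U. U \<subseteq> morse_stratum X p N \<and> stratum_closed X p N (morse_stratum X p N - U))"

text \<open>
  The bonding maps of the direct system are the inclusions of strata, which are continuous
  (\<open>continuous_map_stratum_inclusion\<close>), so the direct limit is the union of the strata with
  the final topology.
\<close>

definition morse_boundary_topology :: "'x metric \<Rightarrow> 'x \<Rightarrow> (real \<Rightarrow> 'x) set topology" where
  "morse_boundary_topology X p =
     topology (\<lambda>U. U \<subseteq> morse_boundary X p \<and>
       (\<forall>N. morse_gauge N \<longrightarrow> openin (stratum_topology X p N) (U \<inter> morse_stratum X p N)))"

text \<open>
  \<open>S\<close> is meant to be a finite generating set of \<open>G\<close>; the basepoint is the vertex \<open>\<one>\<close>
  of the Cayley graph.
\<close>

definition group_morse_boundary ::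
    "('g, 'b) monoid_scheme \<Rightarrow> 'g set \<Rightarrow> (real \<Rightarrow> 'g \<Rightarrow> real) set topology" where
  "group_morse_boundary G S =
     morse_boundary_topology (graph_metric (cayley_graph G S)) (vertex_point \<one>\<^bsub>G\<^esub>)"

lemma stratum_converges_subseq:
  assumes "stratum_converges X p N xs x" "strict_mono q"
  shows "stratum_converges X p N (xs \<circ> q) x"
proof -
  obtain \<alpha>s where \<alpha>: "\<And>n. morse_ray X p N (\<alpha>s n) \<and> \<alpha>s n \<in> xs n"
    and lim: "\<And>r :: nat \<Rightarrow> nat. strict_mono r \<Longrightarrow> \<exists>q \<alpha>. strict_mono q \<and> geodesic_ray X p \<alpha> \<and> \<alpha> \<in> x \<and>
                 ray_limit X (\<alpha>s \<circ> r \<circ> (q :: nat \<Rightarrow> nat)) \<alpha>"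
    using assms(1) unfolding stratum_converges_def by blast
  show ?thesis
    unfolding stratum_converges_def
  proof (intro exI[of _ "\<alpha>s \<circ> q"] conjI allI impI)
    fix r :: "nat \<Rightarrow> nat" assume "strict_mono r"
    then show "\<exists>q' \<alpha>. strict_mono q' \<and> geodesic_ray X p \<alpha> \<and> \<alpha> \<in> x \<and>
        ray_limit X (\<alpha>s \<circ> q \<circ> r \<circ> (q' :: nat \<Rightarrow> nat)) \<alpha>"
      using lim[of "q \<circ> r"] assms(2) by (simp add: strict_mono_o o_assoc)
  qed (use \<alpha> in auto)
qed

lemma stratum_closed_Un:
  assumes "stratum_closed X p N C" "stratum_closed X p N D"
  shows "stratum_closed X p N (C \<union> D)"
  unfolding stratum_closed_def
proof (intro conjI allI impI)
  show "C \<union> D \<subseteq> morse_stratum X p N"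
    using assms by (auto simp: stratum_closed_def)
next
  fix xs x
  assume *: "(\<forall>n. xs n \<in> C \<union> D) \<and> x \<in> morse_stratum X p N \<and> stratum_converges X p N xs x"
  have sub: "x \<in> E" if E: "stratum_closed X p N E" "infinite {n. xs n \<in> E}" for E
  proof -
    obtain q :: "nat \<Rightarrow> nat" where q: "strict_mono q" "\<And>n. q n \<in> {n. xs n \<in> E}"
      using infinite_enumerate[OF E(2)] by blast
    then have "stratum_converges X p N (xs \<circ> q) x"
      using stratum_converges_subseq[of X p N xs x q] * by simp
    then show ?thesis
      using E(1) q * unfolding stratum_closed_def by fastforce
  qed
  have "{n. xs n \<in> C} \<union> {n. xs n \<in> D} = UNIV" using * by auto
  then have "infinite {n. xs n \<in> C} \<or> infinite {n. xs n \<in> D}"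
    by (metis finite_UnI infinite_UNIV_nat)
  then show "x \<in> C \<union> D"
    using sub assms by blast
qed

lemma istopology_stratum:
  "istopology (\<lambda>U. U \<subseteq> morse_stratum X p N \<and> stratum_closed X p N (morse_stratum X p N - U))"
proof -
  let ?B = "morse_stratum X p N"
  have "stratum_closed X p N (?B - U \<inter> V)"
    if "stratum_closed X p N (?B - U)" "stratum_closed X p N (?B - V)" for U V
    using stratum_closed_Un[OF that] by (simp add: Diff_Int)
  moreover have "stratum_closed X p N (?B - \<Union>\<K>)"
    if K: "\<forall>K\<in>\<K>. K \<subseteq> ?B \<and> stratum_closed X p N (?B - K)" for \<K>
    unfolding stratum_closed_def
  proof (intro conjI allI impI)
    fix xs x
    assume *: "(\<forall>n. xs n \<in> ?B - \<Union>\<K>) \<and> x \<in> ?B \<and> stratum_converges X p N xs x"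
    have "x \<in> ?B - L" if "L \<in> \<K>" for L
    proof -
      have "stratum_closed X p N (?B - L)" using K that by simp
      moreover have "\<forall>n. xs n \<in> ?B - L" using * that by simp
      ultimately show ?thesis
        using * unfolding stratum_closed_def by (elim conjE allE[of _ xs] allE[of _ x]) simp
    qed
    then show "x \<in> ?B - \<Union>\<K>" using * by auto
  qed auto
  ultimately show ?thesis
    unfolding istopology_def by blast
qed

lemma openin_stratum_topology:
  "openin (stratum_topology X p N) U \<longleftrightarrow>
     U \<subseteq> morse_stratum X p N \<and> stratum_closed X p N (morse_stratum X p N - U)"
  unfolding stratum_topology_def by (simp add: topology_inverse'[OF istopology_stratum])

lemma topspace_stratum_topology [simp]: "topspace (stratum_topology X p N) = morse_stratum X p N"
proof -
  have "openin (stratum_topology X p N) (morse_stratum X p N)"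
    by (simp add: openin_stratum_topology stratum_closed_def)
  then show ?thesis
    by (metis openin_stratum_topology openin_subset openin_topspace subset_antisym)
qed

lemma closedin_stratum_topology: "closedin (stratum_topology X p N) C \<longleftrightarrow> stratum_closed X p N C"
  by (metis (no_types, lifting) Diff_Diff_Int Diff_subset closedin_def inf.absorb_iff2
      openin_stratum_topology stratum_closed_def topspace_stratum_topology)

lemma morse_ray_mono:
  assumes "morse_ray X p N \<alpha>" "\<And>K C. 1 \<le> K \<Longrightarrow> 0 \<le> C \<Longrightarrow> N K C \<le> N' K C"
  shows "morse_ray X p N' \<alpha>"
  using assms unfolding morse_ray_def by (meson order_trans)

lemma continuous_map_stratum_inclusion:
  assumes le: "\<And>K C. 1 \<le> K \<Longrightarrow> 0 \<le> C \<Longrightarrow> N K C \<le> N' K C"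
  shows "continuous_map (stratum_topology X p N) (stratum_topology X p N') id"
proof -
  have mono: "morse_ray X p N' \<alpha>" if "morse_ray X p N \<alpha>" for \<alpha>
    using that le by (rule morse_ray_mono[of X p N \<alpha> N'])
  have sub: "morse_stratum X p N \<subseteq> morse_stratum X p N'"
    using mono unfolding morse_stratum_def by blast
  have conv: "stratum_converges X p N' xs x" if c: "stratum_converges X p N xs x" for xs x
  proof -
    obtain \<alpha>s where \<alpha>: "\<And>n. morse_ray X p N (\<alpha>s n) \<and> \<alpha>s n \<in> xs n"
      and lim: "\<forall>r. strict_mono r \<longrightarrow> (\<exists>q \<alpha>. strict_mono q \<and> geodesic_ray X p \<alpha> \<and> \<alpha> \<in> x \<and>
                   ray_limit X (\<alpha>s \<circ> (r :: nat \<Rightarrow> nat) \<circ> (q :: nat \<Rightarrow> nat)) \<alpha>)"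
      using c unfolding stratum_converges_def by blast
    have "\<forall>n. morse_ray X p N' (\<alpha>s n) \<and> \<alpha>s n \<in> xs n"
      using \<alpha> mono by simp
    with lim show ?thesis
      unfolding stratum_converges_def by (intro exI[of _ \<alpha>s] conjI)
  qed
  have "stratum_closed X p N {x \<in> morse_stratum X p N. x \<in> C}" if "stratum_closed X p N' C" for C
    using that conv sub unfolding stratum_closed_def by blast
  moreover have "C \<subseteq> morse_stratum X p N'" if "stratum_closed X p N' C" for C
    using that by (simp add: stratum_closed_def)
  ultimately show ?thesis
    using sub unfolding continuous_map_closedin closedin_stratum_topology by auto
qed

lemma istopology_morse_boundary:
  "istopology (\<lambda>U. U \<subseteq> morse_boundary X p \<and>
     (\<forall>N. morse_gauge N \<longrightarrow> openin (stratum_topology X p N) (U \<inter> morse_stratum X p N)))"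
proof -
  have "openin (stratum_topology X p N) (U \<inter> V \<inter> morse_stratum X p N)"
    if "openin (stratum_topology X p N) (U \<inter> morse_stratum X p N)"
       "openin (stratum_topology X p N) (V \<inter> morse_stratum X p N)" for U V N
    using openin_Int[OF that] by (simp add: Int_ac)
  moreover have "openin (stratum_topology X p N) (\<Union>\<K> \<inter> morse_stratum X p N)"
    if "\<forall>K\<in>\<K>. openin (stratum_topology X p N) (K \<inter> morse_stratum X p N)" for \<K> N
    unfolding Int_Union2 using that by (intro openin_Union) auto
  ultimately show ?thesis
    unfolding istopology_def by (intro conjI allI impI) (simp_all add: le_infI1 Sup_le_iff)
qed

lemma openin_morse_boundary_topology:
  "openin (morse_boundary_topology X p) U \<longleftrightarrow>
     U \<subseteq> morse_boundary X p \<and>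
     (\<forall>N. morse_gauge N \<longrightarrow> openin (stratum_topology X p N) (U \<inter> morse_stratum X p N))"
  unfolding morse_boundary_topology_def by (simp add: topology_inverse'[OF istopology_morse_boundary])

lemma topspace_morse_boundary_topology [simp]:
  "topspace (morse_boundary_topology X p) = morse_boundary X p"
proof -
  have "morse_boundary X p \<inter> morse_stratum X p N = morse_stratum X p N" for N
    by (auto simp: morse_stratum_def)
  then have "openin (morse_boundary_topology X p) (morse_boundary X p)"
    by (simp add: openin_morse_boundary_topology openin_stratum_topology stratum_closed_def)
  then show ?thesis
    by (metis openin_morse_boundary_topology openin_subset openin_topspace subset_antisym)
qed

lemma equiv_asymptotic: "equiv (morse_rays X p) (asymptotic X p)"
proof (rule equivI)
  show "asymptotic X p \<subseteq> morse_rays X p \<times> morse_rays X p"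
    by (auto simp: asymptotic_def)
  have mem: "\<alpha> t \<in> mspace X" if "\<alpha> \<in> morse_rays X p" "0 \<le> t" for \<alpha> t
    using that by (auto simp: morse_rays_def morse_ray_def geodesic_ray_def)
  show "refl_on (morse_rays X p) (asymptotic X p)"
  proof (rule refl_onI)
    fix \<alpha> assume "\<alpha> \<in> morse_rays X p"
    moreover from this have "mdist X (\<alpha> t) (\<alpha> t) \<le> 0" if "0 \<le> t" for t
      using mem[OF \<open>\<alpha> \<in> morse_rays X p\<close> that] by (metis mdist_zero order_refl)
    ultimately show "(\<alpha>, \<alpha>) \<in> asymptotic X p"
      by (auto simp: asymptotic_def intro!: bdd_aboveI2)
  qed
  show "sym (asymptotic X p)"
    by (rule symI) (auto simp: asymptotic_def mdist_commute)
  show "trans (asymptotic X p)"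
  proof (rule transI)
    fix \<alpha> \<beta> \<gamma> assume *: "(\<alpha>, \<beta>) \<in> asymptotic X p" "(\<beta>, \<gamma>) \<in> asymptotic X p"
    then obtain A B where "\<And>t. 0 \<le> t \<Longrightarrow> mdist X (\<alpha> t) (\<beta> t) \<le> A" "\<And>t. 0 \<le> t \<Longrightarrow> mdist X (\<beta> t) (\<gamma> t) \<le> B"
      by (auto simp: asymptotic_def bdd_above_def)
    moreover have "mdist X (\<alpha> t) (\<gamma> t) \<le> mdist X (\<alpha> t) (\<beta> t) + mdist X (\<beta> t) (\<gamma> t)" if "0 \<le> t" for t
      using * that mem by (intro mdist_triangle) (auto simp: asymptotic_def)
    ultimately have "mdist X (\<alpha> t) (\<gamma> t) \<le> A + B" if "0 \<le> t" for t
      using that by (meson add_mono order_trans)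
    then show "(\<alpha>, \<gamma>) \<in> asymptotic X p"
      using * by (auto simp: asymptotic_def intro!: bdd_aboveI2)
  qed
qed

lemma morse_boundary_Union: "morse_boundary X p = (\<Union>N\<in>Collect morse_gauge. morse_stratum X p N)"
proof -
  have "\<exists>N. morse_gauge N \<and> (\<exists>\<alpha>\<in>x. morse_ray X p N \<alpha>)" if x: "x \<in> morse_boundary X p" for x
  proof -
    obtain \<alpha> where "\<alpha> \<in> morse_rays X p" "x = asymptotic X p `` {\<alpha>}"
      using x by (auto simp: morse_boundary_def elim: quotientE)
    then have "\<alpha> \<in> x"
      using equiv_class_self[OF equiv_asymptotic] by metis
    then show ?thesis
      using \<open>\<alpha> \<in> morse_rays X p\<close> unfolding morse_rays_def by blast
  qed
  then show ?thesis
    by (auto simp: morse_stratum_def)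
qed


section \<open>Right-angled Coxeter groups: specialization\<close>

lemma graph_metric_racg:
  "mspace (graph_metric (cayley_graph (racg \<Gamma>) (racg_gens \<Gamma>)))
     = graph_points (cayley_graph (racg \<Gamma>) (racg_gens \<Gamma>))"
  "mdist (graph_metric (cayley_graph (racg \<Gamma>) (racg_gens \<Gamma>)))
     = graph_dist (cayley_graph (racg \<Gamma>) (racg_gens \<Gamma>))"
proof -
  interpret Metric_space "graph_points (cayley_graph (racg \<Gamma>) (racg_gens \<Gamma>))"
      "graph_dist (cayley_graph (racg \<Gamma>) (racg_gens \<Gamma>))"
    unfolding racg_def racg_gens_def
    by (intro Metric_space_cayley_graph group_presented_group presented_gens_subset
        generate_presented_gens)
  show "mspace (graph_metric (cayley_graph (racg \<Gamma>) (racg_gens \<Gamma>)))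
     = graph_points (cayley_graph (racg \<Gamma>) (racg_gens \<Gamma>))"
    by (simp add: graph_metric_def)
  show "mdist (graph_metric (cayley_graph (racg \<Gamma>) (racg_gens \<Gamma>)))
     = graph_dist (cayley_graph (racg \<Gamma>) (racg_gens \<Gamma>))"
    by (simp add: graph_metric_def)
qed


section \<open>Total disconnectedness\<close>

definition totally_disconnected_space :: "'a topology \<Rightarrow> bool" where
  "totally_disconnected_space T \<longleftrightarrow> (\<forall>S. connectedin T S \<longrightarrow> (\<exists>a. S \<subseteq> {a}))"

end

theory Submission
  imports Defs "HOL-Library.Multiset"
begin

text \<open>
  A ray over the vertex set \<open>\<Sigma>\<close> of the cycle meets, within any three consecutive letters, two
  non-adjacent letters; since no induced square contains a non-adjacent pair of \<open>\<Sigma>\<close>, at most one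
  letter of \<open>\<Gamma>\<close> commutes with both. Hence two points separated by the corresponding pair of walls have
  almost additive distances through the ray there, while a point can lie between the two walls for at
  most three disjoint pairs along the ray. A quasi-geodesic far away from the ray therefore needs many
  steps per unit of progress along it, which makes all these rays Morse with a common gauge.

  Their classes form a connected set. If two open sets split it, then the geodesic words having
  continuations of both kinds form a tree without dead ends: the letters that can be appended to a
  geodesic word are those of the cycle minus a clique, a connected set, and adjacent letters
  \<open>p\<close>, \<open>q\<close> admit continuations beginning with \<open>p q\<close> and \<open>q p\<close> that define the same boundary point.
  An infinite branch of the tree is a limit of boundary points of both kinds.
\<close>

section \<open>Words up to commutation\<close>

text \<open>The subgroup generated by an induced cycle of length greater than 4 is the reflection
  group of a right-angled hyperbolic polygon, whose boundary is a circle; the connected set found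
  here plays the role of that circle. Quasi-geodesics that test the Morse property are free to leave
  the subgroup, so the paths below consist of arbitrary words over \<Gamma>, and the square
  hypothesis has to control common neighbours in all of \<Gamma>. The common gauge matters for the
  topology: a set open in the direct limit meets the stratum of one fixed gauge in a set whose
  complement there is closed under limits of sequences. Rays whose words share longer and longer
  prefixes converge in that stratum, and no other convergence enters. Walls are handled by words
  alone. Since \<open>rev u\<close> is the inverse of \<open>u\<close>, the word
  \<open>rev u @ x\<close> is \<open>x\<close> seen from the vertex \<open>u\<close>, and
  \<open>s\<close> is a left descent of it exactly when the wall of the edge from \<open>u\<close>
  to \<open>u @ [s]\<close> separates \<open>u\<close> from \<open>x\<close>.\<close>

locale trace_words =
  fixes E :: "'a \<Rightarrow> 'a \<Rightarrow> bool"
  assumes E_sym: "E s t \<Longrightarrow> E t s" and E_irrefl: "\<not> E s s"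
begin

fun front :: "'a \<Rightarrow> 'a list \<Rightarrow> bool" where
  "front s [] \<longleftrightarrow> False"
| "front s (a # w) \<longleftrightarrow> a = s \<or> E a s \<and> front s w"

text \<open>Left multiplication by a generator on reduced words. On these it is an involution up to
  \<open>teq\<close>, and adjacent letters act by commuting maps, so the Coxeter group acts on
  classes of reduced words.\<close>

definition act :: "'a \<Rightarrow> 'a list \<Rightarrow> 'a list" where
  "act s w = (if front s w then remove1 s w else s # w)"

fun red :: "'a list \<Rightarrow> bool" where
  "red [] \<longleftrightarrow> True"
| "red (a # w) \<longleftrightarrow> \<not> front a w \<and> red w"

definition nf :: "'a list \<Rightarrow> 'a list" where
  "nf w = foldr act w []"

definition len :: "'a list \<Rightarrow> nat" where
  "len w = length (nf w)"

text \<open>Passing to the normal form makes this a property of the group element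
  (\<open>cong_desc\<close>): left multiplication by \<open>s\<close> shortens it.\<close>

definition desc :: "'a \<Rightarrow> 'a list \<Rightarrow> bool" where
  "desc s w \<longleftrightarrow> front s (nf w)"

text \<open>
  Equality up to commutations, by the projections to pairs of letters that do not commute;
  \<open>a = b\<close> is such a pair.
\<close>

definition teq :: "'a list \<Rightarrow> 'a list \<Rightarrow> bool" where
  "teq u v \<longleftrightarrow> (\<forall>a b. \<not> E a b \<longrightarrow> filter (\<lambda>c. c = a \<or> c = b) u = filter (\<lambda>c. c = a \<or> c = b) v)"

text \<open>Words are identified when they act alike, so \<open>len\<close> and \<open>desc\<close>
  are invariant at once and each relation is checked only on the action. Reduced \<open>x\<close> is
  required because \<open>act_act\<close> holds only there.\<close>

definition cong :: "'a list \<Rightarrow> 'a list \<Rightarrow> bool" where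
  "cong u v \<longleftrightarrow> (\<forall>x. red x \<longrightarrow> teq (foldr act u x) (foldr act v x))"

section \<open>Commutation classes and the action on reduced words\<close>

lemma teq_refl [simp]: "teq w w"
  by (simp add: teq_def)

lemma teq_sym: "teq u v \<Longrightarrow> teq v u"
  by (simp add: teq_def)

lemma teq_trans [trans]: "teq u v \<Longrightarrow> teq v w \<Longrightarrow> teq u w"
  by (simp add: teq_def)

lemma teq_length:
  assumes "teq u v"
  shows "length u = length v"
proof -
  have "filter (\<lambda>c. c = a) u = filter (\<lambda>c. c = a) v" for a
    using assms E_irrefl[of a] unfolding teq_def by (metis (no_types, lifting) filter_cong)
  then have "count (mset u) a = count (mset v) a" for a
    unfolding count_mset count_list_eq_length_filter eq_commute[of a] by simp
  then have "mset u = mset v"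
    by (rule multiset_eqI)
  then show ?thesis
    by (rule mset_eq_length)
qed

text \<open>A first letter \<open>a\<close> blocks \<open>s\<close> exactly when the projection to
  \<open>s\<close> and \<open>a\<close> begins with \<open>a\<close>. In this form
  \<open>front\<close> visibly depends only on the \<open>teq\<close> class.\<close>

lemma front_iff_filter:
  "front s w \<longleftrightarrow> (\<forall>b. \<not> E s b \<longrightarrow> (\<exists>v. filter (\<lambda>c. c = s \<or> c = b) w = s # v))"
proof (induction w)
  case Nil
  then show ?case using E_irrefl by auto
next
  case (Cons a w)
  show ?case
  proof (cases "a = s")
    case False
    show ?thesis
    proof (cases "E s a")
      case True
      then have "b \<noteq> a" if "\<not> E s b" for b
        using that by blast
      then have "filter (\<lambda>c. c = s \<or> c = b) (a # w) = filter (\<lambda>c. c = s \<or> c = b) w" if "\<not> E s b" for b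
        using False that by auto
      then show ?thesis using Cons False True E_sym by auto
    next
      case F: False
      then have "\<exists>b. \<not> E s b \<and> (\<nexists>v. filter (\<lambda>c. c = s \<or> c = b) (a # w) = s # v)"
        using False by (intro exI[of _ a]) auto
      then show ?thesis using False F E_sym by auto
    qed
  qed auto
qed

lemma front_teq: "teq u v \<Longrightarrow> front s u \<longleftrightarrow> front s v"
  unfolding front_iff_filter teq_def by simp

lemma teq_Cons: "teq u v \<Longrightarrow> teq (s # u) (s # v)"
  by (simp add: teq_def)

lemma filter_remove1_if:
  "filter P (remove1 s w) = (if P s then remove1 s (filter P w) else filter P w)"
  by (induction w) auto

lemma teq_remove1: "teq u v \<Longrightarrow> teq (remove1 s u) (remove1 s v)"
  unfolding teq_def filter_remove1_if by simp

lemma teq_swap: "E s t \<Longrightarrow> teq (s # t # w) (t # s # w)"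
  using E_sym by (auto simp: teq_def E_irrefl)

lemma teq_front: "front s w \<Longrightarrow> teq w (s # remove1 s w)"
proof (induction w)
  case (Cons a w)
  then show ?case
    using teq_trans[OF teq_Cons[of w "s # remove1 s w" a] teq_swap[of a s "remove1 s w"]]
    by auto
qed simp

lemma act_teq: "teq u v \<Longrightarrow> teq (act s u) (act s v)"
  by (simp add: act_def front_teq[of u v] teq_Cons teq_remove1)

lemma front_Cons_adj: "E s t \<Longrightarrow> front s (t # w) \<longleftrightarrow> front s w"
  using E_sym E_irrefl by auto

lemma front_act_adj: "E s t \<Longrightarrow> front s (act t w) \<longleftrightarrow> front s w"
  using front_Cons_adj[of s t] front_teq[OF teq_front[of t w], of s] by (auto simp: act_def)

lemma act_comm:
  assumes "E s t"
  shows "teq (act s (act t w)) (act t (act s w))"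
proof -
  have "E t s" "s \<noteq> t" using assms E_sym E_irrefl by auto
  then show ?thesis
    using teq_swap[OF assms] assms front_act_adj[of s t w] front_act_adj[of t s w]
    by (auto simp: act_def remove1_commute simp del: front.simps)
qed

lemma red_remove1:
  assumes "red w" "front s w"
  shows "\<not> front s (remove1 s w) \<and> red (remove1 s w)"
  using assms
proof (induction w)
  case (Cons a w)
  show ?case
  proof (cases "a = s")
    case False
    with Cons have as: "E a s" "front s w" and IH: "\<not> front s (remove1 s w)" "red (remove1 s w)"
      by auto
    have "front a (remove1 s w) \<longleftrightarrow> front a w"
      using front_teq[OF teq_front[OF as(2)], of a] front_Cons_adj[OF as(1)] by simp
    then show ?thesis using Cons False IH by auto
  qed (use Cons in auto)
qed simp

lemma red_act: "red w \<Longrightarrow> red (act s w)"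
  using red_remove1[of w s] by (simp add: act_def)

lemma front_act_self: "red w \<Longrightarrow> front s (act s w) \<longleftrightarrow> \<not> front s w"
  using red_remove1[of w s] by (simp add: act_def)

lemma act_act: "red w \<Longrightarrow> teq (act s (act s w)) w"
  using red_remove1[of w s] teq_sym[OF teq_front[of s w]] by (auto simp: act_def)

lemma red_foldr: "red x \<Longrightarrow> red (foldr act u x)"
  by (induction u) (auto simp: red_act)

lemma red_nf: "red (nf w)"
  by (simp add: nf_def red_foldr)

lemma foldr_teq: "teq x y \<Longrightarrow> teq (foldr act u x) (foldr act u y)"
  by (induction u) (auto simp: act_teq)

section \<open>Congruence of words as equality in the group\<close>

lemma cong_refl [simp]: "cong w w"
  by (simp add: cong_def)

lemma cong_sym: "cong u v \<Longrightarrow> cong v u"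
  by (simp add: cong_def teq_sym)

lemma cong_trans [trans]: "cong u v \<Longrightarrow> cong v w \<Longrightarrow> cong u w"
  unfolding cong_def using teq_trans by blast

lemma cong_context: "cong u v \<Longrightarrow> cong (a @ u @ b) (a @ v @ b)"
  by (simp add: cong_def red_foldr foldr_teq)

lemma cong_append: "cong u u' \<Longrightarrow> cong v v' \<Longrightarrow> cong (u @ v) (u' @ v')"
  using cong_trans[of "u @ v" "u' @ v" "u' @ v'"] cong_context[of u u' "[]" v] cong_context[of v v' u' "[]"]
  by simp

lemma cong_Cons: "cong u v \<Longrightarrow> cong (s # u) (s # v)"
  using cong_context[of u v "[s]" "[]"] by simp

lemma cong_cancel: "cong (u @ s # s # v) (u @ v)"
proof -
  have "cong [s, s] []" by (simp add: cong_def act_act)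
  from cong_context[OF this, of u v] show ?thesis by simp
qed

lemma cong_swap: "E s t \<Longrightarrow> cong (u @ s # t # v) (u @ t # s # v)"
proof -
  assume "E s t"
  then have "cong [s, t] [t, s]" by (simp add: cong_def act_comm)
  from cong_context[OF this, of u v] show ?thesis by simp
qed

lemma cong_len: "cong u v \<Longrightarrow> len u = len v"
  unfolding cong_def len_def nf_def by (intro teq_length) auto

lemma cong_desc: "cong u v \<Longrightarrow> desc s u \<longleftrightarrow> desc s v"
  unfolding cong_def desc_def nf_def by (intro front_teq) auto

lemma cong_front: "front s w \<Longrightarrow> cong w (s # remove1 s w)"
proof (induction w)
  case (Cons a w)
  show ?case
  proof (cases "a = s")
    case False
    with Cons have "E a s" "cong w (s # remove1 s w)" by auto
    then show ?thesis
      using cong_trans[OF cong_Cons[of w "s # remove1 s w" a], of "s # a # remove1 s w"]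
        cong_swap[of a s "[]" "remove1 s w"] False
      by simp
  qed simp
qed simp

lemma cong_act: "cong (act s w) (s # w)"
proof (cases "front s w")
  case True
  have "cong (s # w) (s # s # remove1 s w)"
    by (rule cong_Cons[OF cong_front[OF True]])
  also have "cong \<dots> (remove1 s w)"
    using cong_cancel[of "[]" s] by simp
  finally show ?thesis using True by (simp add: act_def cong_sym)
qed (simp add: act_def)

lemma cong_nf: "cong w (nf w)"
proof (induction w)
  case (Cons s w)
  have "cong (s # w) (s # nf w)" by (rule cong_Cons[OF Cons])
  also have "cong \<dots> (act s (nf w))" by (rule cong_sym[OF cong_act])
  finally show ?case by (simp add: nf_def)
qed (simp add: nf_def)

lemma cong_rev_left: "cong (rev w @ w) []"
proof (induction w)
  case (Cons s w)
  have "cong (rev w @ s # s # w) (rev w @ w)" by (rule cong_cancel)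
  then show ?case using Cons cong_trans by fastforce
qed simp

lemma cong_rev_right: "cong (w @ rev w) []"
  using cong_rev_left[of "rev w"] by simp

text \<open>Reversal is inversion, as every letter is an involution; this is the uniqueness of
  inverses.\<close>

lemma cong_rev:
  assumes "cong u v"
  shows "cong (rev u) (rev v)"
proof -
  have "cong (rev u) (rev u @ (v @ rev v))"
    using cong_append[OF cong_refl[of "rev u"] cong_sym[OF cong_rev_right[of v]]] by simp
  also have "cong \<dots> (rev u @ (u @ rev v))"
    by (intro cong_append cong_refl cong_sym[OF assms])
  also have "cong \<dots> (rev v)"
    using cong_append[OF cong_rev_left[of u] cong_refl[of "rev v"]] by simp
  finally show ?thesis .
qed

section \<open>Length, descents and reduced words\<close>

lemma nf_red: "red w \<Longrightarrow> nf w = w"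
  by (induction w) (auto simp: nf_def act_def)

lemma len_Nil [simp]: "len [] = 0"
  by (simp add: len_def nf_def)

lemma nf_Cons: "nf (s # w) = act s (nf w)"
  by (simp add: nf_def)

lemma front_in_set: "front s w \<Longrightarrow> s \<in> set w"
  by (induction w) auto

lemma len_Cons_desc: "desc s w \<Longrightarrow> Suc (len (s # w)) = len w"
  using front_in_set[of s "nf w"] length_pos_if_in_set[of s "nf w"]
  by (simp add: len_def desc_def nf_Cons act_def length_remove1)

lemma len_Cons_not_desc: "\<not> desc s w \<Longrightarrow> len (s # w) = Suc (len w)"
  by (simp add: len_def desc_def nf_Cons act_def)

text \<open>Both letters can be brought to the front of the same normal form, and there one of them
  has to pass the other.\<close>

lemma desc_desc: "desc s w \<Longrightarrow> desc t w \<Longrightarrow> s \<noteq> t \<Longrightarrow> E s t"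
proof -
  have "front s w \<Longrightarrow> front t w \<Longrightarrow> s \<noteq> t \<Longrightarrow> E s t" for w
    by (induction w) (use E_sym in auto)
  then show "desc s w \<Longrightarrow> desc t w \<Longrightarrow> s \<noteq> t \<Longrightarrow> E s t"
    by (simp add: desc_def)
qed

lemma desc_Cons_adj: "E s t \<Longrightarrow> desc s (t # w) \<longleftrightarrow> desc s w"
  by (simp add: desc_def nf_Cons front_act_adj)

lemma desc_append_adj: "(\<And>t. t \<in> set u \<Longrightarrow> E s t) \<Longrightarrow> desc s (u @ w) \<longleftrightarrow> desc s w"
  by (induction u) (auto simp: desc_Cons_adj)

lemma desc_Cons_self: "desc s (s # w) \<longleftrightarrow> \<not> desc s w"
  by (simp add: desc_def nf_Cons front_act_self red_nf)

lemma len_append_le: "len (u @ v) \<le> length u + len v"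
proof (induction u)
  case (Cons s u)
  then show ?case
    using len_Cons_desc[of s "u @ v"] len_Cons_not_desc[of s "u @ v"]
    by (cases "desc s (u @ v)") auto
qed simp

lemma len_le_length: "len w \<le> length w"
  using len_append_le[of w "[]"] by simp

lemma red_iff_len: "red w \<longleftrightarrow> len w = length w"
proof
  show "red w \<Longrightarrow> len w = length w"
    by (simp add: len_def nf_red)
  show "len w = length w \<Longrightarrow> red w"
  proof (induction w)
    case (Cons a w)
    have nd: "\<not> desc a w"
      using Cons.prems len_Cons_desc[of a w] len_le_length[of w] by auto
    then have "red w"
      using Cons len_Cons_not_desc[of a w] by simp
    then show ?case
      using nd by (simp add: desc_def nf_red)
  qed simp
qed

lemma red_Cons_desc: "red (a # w) \<longleftrightarrow> \<not> desc a w \<and> red w"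
  by (auto simp: desc_def nf_red)

lemma len_rev: "len (rev w) = len w"
proof -
  have "len (rev w) \<le> len w" for w
    using cong_len[OF cong_rev[OF cong_nf[of w]]] len_le_length[of "rev (nf w)"]
    by (simp add: len_def)
  from this[of w] this[of "rev w"] show ?thesis by simp
qed

lemma red_rev: "red (rev w) \<longleftrightarrow> red w"
  by (simp add: red_iff_len len_rev)

lemma red_appendD:
  assumes "red (u @ v)"
  shows "red u" "red v"
proof -
  have suffix: "red (u @ v) \<Longrightarrow> red v" for u v
    by (induction u) auto
  from suffix[OF assms] show "red v" .
  have "red (rev v @ rev u)" using assms red_rev[of "u @ v"] by simp
  then show "red u" using suffix[of "rev v" "rev u"] by (simp add: red_rev)
qed

lemma red_cong: "cong u v \<Longrightarrow> length u = length v \<Longrightarrow> red u \<longleftrightarrow> red v"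
  by (simp add: red_iff_len cong_len)

lemma red_snoc: "red (w @ [s]) \<longleftrightarrow> red w \<and> \<not> desc s (rev w)"
  using red_rev[of "w @ [s]"] red_Cons_desc[of s "rev w"] red_rev[of w] by auto

section \<open>Crossing walls and additivity of length\<close>

lemma cong_move:
  assumes "\<And>a. a \<in> set u \<Longrightarrow> E a s"
  shows "cong (u @ s # v) (s # u @ v)"
  using assms
proof (induction u)
  case (Cons a u)
  then have "cong (a # u @ s # v) (a # s # u @ v)" by (simp add: cong_Cons)
  also have "cong \<dots> (s # a # u @ v)" using cong_swap[of a s "[]"] Cons.prems by simp
  finally show ?case by simp
qed simp

text \<open>The path \<open>as\<close> leads away from \<open>y\<close>, and \<open>r\<close> is the
  first letter to turn back. At the end of the path both \<open>r\<close> and the last letter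
  \<open>a\<close> are descents, so they commute; then \<open>r\<close> can be moved before
  \<open>a\<close> and the induction goes on.\<close>

lemma first_descent_adjacent:
  assumes "red (as @ [r])" "len (rev as @ y) = length as + len y" "desc r (rev as @ y)"
  shows "\<forall>a\<in>set as. E a r"
  using assms
proof (induction as rule: rev_induct)
  case (snoc a as)
  have up: "\<not> desc a (rev as @ y)" "len (rev as @ y) = length as + len y"
    using snoc.prems(2) len_Cons_desc[of a "rev as @ y"] len_Cons_not_desc[of a "rev as @ y"]
      len_append_le[of "rev as" y] by (cases "desc a (rev as @ y)"; simp)+
  have "red ([a, r])" using red_appendD(2)[of as "[a, r]"] snoc.prems(1) by simp
  then have ar: "a \<noteq> r" by auto
  have "desc a (a # rev as @ y)" using up by (simp add: desc_Cons_self)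
  with snoc.prems(3) ar have E: "E a r" "E r a"
    using desc_desc E_sym by force+
  have "red (as @ [r, a])"
    using red_cong[OF cong_swap[OF E(1), of as "[]"]] snoc.prems(1) by simp
  then have "red (as @ [r])" using red_appendD(1)[of "as @ [r]" "[a]"] by simp
  moreover have "desc r (rev as @ y)" using snoc.prems(3) desc_Cons_adj[OF E(2)] by simp
  ultimately show ?case using snoc.IH up(2) E by simp
qed simp

lemma ascending_or_first_descent:
  "len (rev as @ y) = length as + len y \<or>
   (\<exists>cs b ds. as = cs @ b # ds \<and> len (rev cs @ y) = length cs + len y \<and> desc b (rev cs @ y))"
proof (induction as rule: rev_induct)
  case (snoc a as)
  then show ?case
  proof
    assume *: "len (rev as @ y) = length as + len y"
    then show ?thesis
      using len_Cons_not_desc[of a "rev as @ y"] by (cases "desc a (rev as @ y)") auto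
  next
    assume "\<exists>cs b ds. as = cs @ b # ds \<and> len (rev cs @ y) = length cs + len y \<and> desc b (rev cs @ y)"
    then show ?thesis by (metis append_Cons append_assoc)
  qed
qed simp

text \<open>
  Geometrically: a wall crossed by the word early on, with \<open>y\<close> on its near side, and a wall
  crossed later, with \<open>y\<close> on its far side, must intersect.
\<close>

lemma ascent_descent_adjacent:
  assumes "red (a # bs @ [r])" "\<not> desc a y" "desc r (rev (a # bs) @ y)"
  shows "E a r"
  using assms
proof (induction "length bs" arbitrary: bs y rule: less_induct)
  case less
  show ?case
    using ascending_or_first_descent[of "a # bs" y]
  proof
    assume "len (rev (a # bs) @ y) = length (a # bs) + len y"
    then show ?thesis using first_descent_adjacent[of "a # bs" r y] less.prems by simp
  next
    assume "\<exists>cs b ds. a # bs = cs @ b # ds \<and> len (rev cs @ y) = length cs + len y \<and> desc b (rev cs @ y)"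
    then obtain cs0 b ds where *: "a # bs = cs0 @ b # ds" "len (rev cs0 @ y) = length cs0 + len y"
      "desc b (rev cs0 @ y)" by blast
    have "cs0 \<noteq> []" using * less.prems(2) by auto
    then obtain cs where cs: "cs0 = a # cs" "bs = cs @ b # ds"
      using *(1) by (cases cs0) auto
    \<comment> \<open>The first letter \<open>b\<close> that turns back towards \<open>y\<close>
      commutes with everything before it. Moved to the front and absorbed into \<open>y\<close>, it
      disappears from the path while the element at the end stays the same.\<close>
    have "red (cs0 @ [b])"
      using less.prems(1) red_appendD(1)[of "cs0 @ [b]" "ds @ [r]"] cs by simp
    then have adj: "\<forall>c\<in>set cs0. E c b"
      using first_descent_adjacent *(2,3) by blast
    have mv: "cong (cs0 @ b # v) (b # cs0 @ v)" for v
      using adj by (intro cong_move) blast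
    have "red (b # a # cs @ ds @ [r])"
      using red_cong[OF mv[of "ds @ [r]"]] less.prems(1) cs by simp
    then have 1: "red (a # (cs @ ds) @ [r])" by simp
    have 2: "\<not> desc a (b # y)" using adj cs(1) less.prems(2) by (simp add: desc_Cons_adj)
    have "cong (rev ds @ b # rev cs0 @ y) (rev ds @ rev cs0 @ b # y)"
      using adj by (intro cong_append cong_refl cong_sym[OF cong_move]) auto
    then have 3: "desc r (rev (a # cs @ ds) @ b # y)"
      using less.prems(3) cong_desc cs by fastforce
    show ?thesis using less.hyps[OF _ 1 2 3] cs by simp
  qed
qed

text \<open>Along a reduced word for \<open>x\<close>, the first letter that turns back towards
  \<open>y\<close> commutes with all letters before it, hence is a left descent of both
  \<open>x\<close> and \<open>y\<close>. Without such a letter every step adds one.\<close>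

lemma len_rev_append:
  assumes "\<And>s. \<not> (desc s x \<and> desc s y)"
  shows "len (rev x @ y) = len x + len y"
proof -
  have r: "len (rev x @ y) = length x + len y" if x: "red x" "\<And>s. \<not> (desc s x \<and> desc s y)" for x
    using ascending_or_first_descent[of x y]
  proof
    assume "\<exists>cs b ds. x = cs @ b # ds \<and> len (rev cs @ y) = length cs + len y \<and> desc b (rev cs @ y)"
    then obtain cs b ds where *: "x = cs @ b # ds" "len (rev cs @ y) = length cs + len y"
      "desc b (rev cs @ y)" by blast
    have "red (cs @ [b])" using x(1) * red_appendD(1)[of "cs @ [b]" ds] by simp
    then have "\<forall>c\<in>set cs. E c b" using first_descent_adjacent * by blast
    then have adj: "\<And>c. c \<in> set cs \<Longrightarrow> E b c" using E_sym by blast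
    have "desc b y" using *(3) desc_append_adj[of "rev cs" b] adj by simp
    moreover have "desc b x"
      using * adj x(1) red_appendD(2)[of cs "b # ds"] red_Cons_desc
      by (simp add: desc_append_adj desc_Cons_self del: red.simps)
    ultimately show ?thesis using x(2) by blast
  qed
  have "len (rev x @ y) = len (rev (nf x) @ y)"
    by (intro cong_len cong_append cong_rev cong_nf cong_refl)
  also have "\<dots> = length (nf x) + len y"
    using assms cong_desc[OF cong_nf[of x]] by (intro r red_nf) simp
  finally show ?thesis by (simp add: len_def)
qed

text \<open>
  The common prefix of \<open>x\<close> and \<open>y\<close> consists of letters adjacent to both \<open>u\<close> and \<open>v\<close>.
\<close>

lemma len_rev_append_ge:
  assumes u: "desc u x" and v: "desc v y" and uv: "u \<noteq> v" "\<not> E u v"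
    and nb: "\<And>r r'. E u r \<Longrightarrow> E v r \<Longrightarrow> E u r' \<Longrightarrow> E v r' \<Longrightarrow> r = r'"
  shows "len x + len y \<le> len (rev x @ y) + 2"
proof (cases "\<exists>r. desc r x \<and> desc r y")
  case False
  then show ?thesis using len_rev_append[of x y] by auto
next
  case True
  then obtain r where r: "desc r x" "desc r y" by blast
  have common: "E u r \<and> E v r" if "desc u x" "desc v y" "desc r x" "desc r y" for r x y
    using that uv desc_desc by metis
  have E: "E u r" "E v r" using common[OF u v r] by auto
  \<comment> \<open>Every common descent is adjacent to \<open>u\<close> and \<open>v\<close>, hence
    equal to \<open>r\<close>; once \<open>r\<close> is cancelled, none is left. The cancellation
    shortens each of the two words by one, which is the defect 2.\<close>
  have "len (rev (r # x) @ r # y) = len (r # x) + len (r # y)"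
  proof (rule len_rev_append, rule notI)
    fix s assume s: "desc s (r # x) \<and> desc s (r # y)"
    have "desc u (r # x)" "desc v (r # y)" using u v E by (auto simp: desc_Cons_adj)
    then have "E u s" "E v s" using common s by blast+
    then have "s = r" using nb E by blast
    then show False using s r by (simp add: desc_Cons_self)
  qed
  moreover have "len (rev (r # x) @ r # y) = len (rev x @ y)"
    using cong_len[OF cong_cancel[of "rev x" r y]] by simp
  ultimately show ?thesis
    using len_Cons_desc[OF r(1)] len_Cons_desc[OF r(2)] by simp
qed

subsection \<open>Distances along an infinite word\<close>

definition wdist :: "'a list \<Rightarrow> 'a list \<Rightarrow> nat" where
  "wdist x y = len (rev x @ y)"

definition initial :: "(nat \<Rightarrow> 'a) \<Rightarrow> nat \<Rightarrow> 'a list" where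
  "initial f n = map f [0..<n]"

text \<open>The distance to \<open>x\<close> decreases along the \<open>n\<close>-th edge of the word.\<close>

definition down :: "(nat \<Rightarrow> 'a) \<Rightarrow> 'a list \<Rightarrow> nat \<Rightarrow> bool" where
  "down f x n \<longleftrightarrow> desc (f n) (rev (initial f n) @ x)"

lemma len_append_le': "len (u @ v) \<le> len u + len v"
  using len_append_le[of "nf u" v] cong_len[OF cong_append[OF cong_nf[of u] cong_refl[of v]]]
  by (simp add: len_def)

lemma cong_middle: "cong (u @ x @ rev x @ v) (u @ v)"
  using cong_context[OF cong_rev_right[of x], of u v] by simp

lemma wdist_commute: "wdist x y = wdist y x"
  using len_rev[of "rev x @ y"] by (simp add: wdist_def)

lemma wdist_triangle: "wdist x z \<le> wdist x y + wdist y z"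
  using len_append_le'[of "rev x @ y" "rev y @ z"] cong_len[OF cong_middle[of "rev x" y z]]
  by (simp add: wdist_def)

lemma wdist_append_left: "wdist (u @ x) (u @ y) = wdist x y"
  using cong_len[OF cong_context[OF cong_rev_left[of u], of "rev x" y]]
  by (simp add: wdist_def)

text \<open>Both points are seen from the vertex \<open>u\<close>, the form to which
  \<open>len_rev_append_ge\<close> applies.\<close>

lemma wdist_via: "wdist x y = len (rev (rev u @ x) @ rev u @ y)"
  using cong_len[OF cong_middle[of "rev x" u y]] by (simp add: wdist_def)

lemma initial_Suc: "initial f (Suc n) = initial f n @ [f n]"
  by (simp add: initial_def)

lemma initial_split: "l \<le> n \<Longrightarrow> initial f n = initial f l @ map f [l..<n]"
  unfolding initial_def by (metis le0 map_append upt_add_eq_append le_add_diff_inverse plus_nat.add_0)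

lemma wdist_initial_Suc:
  "int (wdist (initial f (Suc n)) x) = int (wdist (initial f n) x) + (if down f x n then - 1 else 1)"
  using len_Cons_desc[of "f n" "rev (initial f n) @ x"] len_Cons_not_desc[of "f n" "rev (initial f n) @ x"]
  by (auto simp: wdist_def initial_Suc down_def)

lemma wdist_initial_count:
  assumes "l \<le> n"
  shows "wdist (initial f n) x + 2 * card {i. l \<le> i \<and> i < n \<and> down f x i} = wdist (initial f l) x + (n - l)"
  using assms
proof (induction n rule: dec_induct)
  case base
  have "{i. l \<le> i \<and> i < l \<and> down f x i} = {}" by auto
  then show ?case by (simp only: card.empty)
next
  case (step n)
  have "{i. l \<le> i \<and> i < Suc n \<and> down f x i} =
      (if down f x n then insert n {i. l \<le> i \<and> i < n \<and> down f x i} else {i. l \<le> i \<and> i < n \<and> down f x i})"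
    using step.hyps by (auto simp: less_Suc_eq)
  then have "card {i. l \<le> i \<and> i < Suc n \<and> down f x i} =
      card {i. l \<le> i \<and> i < n \<and> down f x i} + (if down f x n then 1 else 0)"
    by simp
  then show ?case
    using step wdist_initial_Suc[of f n x] by (auto split: if_splits)
qed

lemma wdist_steps:
  assumes "p \<le> q" "\<And>i. p \<le> i \<Longrightarrow> i < q \<Longrightarrow> wdist (x i) (x (Suc i)) \<le> J"
  shows "wdist (x p) (x q) \<le> J * (q - p)"
  using assms
proof (induction q rule: dec_induct)
  case base
  then show ?case using cong_len[OF cong_rev_left[of "x p"]] by (simp add: wdist_def)
next
  case (step q)
  then have "wdist (x p) (x (Suc q)) \<le> J * (q - p) + J"
    using wdist_triangle[of "x p" "x (Suc q)" "x q"] by (meson add_mono le_trans less_Suc_eq)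
  then show ?case using step.hyps by (simp add: Suc_diff_le)
qed

end

section \<open>Quasi-geodesics near a geodesic word\<close>

text \<open>\<open>common_neighbour\<close> is the square hypothesis: \<open>r\<close> and
  \<open>r'\<close> are not confined to \<Sigma>, and in a triangle-free graph two different ones
  would form an induced square with \<open>u\<close> and \<open>v\<close>.\<close>

locale geodesic_word = trace_words E for E :: "'a \<Rightarrow> 'a \<Rightarrow> bool" +
  fixes \<Sigma> :: "'a set" and f :: "nat \<Rightarrow> 'a"
  assumes no_triangle: "\<lbrakk>u \<in> \<Sigma>; v \<in> \<Sigma>; w \<in> \<Sigma>; E u v; E v w\<rbrakk> \<Longrightarrow> \<not> E u w"
    and common_neighbour: "\<lbrakk>u \<in> \<Sigma>; v \<in> \<Sigma>; u \<noteq> v; \<not> E u v; E u r; E v r; E u r'; E v r'\<rbrakk> \<Longrightarrow> r = r'"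
    and letters: "f n \<in> \<Sigma>"
    and geodesic: "red (initial f n)"
begin

section \<open>Walls along the ray and windows between them\<close>

lemma red_segment: "red (map f [l..<n])"
proof (cases "l \<le> n")
  case True
  then show ?thesis using geodesic[of n] initial_split[of l n f] red_appendD(2) by simp
qed simp

lemma wdist_initial_initial:
  assumes "l \<le> n"
  shows "wdist (initial f l) (initial f n) = n - l"
  using wdist_append_left[of "initial f l" "[]" "map f [l..<n]"] red_segment[of l n] initial_split[OF assms, of f]
  by (simp add: wdist_def red_iff_len)

text \<open>The counted walls all separate the vertex \<open>l\<close> of the ray from
  \<open>x\<close>. The proof compares the count with the triangle inequality for the geodesic
  segment from \<open>l\<close> to \<open>n\<close>.\<close>

lemma card_down_le:
  assumes "l \<le> n"
  shows "card {i. l \<le> i \<and> i < n \<and> down f x i} \<le> wdist (initial f l) x"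
  using wdist_initial_count[OF assms, of f x] wdist_initial_initial[OF assms]
    wdist_triangle[of "initial f l" "initial f n" x] wdist_commute[of x "initial f n"] wdist_commute[of "initial f l" x]
  by simp

lemma card_up_le: "card {i. i < n \<and> \<not> down f x i} \<le> wdist (initial f n) x"
proof -
  have "{i. 0 \<le> i \<and> i < n \<and> down f x i} \<union> {i. i < n \<and> \<not> down f x i} = {..<n}"
    "{i. 0 \<le> i \<and> i < n \<and> down f x i} \<inter> {i. i < n \<and> \<not> down f x i} = {}" by auto
  then have "card {i. 0 \<le> i \<and> i < n \<and> down f x i} + card {i. i < n \<and> \<not> down f x i} = n"
    using card_Un_disjoint[of "{i. 0 \<le> i \<and> i < n \<and> down f x i}" "{i. i < n \<and> \<not> down f x i}"] by simp
  then show ?thesis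
    using wdist_initial_count[of 0 n f x] wdist_initial_initial[of 0 n]
      wdist_triangle[of "initial f 0" "initial f n" x] wdist_commute[of x "initial f n"]
    by simp
qed

text \<open>The earlier wall has \<open>x\<close> on its near side and the later one has it on its
  far side, so the walls cross.\<close>

lemma up_down_adjacent:
  assumes "i < j" "\<not> down f x i" "down f x j"
  shows "E (f i) (f j)"
proof (rule ascent_descent_adjacent)
  have "map f [i..<Suc j] = f i # map f [Suc i..<j] @ [f j]"
    using assms(1) by (simp add: upt_conv_Cons)
  then show "red (f i # map f [Suc i..<j] @ [f j])"
    using red_segment[of i "Suc j"] by simp
  show "\<not> desc (f i) (rev (initial f i) @ x)" using assms(2) by (simp add: down_def)
  have "initial f j = initial f i @ f i # map f [Suc i..<j]"
    using assms(1) initial_split[of i j f] by (simp add: upt_conv_Cons)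
  then show "desc (f j) (rev (f i # map f [Suc i..<j]) @ rev (initial f i) @ x)"
    using assms(3) by (simp add: down_def)
qed

text \<open>
  If \<open>f a\<close> and \<open>f (Suc a)\<close> commute, then \<open>f a\<close> can be moved next to \<open>f m\<close>; so in either case
  the walls crossed at \<open>a\<close> and \<open>m\<close> are disjoint and both adjacent to the vertex \<open>m\<close> of the ray.
\<close>

definition window :: "nat \<Rightarrow> nat \<Rightarrow> bool" where
  "window a m \<longleftrightarrow> f a \<noteq> f m \<and> \<not> E (f a) (f m) \<and>
     (m = Suc a \<or> m = Suc (Suc a) \<and> E (f a) (f (Suc a)))"

text \<open>Two consecutive letters that do not commute form a window. If both consecutive pairs
  commute, the outer letters differ because the word is reduced, and they are not adjacent because
  there is no triangle. Blocks of three letters keep the windows disjoint.\<close>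

lemma window_exists: "\<exists>a m. 3 * k \<le> a \<and> a < m \<and> m \<le> 3 * k + 2 \<and> window a m"
proof -
  define i where "i = 3 * k"
  have seg: "red [f i, f (Suc i), f (Suc (Suc i))]"
    using red_segment[of i "Suc (Suc (Suc i))"] by (simp add: upt_rec)
  show ?thesis
  proof (cases "E (f i) (f (Suc i))")
    case False
    then have "window i (Suc i)" using seg by (auto simp: window_def)
    then show ?thesis unfolding i_def by (intro exI[of _ "3 * k"] exI[of _ "Suc (3 * k)"]) auto
  next
    case E1: True
    show ?thesis
    proof (cases "E (f (Suc i)) (f (Suc (Suc i)))")
      case False
      then have "window (Suc i) (Suc (Suc i))" using seg by (auto simp: window_def)
      then show ?thesis unfolding i_def
        by (intro exI[of _ "Suc (3 * k)"] exI[of _ "Suc (Suc (3 * k))"]) auto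
    next
      case E2: True
      then have "f i \<noteq> f (Suc (Suc i))" using seg E1 E_sym by auto
      then have "window i (Suc (Suc i))"
        using E1 E2 no_triangle letters by (auto simp: window_def)
      then show ?thesis unfolding i_def by (intro exI[of _ "3 * k"] exI[of _ "Suc (Suc (3 * k))"]) auto
    qed
  qed
qed

lemma window_up:
  assumes "window a m" "\<not> down f x a"
  shows "desc (f a) (rev (initial f m) @ x)"
proof -
  have "desc (f a) (f a # rev (initial f a) @ x)"
    using assms(2) by (simp add: down_def desc_Cons_self)
  then show ?thesis
    using assms(1) desc_Cons_adj by (auto simp: window_def initial_Suc)
qed

text \<open>Seen from the vertex \<open>m\<close>, the letter \<open>f a\<close> is a descent of
  \<open>x\<close> and \<open>f m\<close> one of \<open>y\<close>. They do not commute, so the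
  Gromov product of \<open>x\<close> and \<open>y\<close> at this vertex is at most 1.\<close>

lemma window_gromov_product:
  assumes "window a m" "\<not> down f x a" "down f y m"
  shows "wdist (initial f m) x + wdist (initial f m) y \<le> wdist x y + 2"
proof -
  have "len (rev (initial f m) @ x) + len (rev (initial f m) @ y)
      \<le> len (rev (rev (initial f m) @ x) @ rev (initial f m) @ y) + 2"
  proof (rule len_rev_append_ge[OF window_up[OF assms(1,2)]])
    show "desc (f m) (rev (initial f m) @ y)" using assms(3) by (simp add: down_def)
    show "f a \<noteq> f m" "\<not> E (f a) (f m)" using assms(1) by (auto simp: window_def)
    then show "r = r'" if "E (f a) r" "E (f m) r" "E (f a) r'" "E (f m) r'" for r r'
      using common_neighbour[OF letters letters] that by blast
  qed
  then show ?thesis using wdist_via[of x y "initial f m"] by (simp add: wdist_def)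
qed

end

section \<open>Counting lemmas and the constants of an excursion\<close>

lemma card_ge_4_chain:
  fixes K :: "nat set"
  assumes "finite K" "4 \<le> card K"
  shows "\<exists>a\<in>K. \<exists>b\<in>K. \<exists>c\<in>K. \<exists>d\<in>K. a < b \<and> b < c \<and> c < d"
proof -
  let ?l = "sorted_list_of_set K"
  have l: "length ?l \<ge> 4" "set ?l = K" "sorted_wrt (<) ?l" using assms by auto
  have mem: "?l ! 0 \<in> K" "?l ! 1 \<in> K" "?l ! 2 \<in> K" "?l ! 3 \<in> K"
      using l nth_mem[of _ ?l] by auto
  have "?l ! 0 < ?l ! 1" "?l ! 1 < ?l ! 2" "?l ! 2 < ?l ! 3"
    using l sorted_wrt_nth_less[OF l(3)] by auto
  with mem show ?thesis by blast
qed

lemma card_filter_eq_sum: "finite I \<Longrightarrow> card {i \<in> I. P i} = (\<Sum>i\<in>I. if P i then 1 else 0)"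
  by (simp add: sum.If_cases Int_def)

text \<open>Cuts out a single passage: for a path crossing a window, the indices between
  \<open>p\<close> and \<open>q\<close> are those spent inside it.\<close>

lemma last_before_first_after:
  fixes P Q :: "nat \<Rightarrow> bool"
  assumes "P 0" "Q n" and PQ: "\<And>i. i \<le> n \<Longrightarrow> \<not> (P i \<and> Q i)"
  shows "\<exists>p q. p < q \<and> q \<le> n \<and> P p \<and> Q q \<and> (\<forall>i. p < i \<and> i < q \<longrightarrow> \<not> P i \<and> \<not> Q i)"
proof -
  define q where "q = (LEAST i. Q i)"
  have q: "Q q" "q \<le> n" "\<And>i. i < q \<Longrightarrow> \<not> Q i"
    using assms(2) unfolding q_def by (auto intro: LeastI Least_le dest: not_less_Least)
  define p where "p = Max {i. i \<le> q \<and> P i}"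
  have ne: "{i. i \<le> q \<and> P i} \<noteq> {}" using assms(1) by auto
  have p: "p \<le> q" "P p" using Max_in[OF _ ne] by (auto simp: p_def)
  have p': "\<not> P i" if "p < i" "i \<le> q" for i
    using Max_ge[of "{i. i \<le> q \<and> P i}" i] that unfolding p_def[symmetric] by fastforce
  have "p \<noteq> q" using PQ[of q] p q by blast
  then show ?thesis using p p' q by (intro exI[of _ p] exI[of _ q]) auto
qed

text \<open>18 = 3 * 3 * 2: a window stands for three letters, a point lies inside at most three
  windows, and the factor 2 lets the progress along the ray use up only half of the length of the
  path. The summand 4 makes points within distance 2 of the ray count as near.\<close>

definition excursion_radius :: "nat \<Rightarrow> nat \<Rightarrow> nat" where
  "excursion_radius J A0 = J * (18 * A0 + 1) + 4"

text \<open>The bound of \<open>excursion_bound\<close> for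
  \<open>R' = excursion_radius J A0 + J\<close>, since the first and last far points are one step
  away from near ones.\<close>

definition excursion_length :: "nat \<Rightarrow> nat \<Rightarrow> nat \<Rightarrow> nat" where
  "excursion_length J A0 B = 2 * A0 * (8 * (excursion_radius J A0 + J) + B + 5) + 1"

section \<open>Excursions of a coarse path away from the ray\<close>

context geodesic_word
begin

text \<open>
  The walls at \<open>M i\<close> and \<open>A j\<close> cross for \<open>i < j\<close>, so four windows would yield two non-adjacent letters
  of \<open>\<Sigma>\<close> with two common neighbours.
\<close>

lemma card_inside_windows_le:
  assumes W: "\<And>k. 3 * k \<le> A k \<and> A k < M k \<and> M k \<le> 3 * k + 2 \<and> window (A k) (M k)"
    and "finite K"
  shows "card {k \<in> K. down f x (A k) \<and> \<not> down f x (M k)} \<le> 3"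
proof (rule ccontr)
  let ?I = "{k \<in> K. down f x (A k) \<and> \<not> down f x (M k)}"
  assume "\<not> card ?I \<le> 3"
  then have "finite ?I" "4 \<le> card ?I" using \<open>finite K\<close> by auto
  from card_ge_4_chain[OF this] obtain a b c d where abcd: "a \<in> ?I" "b \<in> ?I" "c \<in> ?I" "d \<in> ?I" "a < b" "b < c" "c < d"
    by (elim bexE conjE) (rule that)
  have adj: "E (f (M i)) (f (A j))" if "i \<in> ?I" "j \<in> ?I" "i < j" for i j
  proof (rule up_down_adjacent)
    show "M i < A j" using W[of i] W[of j] \<open>i < j\<close> by linarith
  qed (use that in auto)
  have na: "\<not> E (f (A i)) (f (M i))" for i
    using W[of i] by (simp add: window_def)
  have 1: "f (M a) \<noteq> f (M b)"
    using adj[of a b] na[of b] abcd E_sym by metis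
  have 2: "f (A c) \<noteq> f (A d)"
    using adj[of c d] na[of c] abcd E_sym by metis
  have E: "E (f (M a)) (f (A c))" "E (f (M a)) (f (A d))" "E (f (M b)) (f (A c))" "E (f (M b)) (f (A d))"
    using adj abcd by (meson order_less_trans)+
  have "\<not> E (f (M a)) (f (M b))"
    using no_triangle[OF letters letters letters E(1) E_sym[OF E(3)]] .
  then show False
    using common_neighbour[OF letters letters 1 _ E(1,3,2,4)] 2 by blast
qed

text \<open>A passage through the window leads from \<open>x p\<close> to \<open>x q\<close>, both
  at distance at least \<open>R\<close> from the vertex \<open>m\<close>. Their Gromov product there
  is at most 1, so they are almost \<open>2 * R\<close> apart and the passage takes more than
  \<open>Q\<close> steps.\<close>

lemma inside_window_count:
  assumes W: "a < m" "window a m"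
    and step: "\<And>i. i < n \<Longrightarrow> wdist (x i) (x (Suc i)) \<le> J"
    and far: "\<And>i k. i \<le> n \<Longrightarrow> R \<le> wdist (initial f k) (x i)"
    and R: "J * (Q + 1) + 2 \<le> 2 * R" and J: "0 < J"
    and ends: "\<not> down f (x 0) a" "down f (x n) m"
  shows "Q \<le> card {i. i \<le> n \<and> down f (x i) a \<and> \<not> down f (x i) m}"
proof -
  have "\<not> (\<not> down f (x i) a \<and> down f (x i) m)" for i
    using up_down_adjacent[of a m] W by (auto simp: window_def)
  then obtain p q where pq: "p < q" "q \<le> n" "\<not> down f (x p) a" "down f (x q) m"
      "\<And>i. p < i \<Longrightarrow> i < q \<Longrightarrow> \<not> \<not> down f (x i) a \<and> \<not> down f (x i) m"
    using last_before_first_after[of "\<lambda>i. \<not> down f (x i) a" "\<lambda>i. down f (x i) m" n, OF ends] by blast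
  have "2 * R \<le> wdist (x p) (x q) + 2"
    using window_gromov_product[OF W(2) pq(3,4)] far[of p m] far[of q m] pq(1,2) by simp
  moreover have "wdist (x p) (x q) \<le> J * (q - p)"
    using pq by (intro wdist_steps step) auto
  ultimately have "J * (Q + 1) \<le> J * (q - p)" using R by simp
  then have "Q + 1 \<le> q - p" using J nat_mult_le_cancel1 by blast
  then have "Q \<le> card {p<..<q}" by simp
  also have "\<dots> \<le> card {i. i \<le> n \<and> down f (x i) a \<and> \<not> down f (x i) m}"
    using pq by (intro card_mono) auto
  finally show ?thesis .
qed

text \<open>
  Crossing a window far away from the ray costs many steps, and a point of the path
  lies inside at most three windows; so a long excursion moves slowly along the ray.
\<close>

lemma excursion_bound:
  assumes step: "\<And>i. i < n \<Longrightarrow> wdist (x i) (x (Suc i)) \<le> J" and J: "0 < J"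
    and qg: "n \<le> A0 * (wdist (x 0) (x n) + B)"
    and far: "\<And>i k. i \<le> n \<Longrightarrow> R \<le> wdist (initial f k) (x i)"
    and R: "J * (18 * A0 + 1) + 2 \<le> 2 * R"
    and ends: "wdist (initial f l) (x 0) \<le> R'" "wdist (initial f l') (x n) \<le> R'" "l \<le> l'"
  shows "n \<le> 2 * A0 * (8 * R' + B + 5) + 1"
proof -
  obtain A M where W: "\<And>k. 3 * k \<le> A k \<and> A k < M k \<and> M k \<le> 3 * k + 2 \<and> window (A k) (M k)"
    using window_exists by metis
  define G0 where "G0 = {k. l \<le> 3 * k \<and> 3 * k + 3 \<le> l'}"
  \<comment> \<open>Windows to discard: the start is already beyond the first wall, or the end is
    not yet beyond the second. Each kind is bounded by the distance \<open>R'\<close> of that end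
    from the ray.\<close>
  define B1 where "B1 = {k \<in> G0. down f (x 0) (A k)}"
  define B2 where "B2 = {k \<in> G0. \<not> down f (x n) (M k)}"
  define G where "G = {k \<in> G0. \<not> down f (x 0) (A k) \<and> down f (x n) (M k)}"
  have fin: "finite G0" by (rule finite_subset[of _ "{..l'}"]) (auto simp: G0_def)
  have "A i < A j" "M i < M j" if "i < j" for i j
    using W[of i] W[of j] that by linarith+
  then have inj: "inj A" "inj M"
    by (simp_all add: linorder_injI less_imp_neq)
  have "card B1 = card (A ` B1)"
    using inj by (metis card_image inj_on_subset subset_UNIV)
  also have "\<dots> \<le> card {i. l \<le> i \<and> i < l' \<and> down f (x 0) i}"
  proof (rule card_mono)
    show "A ` B1 \<subseteq> {i. l \<le> i \<and> i < l' \<and> down f (x 0) i}"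
    proof
      fix i assume "i \<in> A ` B1"
      then obtain k where "k \<in> B1" "i = A k" by blast
      then show "i \<in> {i. l \<le> i \<and> i < l' \<and> down f (x 0) i}"
        using W[of k] by (simp add: B1_def G0_def)
    qed
  qed simp
  finally have B1: "card B1 \<le> R'"
    using card_down_le[OF ends(3), of "x 0"] ends(1) by simp
  have "card B2 = card (M ` B2)"
    using inj by (metis card_image inj_on_subset subset_UNIV)
  also have "\<dots> \<le> card {i. i < l' \<and> \<not> down f (x n) i}"
  proof (rule card_mono)
    show "M ` B2 \<subseteq> {i. i < l' \<and> \<not> down f (x n) i}"
    proof
      fix i assume "i \<in> M ` B2"
      then obtain k where "k \<in> B2" "i = M k" by blast
      then show "i \<in> {i. i < l' \<and> \<not> down f (x n) i}"
        using W[of k] by (simp add: B2_def G0_def)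
    qed
  qed simp
  finally have B2: "card B2 \<le> R'"
    using card_up_le[of l' "x n"] ends(2) by simp
  have "{l div 3 + 1..<l' div 3} \<subseteq> G0" by (auto simp: G0_def)
  then have "l' div 3 - (l div 3 + 1) \<le> card G0"
    using card_mono[OF fin, of "{l div 3 + 1..<l' div 3}"] by simp
  moreover have "card G0 \<le> card G + card B1 + card B2"
  proof -
    have "G0 = G \<union> B1 \<union> B2" by (auto simp: G_def B1_def B2_def)
    then show ?thesis
      using card_Un_le[of "G \<union> B1" B2] card_Un_le[of G B1] by simp
  qed
  \<comment> \<open>Three letters per window; the discarded windows account for
    \<open>6 * R'\<close>, and rounding \<open>l\<close> and \<open>l'\<close> to multiples of three
    for 5.\<close>
  ultimately have ll: "l' - l \<le> 3 * card G + 6 * R' + 5"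
    using B1 B2 by linarith
  let ?in = "\<lambda>i k. down f (x i) (A k) \<and> \<not> down f (x i) (M k)"
  have finG: "finite G" using fin by (simp add: G_def)
  \<comment> \<open>Double counting of pairs of a window and a point inside it: at least
    \<open>18 * A0\<close> points per window, at most three windows per point.\<close>
  have "18 * A0 * card G = (\<Sum>k\<in>G. 18 * A0)" by simp
  also have "\<dots> \<le> (\<Sum>k\<in>G. card {i. i \<le> n \<and> ?in i k})"
  proof (rule sum_mono)
    fix k assume "k \<in> G"
    then show "18 * A0 \<le> card {i. i \<le> n \<and> ?in i k}"
      using W[of k] step far R J
      by (intro inside_window_count[where x = x and J = J and R = R]) (auto simp: G_def)
  qed
  also have "\<dots> = (\<Sum>k\<in>G. \<Sum>i\<le>n. if ?in i k then 1 else 0)"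
  proof (rule sum.cong[OF HOL.refl])
    fix k
    show "card {i. i \<le> n \<and> ?in i k} = (\<Sum>i\<le>n. if ?in i k then 1 else 0)"
      using card_filter_eq_sum[of "{..n}" "\<lambda>i. ?in i k"] by simp
  qed
  also have "\<dots> = (\<Sum>i\<le>n. \<Sum>k\<in>G. if ?in i k then 1 else 0)"
    by (rule sum.swap)
  also have "\<dots> = (\<Sum>i\<le>n. card {k \<in> G. ?in i k})"
    using card_filter_eq_sum[OF finG] by simp
  also have "\<dots> \<le> (\<Sum>i\<le>n. 3)"
    by (intro sum_mono card_inside_windows_le[OF W finG])
  finally have count: "18 * A0 * card G \<le> 3 * (n + 1)" by simp
  have "wdist (x 0) (x n) \<le> wdist (x 0) (initial f l) + wdist (initial f l) (x n)"
    "wdist (initial f l) (x n) \<le> wdist (initial f l) (initial f l') + wdist (initial f l') (x n)"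
    by (rule wdist_triangle)+
  then have "wdist (x 0) (x n) \<le> 2 * R' + (l' - l)"
    using ends wdist_initial_initial[OF ends(3)] wdist_commute[of "x 0"] by simp
  then have "wdist (x 0) (x n) + B \<le> 8 * R' + B + 5 + 3 * card G" using ll by simp
  then have "n \<le> A0 * (8 * R' + B + 5 + 3 * card G)"
    using qg mult_le_mono2 le_trans by blast
  then have "2 * n \<le> 2 * A0 * (8 * R' + B + 5) + 6 * (A0 * card G)"
    by (simp add: algebra_simps)
  then show ?thesis using count by simp
qed

text \<open>A far point lies on a maximal excursion between two near points. The excursion has
  boundedly many steps, so the point is boundedly far from the near point where it began.\<close>

lemma quasi_geodesic_near_ray:
  assumes J: "0 < J" and step: "\<And>i. i < n \<Longrightarrow> wdist (x i) (x (Suc i)) \<le> J"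
    and qg: "\<And>i j. i \<le> j \<Longrightarrow> j \<le> n \<Longrightarrow> j - i \<le> A0 * (wdist (x i) (x j) + B)"
    and ends: "wdist (initial f l0) (x 0) \<le> 2" "wdist (initial f l1) (x n) \<le> 2"
    and "i \<le> n"
  shows "\<exists>m. wdist (initial f m) (x i) \<le> excursion_radius J A0 + J * (excursion_length J A0 B + 1)"
proof -
  let ?R = "excursion_radius J A0" and ?L = "excursion_length J A0 B"
  define near where "near = (\<lambda>j. \<exists>m. wdist (initial f m) (x j) < ?R)"
  have "near 0" "near n"
    unfolding near_def excursion_radius_def by (rule exI, rule le_less_trans, rule ends, simp)+
  show ?thesis
  proof (cases "near i")
    case True
    then show ?thesis unfolding near_def using trans_le_add1 less_imp_le by blast
  next
    case False
    define u where "u = Max {j. j \<le> i \<and> near j}"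
    have ne: "{j. j \<le> i \<and> near j} \<noteq> {}" using \<open>near 0\<close> by auto
    have u: "u < i" "near u"
      using Max_in[OF _ ne] False unfolding u_def[symmetric] by (auto simp: nat_less_le)
    have u': "\<not> near j" if "u < j" "j \<le> i" for j
      using Max_ge[of "{j. j \<le> i \<and> near j}" j] that unfolding u_def[symmetric] by fastforce
    define v where "v = (LEAST j. i \<le> j \<and> near j)"
    have v0: "i \<le> v \<and> near v"
      unfolding v_def by (rule LeastI[of _ n]) (use \<open>near n\<close> \<open>i \<le> n\<close> in blast)
    have "v \<le> n"
      unfolding v_def by (rule Least_le) (use \<open>near n\<close> \<open>i \<le> n\<close> in blast)
    with v0 False have v: "i < v" "v \<le> n" "near v"
      by (auto simp: nat_less_le)
    have v': "\<not> near j" if "i \<le> j" "j < v" for j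
      using not_less_Least[of j "\<lambda>j. i \<le> j \<and> near j"] that unfolding v_def[symmetric] by blast
    have far: "?R \<le> wdist (initial f m) (x j)" if "u < j" "j < v" for j m
      using u'[of j] v'[of j] that by (cases "j \<le> i") (auto simp: near_def not_less)
    \<comment> \<open>The far points have indices from \<open>u + 1\<close> to
      \<open>u + k + 1\<close>, so the excursion proper has \<open>k\<close> steps.\<close>
    obtain k where k: "v = Suc (u + k + 1)"
      using u v by (metis Suc_eq_plus1 Suc_leI add_Suc less_imp_Suc_add less_trans_Suc)
    obtain l l' where l: "wdist (initial f l) (x u) < ?R" "wdist (initial f l') (x v) < ?R"
      using u v by (auto simp: near_def)
    have l1: "wdist (initial f l) (x (u + 1)) \<le> ?R + J"
      using wdist_triangle[of "initial f l" "x (u + 1)" "x u"] l(1) step[of u] u v by simp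
    have l2: "wdist (initial f l') (x (u + k + 1)) \<le> ?R + J"
      using wdist_triangle[of "initial f l'" "x (u + k + 1)" "x v"] l(2) step[of "u + k + 1"] v k
        wdist_commute[of "x v"] by simp
    have k_le: "k \<le> A0 * (wdist (x (u + 1)) (x (u + k + 1)) + B)"
      using qg[of "u + 1" "u + k + 1"] v k by simp
    have R: "J * (18 * A0 + 1) + 2 \<le> 2 * ?R" by (simp add: excursion_radius_def)
    have kL: "k \<le> ?L"
    proof (cases "l \<le> l'")
      case True
      show ?thesis
        unfolding excursion_length_def
        by (rule excursion_bound[where x = "\<lambda>j. x (u + j + 1)", OF _ J _ _ R _ _ True])
          (use step far l1 l2 k_le k v in \<open>auto simp: add.commute\<close>)
    next
      case False
      \<comment> \<open>Here the excursion runs backwards along the ray, so the reversed path is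
        used.\<close>
      have "k - i = Suc (k - Suc i)" if "i < k" for i using that by simp
      moreover have "wdist (x (Suc (u + (k - Suc i)))) (x (u + (k - Suc i) + 1 + 1)) \<le> J" if "i < k" for i
        using step[of "u + (k - Suc i) + 1"] that v k by simp
      ultimately have st: "wdist (x (u + (k - i) + 1)) (x (u + (k - Suc i) + 1)) \<le> J" if "i < k" for i
        using that wdist_commute by simp
      show ?thesis
        unfolding excursion_length_def
      proof (rule excursion_bound[where x = "\<lambda>j. x (u + (k - j) + 1)" and l = l' and l' = l, OF st J _ _ R])
        show "k \<le> A0 * (wdist (x (u + (k - 0) + 1)) (x (u + (k - k) + 1)) + B)"
          using k_le wdist_commute[of "x (u + 1)"] by simp
        show "?R \<le> wdist (initial f m) (x (u + (k - j) + 1))" if "j \<le> k" for j m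
          using k by (intro far) auto
      qed (use False l1 l2 in auto)
    qed
    have "wdist (x u) (x i) \<le> J * (i - u)"
      using step u v by (intro wdist_steps) auto
    also have "\<dots> \<le> J * (?L + 1)"
      using kL k v by (intro mult_le_mono2) simp
    finally show ?thesis
      using l(1) wdist_triangle[of "initial f l" "x i" "x u"]
      by (intro exI[of _ l]) linarith
  qed
qed

end

section \<open>Distances in the realization of a graph\<close>

lemma graph_dist_le_chain:
  assumes "x \<in> graph_points \<Delta>" "l \<in> chain_lengths \<Delta> x y" "y \<in> graph_points \<Delta>"
  shows "graph_dist \<Delta> x y \<le> l"
proof -
  have "bdd_below (chain_lengths \<Delta> x y)"
    using chain_lengths_lower[OF _ assms(1)] by (rule bdd_belowI)
  then show ?thesis
    using assms cInf_lower[of l] by (simp add: graph_dist_def)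
qed

lemma chain_lengths_step:
  assumes "(x, y) \<in> chain_step \<Delta>"
  shows "cell_dist x y \<in> chain_lengths \<Delta> x y"
  unfolding chain_lengths_def using assms
  by (intro CollectI exI[of _ 1] exI[of _ "\<lambda>i::nat. if i = 0 then x else y"]) simp

lemma chain_lengths_refl: "0 \<in> chain_lengths \<Delta> x x"
  unfolding chain_lengths_def by (intro CollectI exI[of _ 0] exI[of _ "\<lambda>i::nat. x"]) auto

lemma graph_dist_le_cell_dist:
  assumes "(x, y) \<in> chain_step \<Delta>"
  shows "graph_dist \<Delta> x y \<le> cell_dist x y"
  using graph_dist_le_chain[OF _ chain_lengths_step[OF assms]] chain_step_points[OF assms] by simp

lemma chain_step_vertex:
  assumes wf: "parcs \<Delta> \<subseteq> pverts \<Delta> \<times> pverts \<Delta>" and x: "x \<in> graph_points \<Delta>"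
  shows "\<exists>v\<in>pverts \<Delta>. (x, vertex_point v) \<in> chain_step \<Delta> \<and> cell_dist x (vertex_point v) \<le> 1"
proof -
  obtain c where c: "c \<in> graph_cells \<Delta>" "x \<in> cell_points c"
    using x by (auto simp: graph_points_def)
  then obtain v where v: "v \<in> c" "v \<in> pverts \<Delta>"
    using wf by (auto simp: graph_cells_def)
  have fin: "finite c" using c(1) by (rule finite_graph_cell)
  have vc: "vertex_point v \<in> cell_points c" using vertex_point_cell[OF fin v(1)] .
  then have "(x, vertex_point v) \<in> chain_step \<Delta>"
    using c unfolding chain_step_def by blast
  moreover have "cell_dist x (vertex_point v) \<le> 1"
  proof -
    have sub: "{u. x u \<noteq> 0} \<subseteq> c" "{u. vertex_point v u \<noteq> (0::real)} \<subseteq> c"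
      using c(2) vc by (auto simp: cell_points_def)
    have "cell_dist x (vertex_point v) = (\<Sum>u\<in>c. \<bar>x u - vertex_point v u\<bar>) / 2"
      by (rule cell_dist_eq_sum[OF fin sub])
    also have "\<dots> \<le> (\<Sum>u\<in>c. x u + vertex_point v u) / 2"
      using c(2) vc by (intro divide_right_mono sum_mono) (auto simp: cell_points_def abs_if)
    also have "\<dots> = 1" using c(2) vc by (simp add: sum.distrib cell_points_def)
    finally show ?thesis .
  qed
  ultimately show ?thesis using v(2) by blast
qed

lemma chain_lengths_nonempty:
  assumes wf: "parcs \<Delta> \<subseteq> pverts \<Delta> \<times> pverts \<Delta>"
    and con: "\<And>u v. u \<in> pverts \<Delta> \<Longrightarrow> v \<in> pverts \<Delta> \<Longrightarrow> (u, v) \<in> (parcs \<Delta>)\<^sup>*"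
    and "x \<in> graph_points \<Delta>" "y \<in> graph_points \<Delta>"
  shows "chain_lengths \<Delta> x y \<noteq> {}"
proof -
  have edges: "chain_lengths \<Delta> (vertex_point u) (vertex_point v) \<noteq> {}" if "(u, v) \<in> (parcs \<Delta>)\<^sup>*" for u v
    using that
  proof induction
    case base
    then show ?case using chain_lengths_refl by blast
  next
    case (step v w)
    then have "{v, w} \<in> graph_cells \<Delta>" by (auto simp: graph_cells_def)
    then have "(vertex_point v, vertex_point w) \<in> chain_step \<Delta>"
      unfolding chain_step_def using vertex_point_cell[of "{v, w}"] by auto
    then show ?case using step.IH chain_lengths_step chain_lengths_append by blast
  qed
  obtain u v where uv: "u \<in> pverts \<Delta>" "v \<in> pverts \<Delta>"
    "(x, vertex_point u) \<in> chain_step \<Delta>" "(y, vertex_point v) \<in> chain_step \<Delta>"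
    using chain_step_vertex[OF wf] assms(3,4) by meson
  have "chain_lengths \<Delta> (vertex_point u) (vertex_point v) \<noteq> {}"
    using edges con uv by blast
  moreover have "chain_lengths \<Delta> (vertex_point v) y \<noteq> {}" "chain_lengths \<Delta> x (vertex_point u) \<noteq> {}"
    using uv chain_lengths_step chain_step_sym by blast+
  ultimately show ?thesis using chain_lengths_append by blast
qed

text \<open>One chain bounds the distance from above, but a lower bound has to hold for all chains.
  It comes from functions that vary by at most 1 along each edge: their affine extensions are
  1-Lipschitz.\<close>

definition affine_extension :: "('v \<Rightarrow> real) \<Rightarrow> ('v \<Rightarrow> real) \<Rightarrow> real" where
  "affine_extension F x = (\<Sum>v | x v \<noteq> 0. x v * F v)"

lemma affine_extension_eq_sum:
  assumes "finite c" "{v. x v \<noteq> 0} \<subseteq> c"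
  shows "affine_extension F x = (\<Sum>v\<in>c. x v * F v)"
  unfolding affine_extension_def by (rule sum.mono_neutral_left) (use assms in auto)

lemma affine_extension_vertex_point [simp]: "affine_extension F (vertex_point v) = F v"
  using affine_extension_eq_sum[of "{v}" "vertex_point v" F] by (simp add: vertex_point_def)

lemma affine_extension_step:
  assumes lip: "\<And>u v. (u, v) \<in> parcs \<Delta> \<Longrightarrow> \<bar>F u - F v\<bar> \<le> 1"
    and "(x, y) \<in> chain_step \<Delta>"
  shows "\<bar>affine_extension F x - affine_extension F y\<bar> \<le> cell_dist x y"
proof -
  obtain c where c: "c \<in> graph_cells \<Delta>" "x \<in> cell_points c" "y \<in> cell_points c"
    using assms(2) by (auto simp: chain_step_def)
  have fin: "finite c" using c(1) by (rule finite_graph_cell)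
  have sub: "{v. x v \<noteq> 0} \<subseteq> c" "{v. y v \<noteq> 0} \<subseteq> c"
    using c by (auto simp: cell_points_def)
  have ax: "affine_extension F x = (\<Sum>v\<in>c. x v * F v)" "affine_extension F y = (\<Sum>v\<in>c. y v * F v)"
    using affine_extension_eq_sum[OF fin] sub by blast+
  have cd: "cell_dist x y = (\<Sum>v\<in>c. \<bar>x v - y v\<bar>) / 2"
    by (rule cell_dist_eq_sum[OF fin sub])
  have sums: "sum x c = 1" "sum y c = 1" using c by (auto simp: cell_points_def)
  consider v where "c = {v}" | u v where "c = {u, v}" "u \<noteq> v" "(u, v) \<in> parcs \<Delta>"
    using c(1) by (auto simp: graph_cells_def)
  then show ?thesis
  proof cases
    case 1
    then show ?thesis using ax cd sums by simp
  next
    case 2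
    then have xy: "x v = 1 - x u" "y v = 1 - y u" using sums by auto
    have "affine_extension F x - affine_extension F y = (x u - y u) * (F u - F v)"
      using 2 ax by (simp add: xy algebra_simps)
    moreover have "cell_dist x y = \<bar>x u - y u\<bar>"
      using 2 cd by (simp add: xy)
    ultimately show ?thesis
      using lip[OF 2(3)] mult_left_mono[of "\<bar>F u - F v\<bar>" 1 "\<bar>x u - y u\<bar>"] by (simp add: abs_mult)
  qed
qed

lemma affine_extension_le_graph_dist:
  assumes lip: "\<And>u v. (u, v) \<in> parcs \<Delta> \<Longrightarrow> \<bar>F u - F v\<bar> \<le> 1"
    and xy: "x \<in> graph_points \<Delta>" "y \<in> graph_points \<Delta>" and ne: "chain_lengths \<Delta> x y \<noteq> {}"
  shows "\<bar>affine_extension F x - affine_extension F y\<bar> \<le> graph_dist \<Delta> x y"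
proof -
  have "\<bar>affine_extension F x - affine_extension F y\<bar> \<le> l" if "l \<in> chain_lengths \<Delta> x y" for l
  proof -
    obtain n c where c: "c 0 = x" "c n = y" "\<And>i. i < n \<Longrightarrow> (c i, c (Suc i)) \<in> chain_step \<Delta>"
      and l: "l = (\<Sum>i<n. cell_dist (c i) (c (Suc i)))"
      using \<open>l \<in> _\<close> by (auto simp: chain_lengths_def)
    have "\<bar>affine_extension F x - affine_extension F (c k)\<bar> \<le> (\<Sum>i<k. cell_dist (c i) (c (Suc i)))"
      if "k \<le> n" for k
      using that
    proof (induction k)
      case (Suc k)
      then have "\<bar>affine_extension F (c k) - affine_extension F (c (Suc k))\<bar> \<le> cell_dist (c k) (c (Suc k))"
        using affine_extension_step[of \<Delta> F, OF lip c(3)[of k]] by simp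
      then show ?case using Suc by auto
    qed (simp add: c)
    from this[of n] show ?thesis using c l by simp
  qed
  then show ?thesis using xy ne by (auto simp: graph_dist_def intro!: cInf_greatest)
qed

definition edge_point :: "'v \<Rightarrow> 'v \<Rightarrow> real \<Rightarrow> 'v \<Rightarrow> real" where
  "edge_point u v \<theta> = (\<lambda>x. (1 - \<theta>) * vertex_point u x + \<theta> * vertex_point v x)"

lemma edge_point_0 [simp]: "edge_point u v 0 = vertex_point u"
  and edge_point_1 [simp]: "edge_point u v 1 = vertex_point v"
  by (simp_all add: edge_point_def)

lemma edge_point_cell:
  assumes "0 \<le> \<theta>" "\<theta> \<le> 1"
  shows "edge_point u v \<theta> \<in> cell_points {u, v}"
proof -
  have "vertex_point u \<in> cell_points {u, v}" "vertex_point v \<in> cell_points {u, v}"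
    by (auto intro: vertex_point_cell)
  then have "sum (vertex_point u) {u, v} = (1::real)" "sum (vertex_point v) {u, v} = (1::real)"
    "\<And>x. x \<notin> {u, v} \<Longrightarrow> vertex_point u x = (0::real)" "\<And>x. x \<notin> {u, v} \<Longrightarrow> vertex_point v x = (0::real)"
    by (auto simp: cell_points_def simp del: sum.insert)
  then show ?thesis
    using assms unfolding cell_points_def edge_point_def
    by (simp add: sum.distrib sum_distrib_left[symmetric] vertex_point_def)
qed

lemma edge_point_step:
  assumes "(u, v) \<in> parcs \<Delta>" "0 \<le> \<theta>" "\<theta> \<le> 1" "0 \<le> \<theta>'" "\<theta>' \<le> 1"
  shows "(edge_point u v \<theta>, edge_point u v \<theta>') \<in> chain_step \<Delta>"
proof -
  have "{u, v} \<in> graph_cells \<Delta>" using assms(1) by (auto simp: graph_cells_def)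
  then show ?thesis
    unfolding chain_step_def
    by (intro CollectI case_prodI bexI[of _ "{u, v}"] conjI edge_point_cell assms)
qed

lemma cell_dist_edge_point: "cell_dist (edge_point u v \<theta>) (edge_point u v \<theta>') \<le> \<bar>\<theta> - \<theta>'\<bar>"
proof -
  have "cell_dist (edge_point u v \<theta>) (edge_point u v \<theta>')
      = (\<Sum>x\<in>{u, v}. \<bar>edge_point u v \<theta> x - edge_point u v \<theta>' x\<bar>) / 2"
    by (rule cell_dist_eq_sum) (auto simp: edge_point_def vertex_point_def)
  also have "\<dots> \<le> \<bar>\<theta> - \<theta>'\<bar>"
    by (cases "u = v") (auto simp: edge_point_def vertex_point_def)
  finally show ?thesis .
qed

lemma affine_extension_edge_point: "affine_extension F (edge_point u v \<theta>) = (1 - \<theta>) * F u + \<theta> * F v"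
proof -
  have "affine_extension F (edge_point u v \<theta>) = (\<Sum>x\<in>{u, v}. edge_point u v \<theta> x * F x)"
    by (rule affine_extension_eq_sum) (auto simp: edge_point_def vertex_point_def)
  then show ?thesis by (cases "u = v") (auto simp: edge_point_def vertex_point_def algebra_simps)
qed

section \<open>Right-angled Coxeter groups by words\<close>

locale racg_graph =
  fixes \<Gamma> :: "'a pair_pre_digraph"
  assumes pg: "pair_graph \<Gamma>"
begin

abbreviation adj :: "'a \<Rightarrow> 'a \<Rightarrow> bool" where
  "adj s t \<equiv> (s, t) \<in> parcs \<Gamma>"

abbreviation V :: "'a set" where
  "V \<equiv> pverts \<Gamma>"

abbreviation R :: "'a gword rel" where
  "R \<equiv> pres_rel V (racg_relations \<Gamma>)"

sublocale trace_words adj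
proof
  interpret pair_graph \<Gamma> by (rule pg)
  show "adj t s" if "adj s t" for s t
    using that arcs_symmetric by simp
  show "\<not> adj s s" for s
    using no_loops' by blast
qed

lemma adj_verts: "adj s t \<Longrightarrow> s \<in> V \<and> t \<in> V"
proof -
  interpret pair_graph \<Gamma> by (rule pg)
  show "adj s t \<Longrightarrow> s \<in> V \<and> t \<in> V" using wellformed by fastforce
qed

section \<open>Words and the presentation\<close>

definition gword :: "'a list \<Rightarrow> 'a gword" where
  "gword w = map (Pair True) w"

definition cls :: "'a list \<Rightarrow> 'a gword set" where
  "cls w = R `` {gword w}"

lemma gword_append [simp]: "gword (u @ v) = gword u @ gword v"
  by (simp add: gword_def)

lemma gword_simps [simp]: "gword [] = []" "gword (s # w) = (True, s) # gword w"
  by (simp_all add: gword_def)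

lemma gword_gwords [simp]: "gword w \<in> gwords V \<longleftrightarrow> set w \<subseteq> V"
  by (induction w) auto

lemma map_snd_gword [simp]: "map snd (gword w) = w"
  by (simp add: gword_def comp_def)

text \<open>With signs forgotten, formal cancellations and relators become the cancellations and
  swaps of \<open>cong\<close>. This is what makes length and descents well defined on group
  elements.\<close>

lemma pres_rel_cong: "(u, v) \<in> R \<Longrightarrow> cong (map snd u) (map snd v)"
proof (induction rule: pres_rel.induct)
  case (relator a b u v)
  from relator.hyps(3) show ?case
    unfolding racg_relations_def by (auto simp: cong_cancel cong_swap)
qed (auto simp: cong_cancel intro: cong_sym cong_trans)

lemma cls_eq_iff_rel: "set u \<subseteq> V \<Longrightarrow> cls u = cls v \<longleftrightarrow> (gword u, gword v) \<in> R" if "set v \<subseteq> V"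
  unfolding cls_def using that by (intro eq_equiv_class_iff[OF equiv_pres_rel]) auto

lemma cls_eq_imp_cong: "set u \<subseteq> V \<Longrightarrow> set v \<subseteq> V \<Longrightarrow> cls u = cls v \<Longrightarrow> cong u v"
  using cls_eq_iff_rel pres_rel_cong by fastforce

lemma rel_context:
  assumes "(gword u, gword v) \<in> R" "set a \<subseteq> V" "set b \<subseteq> V"
  shows "(gword (a @ u @ b), gword (a @ v @ b)) \<in> R"
  using pres_rel_context[OF assms(1), of "gword a" "gword b"] assms by simp

lemma rel_cancel: "s \<in> V \<Longrightarrow> (gword [s, s], gword []) \<in> R"
proof -
  assume s: "s \<in> V"
  then have "([(True, s), (True, s)], []) \<in> racg_relations \<Gamma>"
    by (simp add: racg_relations_def)
  from pres_rel.relator[of "[]" V "[]", OF _ _ this] s show ?thesis by simp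
qed

lemma rel_swap: "adj s t \<Longrightarrow> (gword [s, t], gword [t, s]) \<in> R"
proof -
  assume st: "adj s t"
  then have "([(True, s), (True, t)], [(True, t), (True, s)]) \<in> racg_relations \<Gamma>"
    by (simp add: racg_relations_def)
  from pres_rel.relator[of "[]" V "[]", OF _ _ this] adj_verts[OF st] show ?thesis by simp
qed

lemma rel_front:
  assumes "front s w" "set w \<subseteq> V"
  shows "(gword w, gword (s # remove1 s w)) \<in> R"
  using assms
proof (induction w)
  case (Cons a w)
  show ?case
  proof (cases "a = s")
    case True
    then show ?thesis using Cons.prems by (auto intro: pres_rel.refl)
  next
    case False
    with Cons have as: "adj a s" and IH: "(gword w, gword (s # remove1 s w)) \<in> R" by auto
    have sub: "set (remove1 s w) \<subseteq> V" using Cons.prems set_remove1_subset by fastforce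
    have 1: "(gword (a # w), gword (a # s # remove1 s w)) \<in> R"
      using rel_context[OF IH, of "[a]" "[]"] Cons.prems by simp
    have 2: "(gword (a # s # remove1 s w), gword (s # a # remove1 s w)) \<in> R"
      using rel_context[OF rel_swap[OF as], of "[]" "remove1 s w"] sub by simp
    show ?thesis using pres_rel.trans[OF 1 2] False by simp
  qed
qed simp

lemma set_act: "set (act s w) \<subseteq> insert s (set w)"
  using set_remove1_subset[of s w] by (auto simp: act_def)

lemma rel_act:
  assumes "s \<in> V" "set w \<subseteq> V"
  shows "(gword (s # w), gword (act s w)) \<in> R"
proof (cases "front s w")
  case True
  have sub: "set (remove1 s w) \<subseteq> V" using assms set_remove1_subset by fastforce
  have 1: "(gword (s # w), gword (s # s # remove1 s w)) \<in> R"
    using rel_context[OF rel_front[OF True assms(2)], of "[s]" "[]"] assms by simp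
  have 2: "(gword (s # s # remove1 s w), gword (remove1 s w)) \<in> R"
    using rel_context[OF rel_cancel[OF assms(1)], of "[]" "remove1 s w"] sub by simp
  show ?thesis using pres_rel.trans[OF 1 2] True by (simp add: act_def)
next
  case False
  then show ?thesis using assms by (auto simp: act_def intro: pres_rel.refl)
qed

text \<open>The computation of the normal form is replayed inside the presentation; the resulting
  word spells a shortest edge path in the Cayley graph.\<close>

lemma rel_nf:
  assumes "set w \<subseteq> V"
  shows "(gword w, gword (nf w)) \<in> R \<and> set (nf w) \<subseteq> V"
  using assms
proof (induction w)
  case Nil
  then show ?case by (simp add: nf_def pres_rel.refl)
next
  case (Cons s w)
  then have IH: "(gword w, gword (nf w)) \<in> R" "set (nf w) \<subseteq> V" and s: "s \<in> V" by auto
  have 1: "(gword (s # w), gword (s # nf w)) \<in> R"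
    using rel_context[OF IH(1), of "[s]" "[]"] s by simp
  have "(gword (s # w), gword (nf (s # w))) \<in> R"
    using pres_rel.trans[OF 1 rel_act[OF s IH(2)]] by (simp add: nf_Cons)
  then show ?case using set_act[of s "nf w"] IH(2) s by (auto simp: nf_Cons)
qed

lemma rel_rev: "set w \<subseteq> V \<Longrightarrow> (gword (w @ rev w), gword []) \<in> R"
proof (induction w rule: rev_induct)
  case Nil
  then show ?case by (simp add: pres_rel.refl)
next
  case (snoc s w)
  have 1: "(gword (w @ [s, s] @ rev w), gword (w @ [] @ rev w)) \<in> R"
    using snoc.prems by (intro rel_context rel_cancel) auto
  show ?case using pres_rel.trans[OF 1, of "gword []"] snoc by simp
qed

text \<open>Formal inverses can be replaced by generators: a square of the generator is inserted
  after the inverse, and the inverse cancels its first letter.\<close>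

lemma rel_gword_map_snd: "u \<in> gwords V \<Longrightarrow> (u, gword (map snd u)) \<in> R"
proof (induction u)
  case Nil
  then show ?case by (simp add: pres_rel.refl)
next
  case (Cons x u)
  obtain e s where x: "x = (e, s)" by (cases x)
  have s: "s \<in> V" and u: "u \<in> gwords V" using Cons.prems x by auto
  have IH: "([x] @ u @ [], [x] @ gword (map snd u) @ []) \<in> R"
    using Cons x by (intro pres_rel_context) auto
  have "([(e, s)], [(True, s)]) \<in> R"
  proof (cases e)
    case False
    have "(gword [], gword [s, s]) \<in> R"
      by (rule pres_rel.sym[OF rel_cancel[OF s]])
    from pres_rel_context[OF this, of "[(False, s)]" "[]"]
    have A: "([(False, s)], [(False, s), (True, s), (True, s)]) \<in> R"
      using s by simp
    have B: "([(False, s), (True, s), (True, s)], [(True, s)]) \<in> R"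
      using pres_rel.cancel[of "[]" V "[(True, s)]" s False] s by simp
    show ?thesis using pres_rel.trans[OF A B] False by simp
  next
    case True
    then show ?thesis using s by (simp add: pres_rel.refl)
  qed
  moreover have "gword (map snd u) \<in> gwords V"
    using Cons.IH[OF u] pres_rel_gwords by blast
  ultimately have "([] @ [(e, s)] @ gword (map snd u), [] @ [(True, s)] @ gword (map snd u)) \<in> R"
    by (intro pres_rel_context) simp_all
  then have B: "(x # gword (map snd u), gword (map snd (x # u))) \<in> R"
    by (simp add: x)
  have A: "(x # u, x # gword (map snd u)) \<in> R"
    using IH by simp
  show ?case by (rule pres_rel.trans[OF A B])
qed

subsection \<open>Words as rays in the Cayley graph\<close>

abbreviation \<Delta> :: "'a gword set pair_pre_digraph" where
  "\<Delta> \<equiv> cayley_graph (racg \<Gamma>) (racg_gens \<Gamma>)"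

abbreviation X :: "('a gword set \<Rightarrow> real) metric" where
  "X \<equiv> graph_metric \<Delta>"

definition rep :: "'a gword set \<Rightarrow> 'a list" where
  "rep A = (SOME w. set w \<subseteq> V \<and> cls w = A)"

definition vdist :: "'a gword set \<Rightarrow> 'a gword set \<Rightarrow> nat" where
  "vdist A B = wdist (rep A) (rep B)"

definition vtx :: "(nat \<Rightarrow> 'a) \<Rightarrow> nat \<Rightarrow> 'a gword set" where
  "vtx f n = cls (initial f n)"

definition ray :: "(nat \<Rightarrow> 'a) \<Rightarrow> real \<Rightarrow> 'a gword set \<Rightarrow> real" where
  "ray f t = edge_point (vtx f (nat \<lfloor>t\<rfloor>)) (vtx f (Suc (nat \<lfloor>t\<rfloor>))) (t - real (nat \<lfloor>t\<rfloor>))"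

lemma carrier_racg: "carrier (racg \<Gamma>) = cls ` {w. set w \<subseteq> V}"
proof -
  have "R `` {u} \<in> cls ` {w. set w \<subseteq> V}" if "u \<in> gwords V" for u
  proof -
    have rel: "(u, gword (map snd u)) \<in> R" by (rule rel_gword_map_snd[OF that])
    then have "R `` {u} = cls (map snd u)"
      unfolding cls_def by (rule equiv_class_eq[OF equiv_pres_rel])
    moreover have "set (map snd u) \<subseteq> V" using pres_rel_gwords[OF rel] by simp
    ultimately show ?thesis by blast
  qed
  moreover have "cls w \<in> (\<lambda>w. R `` {w}) ` gwords V" if "set w \<subseteq> V" for w
    using that unfolding cls_def by (intro imageI) simp
  ultimately show ?thesis
    unfolding racg_def presented_carrier by blast
qed

lemma racg_mult: "set u \<subseteq> V \<Longrightarrow> set v \<subseteq> V \<Longrightarrow> cls u \<otimes>\<^bsub>racg \<Gamma>\<^esub> cls v = cls (u @ v)"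
  using presented_mult[of "gword u" V "gword v" "racg_relations \<Gamma>"] by (simp add: racg_def cls_def)

lemma racg_one: "\<one>\<^bsub>racg \<Gamma>\<^esub> = cls []"
  by (simp add: racg_def presented_one cls_def)

lemma racg_gens_eq: "racg_gens \<Gamma> = (\<lambda>s. cls [s]) ` V"
  by (simp add: racg_gens_def presented_gens_def cls_def)

lemma pverts_cayley: "pverts \<Delta> = cls ` {w. set w \<subseteq> V}"
  by (simp add: cayley_graph_def carrier_racg)

lemma parcs_cayley_iff:
  "(A, B) \<in> parcs \<Delta> \<longleftrightarrow> (\<exists>w s. set w \<subseteq> V \<and> s \<in> V \<and>
     (A = cls w \<and> B = cls (w @ [s]) \<or> B = cls w \<and> A = cls (w @ [s])))"
proof -
  have "cls w \<otimes>\<^bsub>racg \<Gamma>\<^esub> cls [s] = cls (w @ [s])" if "set w \<subseteq> V" "s \<in> V" for w s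
    using that racg_mult[of w "[s]"] by simp
  then show ?thesis
    unfolding cayley_graph_def carrier_racg racg_gens_eq by fastforce
qed

section \<open>The word metric inside the metric of the Cayley graph\<close>

lemma wdist_cong: "cong u u' \<Longrightarrow> cong v v' \<Longrightarrow> wdist u v = wdist u' v'"
  unfolding wdist_def by (intro cong_len cong_append cong_rev)

lemma vdist_cls:
  assumes "set u \<subseteq> V" "set v \<subseteq> V"
  shows "vdist (cls u) (cls v) = wdist u v"
proof -
  have "cong (rep (cls w)) w" if "set w \<subseteq> V" for w
  proof -
    have "set (rep (cls w)) \<subseteq> V \<and> cls (rep (cls w)) = cls w"
      unfolding rep_def by (rule someI[of _ w]) (simp add: that)
    then show ?thesis using cls_eq_imp_cong that by blast
  qed
  then show ?thesis using assms by (simp add: vdist_def wdist_cong)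
qed

lemma wdist_snoc_le: "wdist w (w @ [s]) \<le> 1"
  using wdist_append_left[of w "[]" "[s]"] len_le_length[of "[s]"] by (simp add: wdist_def)

lemma vdist_lipschitz:
  assumes "(A, B) \<in> parcs \<Delta>" "set c \<subseteq> V"
  shows "\<bar>real (vdist (cls c) A) - real (vdist (cls c) B)\<bar> \<le> 1"
proof -
  obtain w s where ws: "set w \<subseteq> V" "s \<in> V"
    "A = cls w \<and> B = cls (w @ [s]) \<or> B = cls w \<and> A = cls (w @ [s])"
    using assms(1) unfolding parcs_cayley_iff by blast
  have v: "vdist (cls c) (cls w) = wdist c w" "vdist (cls c) (cls (w @ [s])) = wdist c (w @ [s])"
    using ws assms(2) by (auto intro!: vdist_cls)
  have "wdist c (w @ [s]) \<le> wdist c w + 1" "wdist c w \<le> wdist c (w @ [s]) + 1"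
    using wdist_triangle[of c "w @ [s]" w] wdist_triangle[of c w "w @ [s]"] wdist_snoc_le[of w s]
      wdist_commute[of w "w @ [s]"] by linarith+
  then show ?thesis using ws(3) v by auto
qed

lemmas mspace_X = graph_metric_racg(1)[of \<Gamma>] and mdist_X = graph_metric_racg(2)[of \<Gamma>]

lemma chain_lengths_cayley_nonempty:
  assumes "x \<in> mspace X" "y \<in> mspace X"
  shows "chain_lengths \<Delta> x y \<noteq> {}"
proof (rule chain_lengths_nonempty)
  show "parcs \<Delta> \<subseteq> pverts \<Delta> \<times> pverts \<Delta>"
    unfolding racg_def racg_gens_def
    by (intro cayley_graph_wf group_presented_group presented_gens_subset)
  show "(u, v) \<in> (parcs \<Delta>)\<^sup>*" if "u \<in> pverts \<Delta>" "v \<in> pverts \<Delta>" for u v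
    using that unfolding racg_def racg_gens_def
    by (intro cayley_graph_connected group_presented_group presented_gens_subset
        generate_presented_gens) (auto simp: cayley_graph_def)
qed (use assms mspace_X in auto)

lemma vertex_in_X: "set w \<subseteq> V \<Longrightarrow> vertex_point (cls w) \<in> mspace X"
  using vertex_point_graph_points[of "cls w" \<Delta>] by (simp add: mspace_X pverts_cayley)

text \<open>The distance from the vertex \<open>c\<close> is used as a height function; it changes
  by at most 1 along every edge.\<close>

lemma height_le_mdist:
  assumes "x \<in> mspace X" "y \<in> mspace X" "set c \<subseteq> V"
  shows "\<bar>affine_extension (\<lambda>A. real (vdist (cls c) A)) x - affine_extension (\<lambda>A. real (vdist (cls c) A)) y\<bar>
    \<le> mdist X x y"
  unfolding mdist_X
proof (rule affine_extension_le_graph_dist)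
  show "\<bar>real (vdist (cls c) A) - real (vdist (cls c) B)\<bar> \<le> 1" if "(A, B) \<in> parcs \<Delta>" for A B
    by (rule vdist_lipschitz[OF that assms(3)])
  show "x \<in> graph_points \<Delta>" "y \<in> graph_points \<Delta>"
    using assms(1,2) unfolding mspace_X .
  show "chain_lengths \<Delta> x y \<noteq> {}" by (rule chain_lengths_cayley_nonempty[OF assms(1,2)])
qed

lemma mdist_edge_le:
  assumes "(A, B) \<in> parcs \<Delta>" "0 \<le> \<theta>" "\<theta> \<le> 1" "0 \<le> \<theta>'" "\<theta>' \<le> 1"
  shows "mdist X (edge_point A B \<theta>) (edge_point A B \<theta>') \<le> \<bar>\<theta> - \<theta>'\<bar>"
  unfolding mdist_X using graph_dist_le_cell_dist[OF edge_point_step[OF assms]] cell_dist_edge_point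
  by (rule order_trans)

lemma snoc_arc: "set w \<subseteq> V \<Longrightarrow> s \<in> V \<Longrightarrow> (cls w, cls (w @ [s])) \<in> parcs \<Delta>"
  using parcs_cayley_iff by blast

text \<open>From above, the edge path spelled by the normal form of \<open>rev u @ v\<close>; from
  below, the height measured from \<open>u\<close>.\<close>

lemma mdist_vertex:
  assumes u: "set u \<subseteq> V" and v: "set v \<subseteq> V"
  shows "mdist X (vertex_point (cls u)) (vertex_point (cls v)) = real (wdist u v)"
proof (rule antisym)
  have *: "mdist X (vertex_point (cls u)) (vertex_point (cls (u @ z))) \<le> real (length z)"
    if "set z \<subseteq> V" for z
    using that
  proof (induction z rule: rev_induct)
    case Nil
    have "mdist X (vertex_point (cls u)) (vertex_point (cls u)) = 0"
      using mdist_zero[OF vertex_in_X[OF u] vertex_in_X[OF u]] by simp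
    then show ?case by simp
  next
    case (snoc s z)
    have in_V: "set (u @ z) \<subseteq> V" "s \<in> V" "set ((u @ z) @ [s]) \<subseteq> V" using snoc.prems u by auto
    have "mdist X (vertex_point (cls (u @ z))) (vertex_point (cls ((u @ z) @ [s]))) \<le> 1"
      using mdist_edge_le[OF snoc_arc[OF in_V(1,2)], of 0 1] by simp
    then show ?case
      using snoc mdist_triangle[OF vertex_in_X[OF u] vertex_in_X[OF in_V(1)] vertex_in_X[OF in_V(3)]]
      by simp
  qed
  define z where "z = nf (rev u @ v)"
  have rz: "(gword (rev u @ v), gword z) \<in> R" "set z \<subseteq> V"
    using rel_nf[of "rev u @ v"] u v by (auto simp: z_def)
  have 1: "(gword (u @ (rev u @ v)), gword (u @ z)) \<in> R"
    using rel_context[OF rz(1), of u "[]"] u by simp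
  have 2: "(gword (u @ (rev u @ v)), gword v) \<in> R"
    using rel_context[OF rel_rev[OF u], of "[]" v] v by simp
  have "(gword (u @ z), gword v) \<in> R"
    by (rule pres_rel.trans[OF pres_rel.sym[OF 1] 2])
  then have "cls (u @ z) = cls v"
    using cls_eq_iff_rel[of v "u @ z"] u v rz(2) by simp
  moreover have "length z = wdist u v" by (simp add: z_def wdist_def len_def)
  ultimately show "mdist X (vertex_point (cls u)) (vertex_point (cls v)) \<le> real (wdist u v)"
    using *[OF rz(2)] by simp
  have "wdist u u = 0" using wdist_append_left[of u "[]" "[]"] by (simp add: wdist_def)
  then show "real (wdist u v) \<le> mdist X (vertex_point (cls u)) (vertex_point (cls v))"
    using height_le_mdist[OF vertex_in_X[OF u] vertex_in_X[OF v] u] vdist_cls u v by simp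
qed

lemma near_vertex:
  assumes "x \<in> mspace X"
  shows "\<exists>w. set w \<subseteq> V \<and> mdist X x (vertex_point (cls w)) \<le> 1"
proof -
  have "parcs \<Delta> \<subseteq> pverts \<Delta> \<times> pverts \<Delta>"
    unfolding racg_def racg_gens_def
    by (intro cayley_graph_wf group_presented_group presented_gens_subset)
  from chain_step_vertex[OF this assms[unfolded mspace_X]]
  obtain v where v: "v \<in> pverts \<Delta>" "(x, vertex_point v) \<in> chain_step \<Delta>"
    "cell_dist x (vertex_point v) \<le> 1" by blast
  then have "mdist X x (vertex_point v) \<le> 1"
    using graph_dist_le_cell_dist[OF v(2)] by (simp add: mdist_X)
  then show ?thesis using v(1) pverts_cayley by auto
qed

text \<open>At the right end the floor already selects the next edge, but both edges give the same
  vertex; so the formula holds on the closed segment.\<close>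

lemma ray_segment:
  assumes "real n \<le> t" "t \<le> real (Suc n)"
  shows "ray f t = edge_point (vtx f n) (vtx f (Suc n)) (t - real n)"
proof (cases "t = real (Suc n)")
  case True
  then have "nat \<lfloor>t\<rfloor> = Suc n" by simp
  then show ?thesis using True by (simp add: ray_def)
next
  case False
  then have "\<lfloor>t\<rfloor> = int n" using assms by (intro floor_unique) auto
  then show ?thesis by (simp add: ray_def)
qed

lemma ray_of_nat: "ray f (real n) = vertex_point (vtx f n)"
  using ray_segment[of n "real n" f] by simp

lemma floor_segment: "0 \<le> t \<Longrightarrow> real (nat \<lfloor>t\<rfloor>) \<le> t \<and> t \<le> real (Suc (nat \<lfloor>t\<rfloor>))"
  by linarith

context
  fixes f :: "nat \<Rightarrow> 'a"
  assumes f_V: "\<And>n. f n \<in> V"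
begin

lemma set_initial: "set (initial f n) \<subseteq> V"
  using f_V by (auto simp: initial_def)

lemma vtx_arc: "(vtx f n, vtx f (Suc n)) \<in> parcs \<Delta>"
  unfolding vtx_def initial_Suc by (intro snoc_arc set_initial f_V)

lemma ray_in_X:
  assumes "0 \<le> t"
  shows "ray f t \<in> mspace X"
proof -
  let ?n = "nat \<lfloor>t\<rfloor>"
  have "(ray f t, ray f t) \<in> chain_step \<Delta>"
    using floor_segment[OF assms] vtx_arc[of ?n] unfolding ray_def
    by (intro edge_point_step) linarith+
  then show ?thesis using chain_step_points mspace_X by blast
qed

lemma ray_segment_dist:
  assumes "real n \<le> s" "s \<le> real (Suc n)" "real n \<le> t" "t \<le> real (Suc n)"
  shows "mdist X (ray f s) (ray f t) \<le> \<bar>s - t\<bar>"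
  using mdist_edge_le[OF vtx_arc, of "s - real n" "t - real n" n] assms
  by (simp add: ray_segment)

lemma ray_dist_le:
  assumes "0 \<le> s" "s \<le> t"
  shows "mdist X (ray f s) (ray f t) \<le> t - s"
proof -
  define m n where "m = nat \<lfloor>s\<rfloor>" and "n = nat \<lfloor>t\<rfloor>"
  have s: "real m \<le> s" "s \<le> real (Suc m)" and t: "real n \<le> t" "t \<le> real (Suc n)"
    using floor_segment assms by (auto simp: m_def n_def)
  have "m \<le> n" using assms by (simp add: m_def n_def nat_mono floor_mono)
  then consider "m = n" | "Suc m \<le> n" by linarith
  then show ?thesis
  proof cases
    case 1
    then show ?thesis using ray_segment_dist[of n s t] s t assms by simp
  next
    case 2
    have X: "ray f s \<in> mspace X" "ray f t \<in> mspace X" "ray f (real (Suc m)) \<in> mspace X" "ray f (real n) \<in> mspace X"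
      using assms by (auto intro!: ray_in_X)
    have "wdist (initial f (Suc m)) (initial f n) \<le> n - Suc m"
      using wdist_append_left[of "initial f (Suc m)" "[]" "map f [Suc m..<n]"] initial_split[OF 2, of f]
        len_le_length[of "map f [Suc m..<n]"] by (simp add: wdist_def)
    moreover have "mdist X (ray f (real (Suc m))) (ray f (real n)) = real (wdist (initial f (Suc m)) (initial f n))"
      unfolding ray_of_nat vtx_def by (intro mdist_vertex set_initial)
    ultimately have 1: "mdist X (ray f (real (Suc m))) (ray f (real n)) \<le> real n - real (Suc m)"
      using 2 by linarith
    have "mdist X (ray f s) (ray f (real (Suc m))) \<le> real (Suc m) - s"
      using ray_segment_dist[of m s "real (Suc m)"] s by simp
    moreover have "mdist X (ray f (real n)) (ray f t) \<le> t - real n"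
      using ray_segment_dist[of n "real n" t] t by simp
    ultimately show ?thesis
      using 1 mdist_triangle[OF X(1,3,2)] mdist_triangle[OF X(3,4,2)] by linarith
  qed
qed

text \<open>The height above the identity is \<open>t\<close> at time \<open>t\<close>, so the upper
  bound \<open>ray_dist_le\<close> is sharp.\<close>

lemma geodesic_ray_word:
  assumes red: "\<And>n. red (initial f n)"
  shows "geodesic_ray X (vertex_point \<one>\<^bsub>racg \<Gamma>\<^esub>) (ray f)"
proof -
  let ?h = "affine_extension (\<lambda>A. real (vdist (cls []) A))"
  have h: "?h (ray f t) = t" if "0 \<le> t" for t
  proof -
    have "vdist (cls []) (vtx f n) = n" for n
      using vdist_cls[of "[]" "initial f n"] set_initial[of n] red[of n]
      by (simp add: vtx_def wdist_def red_iff_len) (simp add: initial_def)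
    then show ?thesis unfolding ray_def by (simp add: affine_extension_edge_point algebra_simps)
  qed
  have le: "mdist X (ray f s) (ray f t) = t - s" if "0 \<le> s" "s \<le> t" for s t
    using ray_dist_le[OF that] height_le_mdist[of "ray f s" "ray f t" "[]"] ray_in_X h that by fastforce
  have "mdist X (ray f s) (ray f t) = \<bar>s - t\<bar>" if "0 \<le> s" "0 \<le> t" for s t
    using le[of s t] le[of t s] that mdist_commute[of X "ray f s" "ray f t"] by linarith
  moreover have "ray f 0 = vertex_point \<one>\<^bsub>racg \<Gamma>\<^esub>"
    using ray_of_nat[of f 0] by (simp add: vtx_def initial_def racg_one)
  ultimately show ?thesis
    using ray_in_X by (auto simp: geodesic_ray_def)
qed

end

end

section \<open>A connected set of boundary points\<close>

text \<open>The first three assumptions make all rays over \<Sigma> Morse with one gauge. The last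
  two concern the tree of geodesic words: it has no dead ends, and the letters that can be appended
  span a connected subgraph.\<close>

locale stable_racg = racg_graph \<Gamma> for \<Gamma> :: "'a pair_pre_digraph" +
  fixes \<Sigma> :: "'a set"
  assumes \<Sigma>_V: "\<Sigma> \<subseteq> V"
    and \<Sigma>_no_triangle: "\<lbrakk>u \<in> \<Sigma>; v \<in> \<Sigma>; x \<in> \<Sigma>; adj u v; adj v x\<rbrakk> \<Longrightarrow> \<not> adj u x"
    and \<Sigma>_common_neighbour:
      "\<lbrakk>u \<in> \<Sigma>; v \<in> \<Sigma>; u \<noteq> v; \<not> adj u v; adj u r; adj v r; adj u r'; adj v r'\<rbrakk> \<Longrightarrow> r = r'"
    and ascent_exists: "\<lbrakk>set w \<subseteq> \<Sigma>; red w\<rbrakk> \<Longrightarrow> \<exists>s\<in>\<Sigma>. red (w @ [s])"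
    and ascents_connected:
      "\<lbrakk>set w \<subseteq> \<Sigma>; red w; P \<inter> Q = {}; P \<union> Q = {s \<in> \<Sigma>. red (w @ [s])}; P \<noteq> {}; Q \<noteq> {}\<rbrakk>
       \<Longrightarrow> \<exists>p\<in>P. \<exists>q\<in>Q. adj p q"
begin

definition ray_word :: "(nat \<Rightarrow> 'a) \<Rightarrow> bool" where
  "ray_word f \<longleftrightarrow> (\<forall>n. f n \<in> \<Sigma> \<and> red (initial f n))"

abbreviation base :: "'a gword set \<Rightarrow> real" where
  "base \<equiv> vertex_point \<one>\<^bsub>racg \<Gamma>\<^esub>"

text \<open>A quasi-geodesic is sampled at unit times and rounded to vertices at distance at most 1.
  Steps then have length at most \<open>K + C + 2\<close>; rounding and a short last time step turn
  the additive constant into \<open>C + 3\<close>. The summand \<open>K + C + 1\<close> leads from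
  an arbitrary point to the nearby sampled vertex. The ray itself does not enter.\<close>

definition word_gauge :: gauge_fun where
  "word_gauge K C =
     (let J = nat \<lceil>K + C + 2\<rceil>; A = nat \<lceil>K\<rceil>; B = nat \<lceil>C + 3\<rceil>
      in K + C + 1 + real (excursion_radius J A + J * (excursion_length J A B + 1)))"

section \<open>The Morse property with a common gauge\<close>

lemma ray_word_letters: "ray_word f \<Longrightarrow> f n \<in> V"
  using \<Sigma>_V by (auto simp: ray_word_def)

lemma ray_word_geodesic_ray: "ray_word f \<Longrightarrow> geodesic_ray X base (ray f)"
  by (rule geodesic_ray_word) (auto simp: ray_word_letters ray_word_def)

lemma ray_word_morse_ray:
  assumes "ray_word f"
  shows "morse_ray X base word_gauge (ray f)"
  unfolding morse_ray_def
proof (intro conjI allI impI ballI)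
  show "geodesic_ray X base (ray f)" by (rule ray_word_geodesic_ray[OF assms])
next
  fix K C a b :: real and c t
  assume K: "1 \<le> K" and C: "0 \<le> C"
    and *: "a \<le> b \<and> quasi_geodesic X K C {a..b} c \<and> c a \<in> ray f ` {0..} \<and> c b \<in> ray f ` {0..}"
    and t: "t \<in> {a..b}"
  interpret geodesic_word adj \<Sigma> f
  proof
    show "\<not> adj u x" if "u \<in> \<Sigma>" "v \<in> \<Sigma>" "x \<in> \<Sigma>" "adj u v" "adj v x" for u v x
      by (rule \<Sigma>_no_triangle[OF that])
    show "r = r'" if "u \<in> \<Sigma>" "v \<in> \<Sigma>" "u \<noteq> v" "\<not> adj u v" "adj u r" "adj v r" "adj u r'" "adj v r'"
      for u v r r' by (rule \<Sigma>_common_neighbour[OF that])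
    show "f n \<in> \<Sigma>" "red (initial f n)" for n using assms by (auto simp: ray_word_def)
  qed
  have f_V: "f n \<in> V" for n using assms by (rule ray_word_letters)
  have c_X: "c s \<in> mspace X" if "a \<le> s" "s \<le> b" for s
    using * that by (auto simp: quasi_geodesic_def)
  have upper: "mdist X (c s) (c s') \<le> K * \<bar>s - s'\<bar> + C"
    and lower: "1 / K * \<bar>s - s'\<bar> - C \<le> mdist X (c s) (c s')"
    if "a \<le> s" "s \<le> b" "a \<le> s'" "s' \<le> b" for s s'
    using * that by (auto simp: quasi_geodesic_def)
  \<comment> \<open>The last sample is cut off at \<open>b\<close>, so that both endpoints, which
    lie on the ray, are sampled.\<close>
  define \<tau> where "\<tau> i = min (a + real i) b" for i
  define m where "m = nat \<lceil>b - a\<rceil>"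
  define x where "x i = (SOME w. set w \<subseteq> V \<and> mdist X (c (\<tau> i)) (vertex_point (cls w)) \<le> 1)" for i
  have \<tau>: "a \<le> \<tau> i" "\<tau> i \<le> b" for i using * by (auto simp: \<tau>_def)
  have x: "set (x i) \<subseteq> V" "mdist X (c (\<tau> i)) (vertex_point (cls (x i))) \<le> 1" for i
    using someI_ex[OF near_vertex[OF c_X[OF \<tau>]]] unfolding x_def by auto
  have x_X: "vertex_point (cls (x i)) \<in> mspace X" for i using x by (intro vertex_in_X)
  have c\<tau>_X: "c (\<tau> i) \<in> mspace X" for i using c_X \<tau> by blast
  have x_le: "real (wdist (x i) (x j)) \<le> mdist X (c (\<tau> i)) (c (\<tau> j)) + 2" for i j
    using mdist_vertex[OF x(1)[of i] x(1)[of j]] x(2)[of i] x(2)[of j]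
      mdist_triangle[OF x_X[of i] c\<tau>_X[of i] x_X[of j]] mdist_triangle[OF c\<tau>_X[of i] c\<tau>_X[of j] x_X[of j]]
      mdist_commute[of X "vertex_point (cls (x i))" "c (\<tau> i)"] by linarith
  have x_ge: "mdist X (c (\<tau> i)) (c (\<tau> j)) \<le> real (wdist (x i) (x j)) + 2" for i j
    using mdist_vertex[OF x(1)[of i] x(1)[of j]] x(2)[of i] x(2)[of j]
      mdist_triangle[OF c\<tau>_X[of i] x_X[of i] c\<tau>_X[of j]] mdist_triangle[OF x_X[of i] x_X[of j] c\<tau>_X[of j]]
      mdist_commute[of X "vertex_point (cls (x j))" "c (\<tau> j)"] by linarith
  define J A B where "J = nat \<lceil>K + C + 2\<rceil>" and "A = nat \<lceil>K\<rceil>" and "B = nat \<lceil>C + 3\<rceil>"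
  have JAB: "K + C + 2 \<le> real J" "K \<le> real A" "C + 3 \<le> real B"
    unfolding J_def A_def B_def by (rule real_nat_ceiling_ge)+
  then have "0 < real J" using K C by linarith
  then have J: "0 < J" by simp
  have step: "wdist (x i) (x (Suc i)) \<le> J" for i
  proof -
    have "\<bar>\<tau> i - \<tau> (Suc i)\<bar> \<le> 1" by (auto simp: \<tau>_def min_def)
    then have "K * \<bar>\<tau> i - \<tau> (Suc i)\<bar> \<le> K * 1" using K by (intro mult_left_mono) auto
    then have "real (wdist (x i) (x (Suc i))) \<le> real J"
      using x_le[of i "Suc i"] upper[OF \<tau> \<tau>, of i "Suc i"] JAB(1) by linarith
    then show ?thesis by simp
  qed
  have qg: "j - i \<le> A * (wdist (x i) (x j) + B)" if ij: "i \<le> j" "j \<le> m" for i j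
  proof -
    have "real j \<le> b - a + 1" using ij * unfolding m_def by linarith
    then have 1: "real (j - i) \<le> \<bar>\<tau> i - \<tau> j\<bar> + 1"
      using ij by (auto simp: \<tau>_def min_def of_nat_diff)
    have "1 / K * \<bar>\<tau> i - \<tau> j\<bar> \<le> real (wdist (x i) (x j)) + 2 + C"
      using lower[OF \<tau> \<tau>, of i j] x_ge[of i j] by linarith
    then have "\<bar>\<tau> i - \<tau> j\<bar> \<le> K * (real (wdist (x i) (x j)) + 2 + C)"
      using K by (simp add: field_simps)
    then have "real (j - i) \<le> K * (real (wdist (x i) (x j)) + (C + 3))"
      using 1 K by (simp add: algebra_simps)
    also have "\<dots> \<le> real A * (real (wdist (x i) (x j)) + real B)"
      using JAB K C by (intro mult_mono) auto
    also have "\<dots> = real (A * (wdist (x i) (x j) + B))" by simp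
    finally show ?thesis by (simp only: of_nat_le_iff)
  qed
  have initial_V: "set (initial f n) \<subseteq> V" for n using set_initial f_V by blast
  have ray_X: "ray f s \<in> mspace X" if "0 \<le> s" for s using ray_in_X f_V that by blast
  \<comment> \<open>One unit for rounding the point of the ray down to a vertex, one for rounding
    the sample.\<close>
  have end_near: "\<exists>l. wdist (initial f l) (x i) \<le> 2" if "c (\<tau> i) \<in> ray f ` {0..}" for i
  proof -
    obtain s where s: "0 \<le> s" "c (\<tau> i) = ray f s" using \<open>c (\<tau> i) \<in> ray f ` {0..}\<close> by auto
    define l where "l = nat \<lfloor>s\<rfloor>"
    have l: "real l \<le> s" "s \<le> real l + 1" using s(1) by (auto simp: l_def)
    have "mdist X (ray f (real l)) (ray f s) \<le> 1"
      using ray_dist_le[of f "real l" s] f_V l by simp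
    moreover have "mdist X (ray f (real l)) (vertex_point (cls (x i))) = real (wdist (initial f l) (x i))"
      unfolding ray_of_nat vtx_def by (intro mdist_vertex initial_V x)
    ultimately have "real (wdist (initial f l) (x i)) \<le> 2"
      using mdist_triangle[OF ray_X ray_X[OF s(1)] x_X[of i], of "real l"] x(2)[of i] s(2) by simp
    then show ?thesis by (intro exI[of _ l]) simp
  qed
  have "\<tau> 0 = a" "\<tau> m = b" using * by (auto simp: \<tau>_def m_def) linarith
  then obtain l0 l1 where l: "wdist (initial f l0) (x 0) \<le> 2" "wdist (initial f l1) (x m) \<le> 2"
    using end_near[of 0] end_near[of m] * by auto
  define i where "i = nat \<lfloor>t - a\<rfloor>"
  have i: "i \<le> m" "\<tau> i \<le> t" "t \<le> \<tau> i + 1"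
    using t by (auto simp: i_def m_def \<tau>_def min_def intro!: nat_mono) linarith+
  define D where "D = excursion_radius J A + J * (excursion_length J A B + 1)"
  obtain k where k: "wdist (initial f k) (x i) \<le> D"
    using quasi_geodesic_near_ray[OF J step qg l i(1)] unfolding D_def by blast
  have rk: "mdist X (vertex_point (cls (x i))) (ray f (real k)) \<le> real D"
    using k mdist_vertex[OF x(1)[of i] initial_V[of k]] wdist_commute[of "x i"] by (simp add: ray_of_nat vtx_def)
  have "K * \<bar>t - \<tau> i\<bar> \<le> K * 1" using i K by (intro mult_left_mono) auto
  then have "mdist X (c t) (c (\<tau> i)) \<le> K + C"
    using upper[OF _ _ \<tau>, of t i] t by simp
  then have "mdist X (c t) (ray f (real k)) \<le> K + C + 1 + real D"
    using mdist_triangle[OF c_X c\<tau>_X[of i] ray_X, of t "real k"]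
      mdist_triangle[OF c\<tau>_X[of i] x_X[of i] ray_X, of "real k"] rk x(2)[of i] t by simp
  then show "\<exists>s\<ge>0. mdist X (c t) (ray f s) \<le> word_gauge K C"
    by (intro exI[of _ "real k"]) (simp add: word_gauge_def J_def A_def B_def D_def Let_def)
qed

lemma morse_gauge_word_gauge: "morse_gauge word_gauge"
  by (auto simp: morse_gauge_def word_gauge_def Let_def)

section \<open>Boundary points of words and their limits\<close>

definition bdry_point :: "(nat \<Rightarrow> 'a) \<Rightarrow> (real \<Rightarrow> 'a gword set \<Rightarrow> real) set" where
  "bdry_point f = asymptotic X base `` {ray f}"

lemma ray_word_morse_rays: "ray_word f \<Longrightarrow> ray f \<in> morse_rays X base"
  unfolding morse_rays_def
  by (intro CollectI exI[of _ word_gauge] conjI ray_word_morse_ray morse_gauge_word_gauge)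

lemma ray_in_bdry_point: "ray_word f \<Longrightarrow> ray f \<in> bdry_point f"
  unfolding bdry_point_def by (rule equiv_class_self[OF equiv_asymptotic ray_word_morse_rays])

lemma bdry_point_in_stratum: "ray_word f \<Longrightarrow> bdry_point f \<in> morse_stratum X base word_gauge"
  unfolding morse_stratum_def morse_boundary_def
  using ray_in_bdry_point ray_word_morse_ray quotientI[OF ray_word_morse_rays] by (force simp: bdry_point_def)

lemma ray_from_base:
  assumes "ray_word f" "0 \<le> t"
  shows "mdist X base (ray f t) = t"
proof -
  have "ray f 0 = base" "\<forall>s\<ge>0. \<forall>t\<ge>0. mdist X (ray f s) (ray f t) = \<bar>s - t\<bar>"
    using ray_word_geodesic_ray[OF assms(1)] unfolding geodesic_ray_def by blast+
  then show ?thesis using assms(2) by (metis abs_minus_commute abs_of_nonneg diff_zero order_refl)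
qed

lemma ray_word_ray_in_X: "ray_word f \<Longrightarrow> 0 \<le> t \<Longrightarrow> ray f t \<in> mspace X"
  by (rule ray_in_X) (rule ray_word_letters)

lemma ray_cong: "(\<And>n. n \<le> Suc (nat \<lfloor>t\<rfloor>) \<Longrightarrow> nat \<lfloor>t\<rfloor> \<le> n \<Longrightarrow> vtx f n = vtx g n) \<Longrightarrow> ray f t = ray g t"
  by (simp add: ray_def)

lemma bdry_point_eqI:
  assumes f: "ray_word f" and g: "ray_word g" and eq: "\<And>n. n0 \<le> n \<Longrightarrow> vtx f n = vtx g n"
  shows "bdry_point f = bdry_point g"
proof -
  have in_X: "ray f t \<in> mspace X" "ray g t \<in> mspace X" if "0 \<le> t" for t
    using ray_word_ray_in_X[OF f that] ray_word_ray_in_X[OF g that] .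
  have "mdist X (ray f t) (ray g t) \<le> 2 * real n0" if t: "0 \<le> t" for t
  proof (cases "real n0 \<le> t")
    case True
    then have "n0 \<le> nat \<lfloor>t\<rfloor>" by linarith
    then have "ray f t = ray g t" using eq by (intro ray_cong) auto
    then show ?thesis using mdist_zero[OF in_X(2)[OF t] in_X(2)[OF t]] by simp
  next
    case False
    have "base \<in> mspace X" using vertex_in_X[of "[]"] by (simp add: racg_one)
    then show ?thesis
      using mdist_triangle[OF in_X(1)[OF t] _ in_X(2)[OF t], of base] ray_from_base[OF f t]
        ray_from_base[OF g t] False mdist_commute[of X base "ray f t"] by simp
  qed
  then have "bdd_above ((\<lambda>t. mdist X (ray f t) (ray g t)) ` {0..})"
    by (intro bdd_aboveI2[of _ _ "2 * real n0"]) auto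
  then have "(ray f, ray g) \<in> asymptotic X base"
    using f g ray_word_morse_rays by (simp add: asymptotic_def)
  then show ?thesis unfolding bdry_point_def by (rule equiv_class_eq[OF equiv_asymptotic])
qed

text \<open>A bounded set of times involves finitely many letters, so the rays eventually coincide
  there with the limit ray; every subsequence converges as it stands.\<close>

lemma stratum_converges_words:
  assumes ray_word: "ray_word \<rho>" "\<And>n. ray_word (g n)" and agree: "\<And>n i. i < n \<Longrightarrow> g n i = \<rho> i"
  shows "stratum_converges X base word_gauge (\<lambda>n. bdry_point (g n)) (bdry_point \<rho>)"
  unfolding stratum_converges_def
proof (intro exI[of _ "\<lambda>n. ray (g n)"] conjI allI impI)
  show "morse_ray X base word_gauge (ray (g n))" "ray (g n) \<in> bdry_point (g n)" for n
    using ray_word_morse_ray[OF ray_word(2)] ray_in_bdry_point[OF ray_word(2)] .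
next
  fix r :: "nat \<Rightarrow> nat" assume r: "strict_mono r"
  have "ray_limit X ((\<lambda>n. ray (g n)) \<circ> r \<circ> id) (ray \<rho>)"
    unfolding ray_limit_def
  proof (intro allI impI)
    fix S :: "real set" and \<epsilon> :: real
    assume S: "compact S \<and> S \<subseteq> {0..}" and \<epsilon>: "\<epsilon> > 0"
    obtain b where b: "\<And>t. t \<in> S \<Longrightarrow> t \<le> b"
      using S compact_imp_bounded[of S] unfolding bounded_iff by (fastforce simp: abs_le_iff)
    have "mdist X (ray (g (r n)) t) (ray \<rho> t) < \<epsilon>" if n: "nat \<lceil>b\<rceil> + 1 \<le> n" and t: "t \<in> S" for n t
    proof -
      have "0 \<le> t" "t \<le> b" using S t b by auto
      have "n \<le> r n" using r by (rule strict_mono_imp_increasing)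
      then have "Suc (nat \<lfloor>t\<rfloor>) \<le> r n" using n \<open>t \<le> b\<close> by linarith
      then have "initial (g (r n)) k = initial \<rho> k" if "k \<le> Suc (nat \<lfloor>t\<rfloor>)" for k
        using that agree unfolding initial_def by simp
      then have "ray (g (r n)) t = ray \<rho> t" by (intro ray_cong) (simp add: vtx_def)
      then show ?thesis
        using \<epsilon> mdist_zero[OF ray_word_ray_in_X ray_word_ray_in_X, OF ray_word(1) _ ray_word(1), of t t] \<open>0 \<le> t\<close> by simp
    qed
    then show "\<forall>\<^sub>F n in sequentially. \<forall>t\<in>S. mdist X (((\<lambda>n. ray (g n)) \<circ> r \<circ> id) n t) (ray \<rho> t) < \<epsilon>"
      unfolding eventually_sequentially comp_def id_def
      by (intro exI[of _ "nat \<lceil>b\<rceil> + 1"] allI impI ballI)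
  qed
  then show "\<exists>q \<alpha>. strict_mono q \<and> geodesic_ray X base \<alpha> \<and> \<alpha> \<in> bdry_point \<rho> \<and>
      ray_limit X ((\<lambda>n. ray (g n)) \<circ> r \<circ> q) \<alpha>"
    using ray_word_geodesic_ray[OF ray_word(1)] ray_in_bdry_point[OF ray_word(1)]
    by (intro exI[of _ id] exI[of _ "ray \<rho>"] conjI) (simp_all add: strict_mono_def)
qed

lemma openin_approx:
  assumes ray_word: "ray_word \<rho>" "\<And>n. ray_word (g n)" and agree: "\<And>n i. i < n \<Longrightarrow> g n i = \<rho> i"
    and U: "openin (morse_boundary_topology X base) U" "bdry_point \<rho> \<in> U"
  shows "\<exists>n. bdry_point (g n) \<in> U"
proof (rule ccontr)
  let ?C = "morse_stratum X base word_gauge - U \<inter> morse_stratum X base word_gauge"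
  assume "\<nexists>n. bdry_point (g n) \<in> U"
  then have g: "\<forall>n. bdry_point (g n) \<in> ?C" using bdry_point_in_stratum[OF ray_word(2)] by blast
  have "stratum_closed X base word_gauge ?C"
    using U(1) morse_gauge_word_gauge
    unfolding openin_morse_boundary_topology openin_stratum_topology by blast
  then have "x \<in> ?C"
    if "\<forall>n. xs n \<in> ?C" "x \<in> morse_stratum X base word_gauge" "stratum_converges X base word_gauge xs x" for xs x
    using that unfolding stratum_closed_def by blast
  from this[OF g bdry_point_in_stratum[OF ray_word(1)] stratum_converges_words[of \<rho> g, OF ray_word agree]]
  have "bdry_point \<rho> \<in> ?C" .
  then show False using U(2) by blast
qed

text \<open>Dependent choice: the absence of dead ends takes the place of Koenig's lemma.\<close>

lemma extend_word:
  assumes P: "\<And>w. P w \<Longrightarrow> \<exists>s. P (w @ [s])" and w0: "P w0"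
  shows "\<exists>f. initial f (length w0) = w0 \<and> (\<forall>n\<ge>length w0. P (initial f n))"
proof -
  obtain nx where nx: "\<And>w. P w \<Longrightarrow> P (w @ [nx w])" using P by metis
  define W where "W = rec_nat w0 (\<lambda>_ w. w @ [nx w])"
  have W: "W 0 = w0" "W (Suc k) = W k @ [nx (W k)]" for k by (simp_all add: W_def)
  define f where "f i = (if i < length w0 then w0 ! i else nx (W (i - length w0)))" for i
  have "initial f (length w0) = map ((!) w0) [0..<length w0]"
    unfolding initial_def by (simp add: f_def)
  then have 0: "initial f (length w0) = w0" by (simp add: map_nth)
  have "initial f (length w0 + k) = W k \<and> P (W k)" for k
  proof (induction k)
    case (Suc k)
    then show ?case using nx by (simp add: W initial_Suc) (simp add: f_def)
  qed (use 0 w0 W in simp)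
  then have "P (initial f n)" if "length w0 \<le> n" for n
    using that by (metis le_add_diff_inverse)
  with 0 show ?thesis by blast
qed

lemma ray_wordI:
  assumes "\<And>n. n0 \<le> n \<Longrightarrow> set (initial f n) \<subseteq> \<Sigma> \<and> red (initial f n)"
  shows "ray_word f"
proof -
  have "f n \<in> set (initial f (n0 + Suc n))" for n
    unfolding initial_def set_map by (rule imageI) auto
  moreover have "red (initial f n)" for n
    using assms[of "n0 + n"] initial_split[of n "n0 + n" f] red_appendD(1)[of "initial f n" "map f [n..<n0 + n]"]
    by simp
  ultimately show ?thesis using assms unfolding ray_word_def by (metis le_add1 subsetD)
qed

lemma ray_word_extension:
  assumes "set w \<subseteq> \<Sigma>" "red w"
  shows "\<exists>f. ray_word f \<and> initial f (length w) = w"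
proof -
  have "\<exists>s. set (w @ [s]) \<subseteq> \<Sigma> \<and> red (w @ [s])" if "set w \<subseteq> \<Sigma> \<and> red w" for w
    using ascent_exists[of w] that by auto
  from extend_word[of "\<lambda>w. set w \<subseteq> \<Sigma> \<and> red w", OF this, of w]
  obtain f where f: "initial f (length w) = w" "\<forall>n\<ge>length w. set (initial f n) \<subseteq> \<Sigma> \<and> red (initial f n)"
    using assms by blast
  have "ray_word f" by (rule ray_wordI[of "length w"]) (rule f(2)[rule_format])
  with f(1) show ?thesis by blast
qed

section \<open>Boundary points shared by two branches\<close>

lemma red_swap_last:
  assumes "red (w @ [p])" "red (w @ [q])" "adj p q"
  shows "red (w @ [p, q])"
proof -
  have "\<not> desc q (p # rev w)"
    using assms red_snoc[of w q] desc_Cons_adj[OF E_sym[OF assms(3)]] by blast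
  then show ?thesis using assms(1) red_snoc[of "w @ [p]" q] by simp
qed

text \<open>
  The two commuting orders of the same square give two ways of describing a single boundary point,
  as with the two binary expansions of a dyadic rational.
\<close>

lemma shared_point:
  assumes "set w \<subseteq> \<Sigma>" "p \<in> \<Sigma>" "q \<in> \<Sigma>" "red (w @ [p])" "red (w @ [q])" "adj p q"
  shows "\<exists>f g. ray_word f \<and> ray_word g \<and> initial f (Suc (length w)) = w @ [p] \<and> initial g (Suc (length w)) = w @ [q] \<and>
    bdry_point f = bdry_point g"
proof -
  let ?n = "length w"
  obtain f where f: "ray_word f" "initial f (length (w @ [p, q])) = w @ [p, q]"
    using ray_word_extension[of "w @ [p, q]"] red_swap_last assms by fastforce
  \<comment> \<open>Only the two letters after \<open>w\<close> are exchanged; all longer prefixes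
    of \<open>f\<close> and \<open>g\<close> represent the same elements, so the rays agree from
    there on.\<close>
  define g where "g = f(?n := q, Suc ?n := p)"
  have pq: "initial f (Suc (Suc ?n)) = w @ [p, q]" using f(2) by simp
  then have fw: "initial f ?n = w" "f ?n = p" "f (Suc ?n) = q" by (simp_all add: initial_Suc)
  have "initial g ?n = initial f ?n" by (simp add: initial_def g_def)
  then have gw: "initial g ?n = w" using fw(1) by simp
  have g2: "initial g (Suc ?n) = w @ [q]" "initial g (Suc (Suc ?n)) = w @ [q, p]"
    by (simp_all add: initial_Suc gw) (simp_all add: g_def)
  have tail: "initial g n = w @ q # p # map f [Suc (Suc ?n)..<n] \<and> initial f n = w @ p # q # map f [Suc (Suc ?n)..<n]"
    if "Suc (Suc ?n) \<le> n" for n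
  proof -
    have "map g [Suc (Suc ?n)..<n] = map f [Suc (Suc ?n)..<n]" by (simp add: g_def)
    then show ?thesis using initial_split[OF that, of g] initial_split[OF that, of f] g2 pq by simp
  qed
  have "set (initial g n) \<subseteq> \<Sigma> \<and> red (initial g n)" if "Suc (Suc ?n) \<le> n" for n
  proof -
    have "red (initial f n)" "f k \<in> \<Sigma>" for k using f(1) by (auto simp: ray_word_def)
    then show ?thesis
      using tail[OF that] red_cong[OF cong_swap[OF assms(6)], of w "map f [Suc (Suc ?n)..<n]"] assms(1,2,3)
      by auto
  qed
  then have g: "ray_word g" by (rule ray_wordI)
  have "vtx f n = vtx g n" if n: "Suc (Suc ?n) \<le> n" for n
  proof -
    have V: "set (map f [Suc (Suc ?n)..<n]) \<subseteq> V" "set w \<subseteq> V" "p \<in> V" "q \<in> V"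
      using ray_word_letters[OF f(1)] assms(1,2,3) \<Sigma>_V by auto
    have "(gword (initial f n), gword (initial g n)) \<in> R"
      using rel_context[OF rel_swap[OF assms(6)] V(2,1)] tail[OF n] by simp
    then show ?thesis
      unfolding vtx_def using cls_eq_iff_rel[of "initial g n" "initial f n"] set_initial[OF ray_word_letters[OF f(1)]]
        set_initial[OF ray_word_letters[OF g]] by simp
  qed
  then have "bdry_point f = bdry_point g" by (rule bdry_point_eqI[OF f(1) g])
  then show ?thesis using f(1) g fw(1,2) g2(1) by (intro exI[of _ f] exI[of _ g]) (simp add: initial_Suc)
qed

section \<open>The tree of straddling words and connectedness\<close>

definition straddles :: "(real \<Rightarrow> 'a gword set \<Rightarrow> real) set set \<Rightarrow> (real \<Rightarrow> 'a gword set \<Rightarrow> real) set set \<Rightarrow> 'a list \<Rightarrow> bool" where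
  "straddles U W w \<longleftrightarrow> set w \<subseteq> \<Sigma> \<and> red w \<and>
     (\<exists>f g. ray_word f \<and> ray_word g \<and> initial f (length w) = w \<and> initial g (length w) = w \<and> bdry_point f \<in> U \<and> bdry_point g \<in> W)"

text \<open>If no letter kept both kinds of continuation, each appendable letter would force
  \<open>U\<close> or force \<open>W\<close>. Some adjacent \<open>p\<close> and \<open>q\<close>
  would then force different sets, yet their branches share a boundary point.\<close>

lemma straddles_step:
  assumes cover: "\<And>f. ray_word f \<Longrightarrow> bdry_point f \<in> U \<union> W" and disj: "\<And>f. ray_word f \<Longrightarrow> bdry_point f \<notin> U \<inter> W"
    and w: "straddles U W w"
  shows "\<exists>s. straddles U W (w @ [s])"
proof (rule ccontr)
  assume none: "\<nexists>s. straddles U W (w @ [s])"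
  let ?up = "{s \<in> \<Sigma>. red (w @ [s])}"
  define P where "P = {s \<in> ?up. \<forall>f. ray_word f \<and> initial f (Suc (length w)) = w @ [s] \<longrightarrow> bdry_point f \<in> U}"
  define Q where "Q = {s \<in> ?up. \<forall>f. ray_word f \<and> initial f (Suc (length w)) = w @ [s] \<longrightarrow> bdry_point f \<in> W}"
  have w\<Sigma>: "set w \<subseteq> \<Sigma>" "red w" using w by (auto simp: straddles_def)
  have ext: "\<exists>f. ray_word f \<and> initial f (Suc (length w)) = w @ [s]" if "s \<in> ?up" for s
    using ray_word_extension[of "w @ [s]"] w\<Sigma> that by auto
  have "P \<inter> Q = {}"
    using ext disj unfolding P_def Q_def by fastforce
  moreover have "s \<in> P \<union> Q" if s: "s \<in> ?up" for s
  proof (rule ccontr)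
    assume "s \<notin> P \<union> Q"
    then obtain f g where fg: "ray_word f" "initial f (Suc (length w)) = w @ [s]" "bdry_point f \<notin> U"
        "ray_word g" "initial g (Suc (length w)) = w @ [s]" "bdry_point g \<notin> W"
      using s unfolding P_def Q_def by blast
    then have "bdry_point f \<in> W" "bdry_point g \<in> U" using cover by blast+
    then have "straddles U W (w @ [s])"
      unfolding straddles_def using s w\<Sigma> fg by auto
    then show False using none by blast
  qed
  then have "P \<union> Q = ?up" by (auto simp: P_def Q_def)
  moreover have first: "f (length w) \<in> ?up \<and> initial f (Suc (length w)) = w @ [f (length w)]"
    if "ray_word f" "initial f (length w) = w" for f
    using that unfolding ray_word_def by (metis (mono_tags, lifting) mem_Collect_eq initial_Suc)
  obtain f g where fg: "ray_word f" "ray_word g" "initial f (length w) = w" "initial g (length w) = w" "bdry_point f \<in> U" "bdry_point g \<in> W"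
    using w unfolding straddles_def by blast
  have "f (length w) \<notin> Q" "g (length w) \<notin> P"
    using first fg disj unfolding P_def Q_def by blast+
  with first fg \<open>P \<union> Q = ?up\<close> have "P \<noteq> {}" "Q \<noteq> {}" by blast+
  ultimately obtain p q where pq: "p \<in> P" "q \<in> Q" "adj p q"
    using ascents_connected[OF w\<Sigma>, of P Q] by blast
  then have "p \<in> ?up" "q \<in> ?up" by (auto simp: P_def Q_def)
  then obtain f g where "ray_word f" "ray_word g" "initial f (Suc (length w)) = w @ [p]" "initial g (Suc (length w)) = w @ [q]"
      "bdry_point f = bdry_point g"
    using shared_point[OF w\<Sigma>(1) _ _ _ _ pq(3)] by blast
  then have "bdry_point f \<in> U" "bdry_point f \<in> W" using pq(1,2) unfolding P_def Q_def by auto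
  then show False using disj \<open>ray_word f\<close> by blast
qed

lemma connectedin_words: "connectedin (morse_boundary_topology X base) (bdry_point ` Collect ray_word)"
proof -
  let ?T = "morse_boundary_topology X base" and ?S = "bdry_point ` Collect ray_word"
  have "?S \<subseteq> topspace ?T"
    using bdry_point_in_stratum by (auto simp: morse_stratum_def)
  moreover have False if UW: "openin ?T U" "openin ?T W" "?S \<subseteq> U \<union> W" "U \<inter> W \<inter> ?S = {}" "U \<inter> ?S \<noteq> {}" "W \<inter> ?S \<noteq> {}"
    for U W
  proof -
    have cover: "bdry_point f \<in> U \<union> W" and disj: "bdry_point f \<notin> U \<inter> W" if "ray_word f" for f
      using UW(3,4) that by blast+
    have "straddles U W []"
      using UW(5,6) unfolding straddles_def by (fastforce simp: initial_def)
    then obtain \<rho> where \<rho>: "\<And>n. straddles U W (initial \<rho> n)"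
      using extend_word[of "straddles U W" "[]"] straddles_step[OF cover disj] by auto
    have ray_word: "ray_word \<rho>" using \<rho> by (intro ray_wordI[of 0]) (auto simp: straddles_def)
    have len: "length (initial \<rho> n) = n" for n by (simp add: initial_def)
    have "\<exists>f g. ray_word f \<and> ray_word g \<and> initial f n = initial \<rho> n \<and> initial g n = initial \<rho> n \<and> bdry_point f \<in> U \<and> bdry_point g \<in> W" for n
      using \<rho>[of n] unfolding straddles_def len by blast
    then obtain F G where FG: "\<And>n. ray_word (F n)" "\<And>n. ray_word (G n)" "\<And>n. initial (F n) n = initial \<rho> n"
        "\<And>n. initial (G n) n = initial \<rho> n" "\<And>n. bdry_point (F n) \<in> U" "\<And>n. bdry_point (G n) \<in> W"
      by metis
    have agree: "h i = \<rho> i" if "initial h n = initial \<rho> n" "i < n" for h n i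
      using arg_cong[OF that(1), of "\<lambda>w. w ! i"] that(2) by (simp add: initial_def)
    have agreeF: "F n i = \<rho> i" and agreeG: "G n i = \<rho> i" if "i < n" for n i
      using agree FG(3,4) that by blast+
    \<comment> \<open>The limit word is approximated from both sides; the open set containing its
      boundary point also contains approximating points taken from the other set.\<close>
    show False
      using cover[OF ray_word]
    proof
      assume "bdry_point \<rho> \<in> U"
      then obtain n where "bdry_point (G n) \<in> U"
        using openin_approx[of \<rho> G U, OF ray_word FG(2) agreeG UW(1)] by blast
      then show False using FG disj by blast
    next
      assume "bdry_point \<rho> \<in> W"
      then obtain n where "bdry_point (F n) \<in> W"
        using openin_approx[of \<rho> F W, OF ray_word FG(1) agreeF UW(2)] by blast
      then show False using FG disj by blast
    qed
  qed
  ultimately show ?thesis unfolding connectedin by (intro conjI notI) (assumption, elim exE conjE)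
qed

section \<open>Two different boundary points\<close>

lemma ray_word_alternating:
  assumes "a \<in> \<Sigma>" "b \<in> \<Sigma>" "a \<noteq> b" "\<not> adj a b"
  shows "ray_word (\<lambda>n. if even n then a else b)"
proof -
  let ?f = "\<lambda>n::nat. if even n then a else b"
  have "red (map ?f [m..<n])" if "m \<le> n" for m n
    using that
  proof (induction m rule: inc_induct)
    case (step m)
    have "\<not> front (?f m) (map ?f [Suc m..<n])"
      using assms(3,4) E_sym[of b a] by (cases "Suc m < n") (auto simp: upt_conv_Cons)
    then show ?case using step by (simp add: upt_conv_Cons del: upt_Suc)
  qed simp
  then show ?thesis using assms by (auto simp: ray_word_def initial_def)
qed

text \<open>Reduced words in disjoint letters have no common descent, so their lengths add and the
  two rays diverge at speed 2.\<close>

lemma distinct_points: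
  assumes ab: "a \<in> \<Sigma>" "b \<in> \<Sigma>" "a \<noteq> b" "\<not> adj a b"
    and cd: "c \<in> \<Sigma>" "d \<in> \<Sigma>" "c \<noteq> d" "\<not> adj c d"
    and disj: "{a, b} \<inter> {c, d} = {}"
  shows "\<exists>f g. ray_word f \<and> ray_word g \<and> bdry_point f \<noteq> bdry_point g"
proof -
  let ?f = "\<lambda>n::nat. if even n then a else b" and ?g = "\<lambda>n::nat. if even n then c else d"
  have f: "ray_word ?f" and g: "ray_word ?g" using ray_word_alternating ab cd by blast+
  have "bdry_point ?f \<noteq> bdry_point ?g"
  proof
    assume "bdry_point ?f = bdry_point ?g"
    then have "(ray ?f, ray ?g) \<in> asymptotic X base"
      unfolding bdry_point_def by (rule eq_equiv_class[OF _ equiv_asymptotic ray_word_morse_rays[OF g]])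
    then obtain M where M: "\<And>t. 0 \<le> t \<Longrightarrow> mdist X (ray ?f t) (ray ?g t) \<le> M"
      by (auto simp: asymptotic_def bdd_above_def)
    define n where "n = nat \<lceil>M\<rceil> + 1"
    have in_set: "s \<in> set w" if "desc s w" "red w" for s w
      using that front_in_set by (simp add: desc_def nf_red)
    have red: "red (initial ?f n)" "red (initial ?g n)" using f g by (simp_all add: ray_word_def)
    have "set (initial ?f n) \<inter> set (initial ?g n) = {}" using disj by (auto simp: initial_def)
    then have "wdist (initial ?f n) (initial ?g n) = len (initial ?f n) + len (initial ?g n)"
      unfolding wdist_def using in_set red by (intro len_rev_append) blast
    also have "\<dots> = 2 * n" using red by (simp add: red_iff_len) (simp add: initial_def)
    finally have "mdist X (ray ?f (real n)) (ray ?g (real n)) = 2 * real n"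
      unfolding ray_of_nat vtx_def
      using mdist_vertex[OF set_initial[OF ray_word_letters[OF f]] set_initial[OF ray_word_letters[OF g]]] by simp
    then have "2 * real n \<le> M" using M[of "real n"] by simp
    moreover have "M \<le> real (nat \<lceil>M\<rceil>)" by (rule real_nat_ceiling_ge)
    moreover have "real n = real (nat \<lceil>M\<rceil>) + 1" by (simp add: n_def)
    ultimately show False by linarith
  qed
  with f g show ?thesis by blast
qed

end

text \<open>Letters that cannot be appended to a reduced word are descents of its inverse, hence
  pairwise adjacent. Such a clique cannot contain two vertices at distance two on the cycle, nor
  meet both open arcs between two other vertices.\<close>

lemma (in racg_graph) induced_cycle_stable:
  assumes tf: "triangle_free \<Gamma>" and \<sigma>: "induced_cycle \<Gamma> \<sigma>" "length \<sigma> > 4"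
    and no_square: "\<not> (\<exists>\<tau> u v. induced_cycle \<Gamma> \<tau> \<and> length \<tau> = 4 \<and>
               u \<in> set \<tau> \<and> v \<in> set \<tau> \<and> u \<noteq> v \<and> (u, v) \<notin> parcs \<Gamma> \<and>
               u \<in> set \<sigma> \<and> v \<in> set \<sigma>)"
  shows "stable_racg \<Gamma> (set \<sigma>)"
proof
  let ?n = "length \<sigma>"
  have \<sigma>_adj: "adj (\<sigma> ! i) (\<sigma> ! j) \<longleftrightarrow> j = Suc i mod ?n \<or> i = Suc j mod ?n" if "i < ?n" "j < ?n" for i j
    using \<sigma>(1) that unfolding induced_cycle_def by blast
  have "\<sigma> \<noteq> []" using \<sigma>(2) by auto
  have dist: "distinct \<sigma>" using \<sigma>(1) by (simp add: induced_cycle_def)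
  show "set \<sigma> \<subseteq> V" using \<sigma>(1) by (simp add: induced_cycle_def)
  have no_tri: "\<not> adj u x" if "adj u v" "adj v x" for u v x
    using tf that E_sym unfolding triangle_free_def by blast
  show "\<not> adj u x" if "adj u v" "adj v x" for u v x by (rule no_tri[OF that])
  show "r = r'" if uv: "u \<in> set \<sigma>" "v \<in> set \<sigma>" "u \<noteq> v" "\<not> adj u v"
    and r: "adj u r" "adj v r" "adj u r'" "adj v r'" for u v r r'
  proof (rule ccontr)
    assume "r \<noteq> r'"
    \<comment> \<open>Without triangles \<open>r\<close> and \<open>r'\<close> are not adjacent, so
      \<open>u\<close>, \<open>r\<close>, \<open>v\<close>, \<open>r'\<close> would be an induced
      square.\<close>
    have nr: "\<not> adj r r'" "\<not> adj r' r" "\<not> adj v u"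
      using no_tri[of u r r'] r E_sym uv by blast+
    have sym: "adj r u" "adj r v" "adj r' u" "adj r' v" using r E_sym by blast+
    have V: "u \<in> V" "v \<in> V" "r \<in> V" "r' \<in> V" using r adj_verts by blast+
    have ne: "u \<noteq> r" "u \<noteq> r'" "v \<noteq> r" "v \<noteq> r'" using r E_irrefl by blast+
    have irr: "\<not> adj u u" "\<not> adj v v" "\<not> adj r r" "\<not> adj r' r'" using E_irrefl by blast+
    have "adj ([u, r, v, r'] ! i) ([u, r, v, r'] ! j) \<longleftrightarrow> j = Suc i mod 4 \<or> i = Suc j mod 4"
      if "i < 4" "j < 4" for i j
    proof -
      have "i = 0 \<or> i = 1 \<or> i = 2 \<or> i = 3" "j = 0 \<or> j = 1 \<or> j = 2 \<or> j = 3"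
        using that by linarith+
      then show ?thesis
        by (elim disjE; simp add: r sym nr irr uv(4))
    qed
    then have "induced_cycle \<Gamma> [u, r, v, r']"
      using V ne uv(3) \<open>r \<noteq> r'\<close> unfolding induced_cycle_def by auto
    moreover have "length [u, r, v, r'] = 4" "u \<in> set [u, r, v, r']" "v \<in> set [u, r, v, r']" by simp_all
    ultimately show False using no_square uv by blast
  qed
  have desc_clique: "adj s t" if "desc s w" "desc t w" "s \<noteq> t" for s t w
    using desc_desc that by blast
  show "\<exists>s\<in>set \<sigma>. red (w @ [s])" if "red w" for w
  proof -
    have "0 < ?n" "2 < ?n" using \<sigma>(2) by linarith+
    then have "\<not> adj (\<sigma> ! 0) (\<sigma> ! 2)" "\<sigma> ! 0 \<noteq> \<sigma> ! 2"
      using \<sigma>_adj[of 0 2] \<sigma>(2) dist by (simp_all add: nth_eq_iff_index_eq)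
    then have "\<not> desc (\<sigma> ! 0) (rev w) \<or> \<not> desc (\<sigma> ! 2) (rev w)"
      using desc_clique by blast
    moreover have "\<sigma> ! 0 \<in> set \<sigma>" "\<sigma> ! 2 \<in> set \<sigma>"
      using \<open>0 < ?n\<close> \<open>2 < ?n\<close> by simp_all
    ultimately show ?thesis using that red_snoc by blast
  qed
  show "\<exists>p\<in>P. \<exists>q\<in>Q. adj p q"
    if "red w" "P \<inter> Q = {}" "P \<union> Q = {s \<in> set \<sigma>. red (w @ [s])}" "P \<noteq> {}" "Q \<noteq> {}" for w P Q
  proof (rule ccontr)
    assume none: "\<not> (\<exists>p\<in>P. \<exists>q\<in>Q. adj p q)"
    have PQ: "\<sigma> ! k \<in> P \<union> Q \<longleftrightarrow> \<not> desc (\<sigma> ! k) (rev w)" if "k < ?n" for k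
      using \<open>P \<union> Q = _\<close> \<open>red w\<close> that red_snoc by simp
    \<comment> \<open>With no edge between \<open>A\<close> and \<open>B\<close>, a walk along
      either arc from \<open>i\<close> to \<open>j\<close> has to meet a descent. \<open>A\<close>
      and \<open>B\<close> stand for \<open>P\<close> and \<open>Q\<close> in either order, so that
      \<open>i < j\<close> can be assumed.\<close>
    have core: False
      if ij: "i < j" "j < ?n" "\<sigma> ! i \<in> A" "\<sigma> ! j \<in> B" and AB: "A \<union> B = P \<union> Q" "A \<inter> B = {}"
        and sep: "\<And>p q. p \<in> A \<Longrightarrow> q \<in> B \<Longrightarrow> \<not> adj p q" for i j A B
    proof -
      have suc: "adj (\<sigma> ! k) (\<sigma> ! Suc k)" if "Suc k < ?n" for k
        using \<sigma>_adj[of k "Suc k"] that by simp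
      have "\<exists>k. i < k \<and> k < j \<and> desc (\<sigma> ! k) (rev w)"
      proof (rule ccontr)
        assume nd: "\<nexists>k. i < k \<and> k < j \<and> desc (\<sigma> ! k) (rev w)"
        have "i + k \<le> j \<longrightarrow> \<sigma> ! (i + k) \<in> A" for k
        proof (induction k)
          case (Suc k)
          show ?case
          proof
            assume le: "i + Suc k \<le> j"
            then have "\<sigma> ! (i + Suc k) \<in> A \<union> B"
              using nd ij PQ[of "i + Suc k"] AB(1) by (cases "i + Suc k = j") auto
            then show "\<sigma> ! (i + Suc k) \<in> A"
              using sep suc[of "i + k"] Suc le ij by auto
          qed
        qed (use ij in simp)
        from this[of "j - i"] show False using ij AB by auto
      qed
      then obtain k where k: "i < k" "k < j" "desc (\<sigma> ! k) (rev w)" by blast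
      \<comment> \<open>The other arc wraps around: from \<open>j\<close> to the last index, on to
        0, and up to \<open>i\<close>, staying in \<open>B\<close> all the way.\<close>
      have "\<exists>l. (l < i \<or> j < l) \<and> l < ?n \<and> desc (\<sigma> ! l) (rev w)"
      proof (rule ccontr)
        assume nd: "\<nexists>l. (l < i \<or> j < l) \<and> l < ?n \<and> desc (\<sigma> ! l) (rev w)"
        have AB_mem: "\<sigma> ! l \<in> A \<union> B" if "l \<le> i \<or> j \<le> l" "l < ?n" for l
          using nd ij PQ[of l] AB(1) that by (cases "l = i \<or> l = j") auto
        have "j + l < ?n \<longrightarrow> \<sigma> ! (j + l) \<in> B" for l
        proof (induction l)
          case (Suc l)
          show ?case
          proof
            assume lt: "j + Suc l < ?n"
            then have "adj (\<sigma> ! (j + Suc l)) (\<sigma> ! (j + l))" using suc[of "j + l"] E_sym by simp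
            then show "\<sigma> ! (j + Suc l) \<in> B"
              using sep Suc lt AB_mem[of "j + Suc l"] by auto
          qed
        qed (use ij in simp)
        from this[of "?n - 1 - j"] have "\<sigma> ! (?n - 1) \<in> B" using ij by simp
        moreover have "adj (\<sigma> ! 0) (\<sigma> ! (?n - 1))"
          using \<sigma>_adj[of 0 "?n - 1"] \<open>\<sigma> \<noteq> []\<close> by simp
        ultimately have 0: "\<sigma> ! 0 \<in> B"
          using sep AB_mem[of 0] ij \<open>\<sigma> \<noteq> []\<close> by auto
        have "l \<le> i \<longrightarrow> \<sigma> ! l \<in> B" for l
        proof (induction l)
          case (Suc l)
          show ?case
          proof
            assume le: "Suc l \<le> i"
            then have "adj (\<sigma> ! Suc l) (\<sigma> ! l)" using suc[of l] E_sym ij by simp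
            then show "\<sigma> ! Suc l \<in> B" using sep Suc le AB_mem[of "Suc l"] ij by auto
          qed
        qed (use 0 in simp)
        from this[of i] show False using ij AB by auto
      qed
      then obtain l where l: "l < i \<or> j < l" "l < ?n" "desc (\<sigma> ! l) (rev w)" by blast
      \<comment> \<open>The two descents must be adjacent, but \<open>i\<close> and \<open>j\<close>
        separate the open arcs in which they lie.\<close>
      have "\<sigma> ! k \<noteq> \<sigma> ! l" using k l ij dist by (auto simp: nth_eq_iff_index_eq)
      then have "adj (\<sigma> ! k) (\<sigma> ! l)" using desc_clique k(3) l(3) by blast
      then have "l = Suc k mod ?n \<or> k = Suc l mod ?n" using \<sigma>_adj k l ij by simp
      moreover have "Suc k mod ?n = Suc k" using k ij by simp
      moreover have "Suc l mod ?n = Suc l \<or> Suc l mod ?n = 0" using l(2) by (cases "Suc l = ?n") auto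
      ultimately show False using k l ij by auto
    qed
    obtain p q where "p \<in> P" "q \<in> Q" using \<open>P \<noteq> {}\<close> \<open>Q \<noteq> {}\<close> by blast
    moreover from this have "p \<in> set \<sigma>" "q \<in> set \<sigma>" using \<open>P \<union> Q = _\<close> by blast+
    ultimately obtain i j where ij: "i < ?n" "j < ?n" "\<sigma> ! i \<in> P" "\<sigma> ! j \<in> Q"
      by (metis in_set_conv_nth)
    have "i \<noteq> j" using ij \<open>P \<inter> Q = {}\<close> by blast
    then consider "i < j" | "j < i" by linarith
    then show False
    proof cases
      case 1
      show False
        by (rule core[OF 1 ij(2,3,4)]) (use none \<open>P \<inter> Q = {}\<close> in auto)
    next
      case 2
      show False
        by (rule core[OF 2 ij(1,4,3)]) (use none \<open>P \<inter> Q = {}\<close> E_sym in blast)+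
    qed
  qed
qed

theorem corollary1p13:
  fixes \<Gamma> :: "'a pair_pre_digraph" and \<sigma> :: "'a list"
  assumes "pair_graph \<Gamma>"
    and "triangle_free \<Gamma>"
    and "induced_cycle \<Gamma> \<sigma>" and "length \<sigma> > 4"
    and "\<not> (\<exists>\<tau> u v. induced_cycle \<Gamma> \<tau> \<and> length \<tau> = 4 \<and>
               u \<in> set \<tau> \<and> v \<in> set \<tau> \<and> u \<noteq> v \<and> (u, v) \<notin> parcs \<Gamma> \<and>
               u \<in> set \<sigma> \<and> v \<in> set \<sigma>)"
  shows "\<not> totally_disconnected_space (group_morse_boundary (racg \<Gamma>) (racg_gens \<Gamma>))"
proof
  interpret racg_graph \<Gamma> by (rule racg_graph.intro) (rule assms(1))
  interpret stable_racg \<Gamma> "set \<sigma>" by (rule induced_cycle_stable[OF assms(2-5)])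
  assume "totally_disconnected_space (group_morse_boundary (racg \<Gamma>) (racg_gens \<Gamma>))"
  then obtain z where z: "bdry_point ` Collect ray_word \<subseteq> {z}"
    using connectedin_words unfolding totally_disconnected_space_def group_morse_boundary_def by blast
  have adj_iff: "adj (\<sigma> ! i) (\<sigma> ! j) \<longleftrightarrow> j = Suc i mod length \<sigma> \<or> i = Suc j mod length \<sigma>"
    if "i < length \<sigma>" "j < length \<sigma>" for i j
    using assms(3) that unfolding induced_cycle_def by blast
  have "distinct \<sigma>" using assms(3) by (simp add: induced_cycle_def)
  then have ne: "\<sigma> ! i \<noteq> \<sigma> ! j" if "i < 4" "j < 4" "i \<noteq> j" for i j
    using that assms(4) by (simp add: nth_eq_iff_index_eq)
  have lt: "0 < length \<sigma>" "1 < length \<sigma>" "2 < length \<sigma>" "3 < length \<sigma>"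
    using assms(4) by linarith+
  \<comment> \<open>Two disjoint non-adjacent pairs on the cycle give two alternating rays, so the
    connected set is not a single point.\<close>
  have "\<exists>f g. ray_word f \<and> ray_word g \<and> bdry_point f \<noteq> bdry_point g"
  proof (rule distinct_points[of "\<sigma> ! 0" "\<sigma> ! 2" "\<sigma> ! 1" "\<sigma> ! 3"])
    show "\<not> adj (\<sigma> ! 0) (\<sigma> ! 2)" "\<not> adj (\<sigma> ! 1) (\<sigma> ! 3)"
      using adj_iff[of 0 2] adj_iff[of 1 3] lt assms(4) by simp_all
    show "{\<sigma> ! 0, \<sigma> ! 2} \<inter> {\<sigma> ! 1, \<sigma> ! 3} = {}"
      using ne[of 0 1] ne[of 0 3] ne[of 2 1] ne[of 2 3] by auto
  qed (use lt ne[of 0 2] ne[of 1 3] in \<open>simp_all add: nth_mem\<close>)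
  then show False using z by blast
qed

end
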